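(* There is an ordinal lme-space $X=(\varepsilon_0,\tau_0,\tau_1,\dots)$ on the ordinal $\varepsilon_0$ such that $\mathrm{Log}(X)=\mathbf{GLP}$, i.e. for every formula $\varphi$ in the language with modalities $[k]$, $k<\omega$, $\varphi$ is valid in $X$ if and only if $\mathbf{GLP}\vdash\varphi$.
   Context: The logic $\mathbf{GLP}$ is formulated in the propositional modal language with modalities $[0],[1],[2],\dots$, where $\langle n\rangle\varphi$ stands for $\neg[n]\neg\varphi$. Axiom schemata: (i) Boolean tautologies; (ii) $[n](\varphi\to\psi)\to([n]\varphi\to[n]\psi)$; (iii) $[n]([n]\varphi\to\varphi)\to[n]\varphi$; (iv) $[m]\varphi\to[n]\varphi$ for $m<n$; (v) $\langle m\rangle\varphi\to[n]\langle m\rangle\varphi$ for $m<n$. Rules: modus ponens and necessitation ($\vdash\varphi$ implies $\vdash[n]\varphi$, for each $n$). For a topological space $(X,\tau)$, $d_\tau(A)$ is the set of limit points of $A\subseteq X$ ($x\in d_\tau(A)$ iff every open neighborhood of $x$ contains some $y\neq x$ with $y\in A$). A valuation $v$ on a polytopological space $(X,\tau_0,\tau_1,\dots)$ assigns subsets of $X$ to variables and is extended by $v(\varphi\lor\psi)=v(\varphi)\cup v(\psi)$, $v(\neg\varphi)=X\setminus v(\varphi)$, $v(\bot)=\emptyset$, $v(\langle n\rangle\varphi)=d_{\tau_n}(v(\varphi))$, $v([n]\varphi)=X\setminus d_{\tau_n}(X\setminus v(\varphi))$. A formula is valid in $X$ if $v(\varphi)=X$ for all $v$; $\mathrm{Log}(X)$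 is the set of formulas valid in $X$. A space is scattered if every nonempty subspace has an isolated point. For a scattered space $(X,\tau)$ let $d^0X=X$, $d^{\alpha+1}X=d_\tau(d^\alpha X)$, $d^\alpha X=\bigcap_{\beta<\alpha}d^\beta X$ for limit $\alpha$; the rank function is $\rho_\tau(x)=\min\{\alpha:x\notin d^{\alpha+1}X\}$. A topology $\sigma\supseteq\tau$ on $X$ is a rank preserving extension of $\tau$ if $\rho_\sigma=\rho_\tau$ (with $\sigma$ scattered). It is an $\ell$-extension of $\tau$ if moreover for any $U\in\sigma$ and any $x\in U$ whose rank $\rho_\tau(x)$ is not a limit ordinal ($0$ is not a limit ordinal) there is $V\in\tau$ with $x\in V\subseteq U$. A scattered topology is $\ell$-maximal if it has no proper $\ell$-extension. $\tau^+$ denotes the coarsest topology containing $\tau\cup\{d_\tau(A):A\subseteq X\}$. $(X,\tau_0,\tau_1,\dots)$ is an lme-space based on a scattered topology $\tau$ if $\tau_0$ is an $\ell$-maximal $\ell$-extension of $\tau$ and, for each $n$, $\tau_{n+1}$ is an $\ell$-maximal $\ell$-extension of $\tau_n^+$. It is an ordinal lme-space if $X$ is an ordinal (or an interval of ordinals) and $\tau$ is the order topology on $X$. $\varepsilon_0=\sup_k\omega_k$ where $\omega_0=1$, $\omega_{k+1}=\omega^{\omega_k}$. *)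

theory Defs
  imports "HOL-Analysis.Analysis" "HOL-Library.Countable_Set_Type"
begin

section \<open>Countable ordinals\<close>

text \<open>The type \<open>cord\<close> is the ordinal \<open>\<omega>\<^sub>1\<close>: its elements are the countable ordinals, each
  of them represented exactly once. It contains \<open>\<epsilon>\<^sub>0\<close> as an element, and it supplies all ordinals
  needed as ranks in countable scattered spaces (lemma \<open>rank_exists\<close> below).\<close>

typedef cord = "Field (cardSuc natLeq)"
proof -
  have "Field (cardSuc natLeq) \<noteq> {}"
    using cardSuc_finite[OF natLeq_Card_order] Field_natLeq infinite_UNIV_nat
    by (metis finite.emptyI)
  then show ?thesis by blast
qed

instantiation cord :: linorder
begin

definition less_eq_cord :: "cord \<Rightarrow> cord \<Rightarrow> bool"
  where "\<alpha> \<le> \<beta> \<longleftrightarrow> (Rep_cord \<alpha>, Rep_cord \<beta>) \<in> cardSuc natLeq"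

definition less_cord :: "cord \<Rightarrow> cord \<Rightarrow> bool"
  where "\<alpha> < \<beta> \<longleftrightarrow> \<alpha> \<le> \<beta> \<and> \<alpha> \<noteq> (\<beta>::cord)"

instance
proof -
  let ?r = "cardSuc natLeq"
  have "Well_order ?r"
    using cardSuc_Card_order[OF natLeq_Card_order] card_order_on_well_order_on by blast
  then have L: "refl_on (Field ?r) ?r" "trans ?r" "antisym ?r" "total_on (Field ?r) ?r"
    by (auto simp: order_on_defs)
  show "OFCLASS(cord, linorder_class)"
  proof (standard, goal_cases)
    case (1 x y)
    then show ?case
      unfolding less_cord_def less_eq_cord_def
      using L(3) Rep_cord_inject by (auto dest: antisymD)
  next
    case (2 x)
    then show ?case
      unfolding less_eq_cord_def using L(1) Rep_cord by (auto dest: refl_onD)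
  next
    case (3 x y z)
    then show ?case
      unfolding less_eq_cord_def using L(2) by (blast dest: transD)
  next
    case (4 x y)
    then show ?case
      unfolding less_eq_cord_def using L(3) Rep_cord_inject by (blast dest: antisymD)
  next
    case (5 x y)
    then show ?case
      unfolding less_eq_cord_def using L(1,4) Rep_cord
      by (metis refl_onD total_on_def)
  qed
qed

end

instance cord :: wellorder
proof (rule wf_wellorderI)
  let ?r = "cardSuc natLeq"
  have "Well_order ?r"
    using cardSuc_Card_order[OF natLeq_Card_order] card_order_on_well_order_on by blast
  then have "wf (?r - Id)" by (simp add: well_order_on_def)
  then have "wf (inv_image (?r - Id) Rep_cord)" by (rule wf_inv_image)
  moreover have "{(x::cord, y). x < y} \<subseteq> inv_image (?r - Id) Rep_cord"
    by (auto simp: less_cord_def less_eq_cord_def Rep_cord_inject)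
  ultimately show "wf {(x::cord, y). x < y}" by (rule wf_subset)
qed standard

lemma uncountable_UNIV_cord:
  includes cardinal_syntax
  shows "\<not> countable (UNIV :: cord set)"
proof
  assume "countable (UNIV :: cord set)"
  then have "countable (range Rep_cord)" by simp
  then have "countable (Field (cardSuc natLeq))"
    using type_definition.Rep_range[OF type_definition_cord] by simp
  then have "|Field (cardSuc natLeq)| \<le>o natLeq"
    by (simp add: countable_card_le_natLeq)
  then have "cardSuc natLeq \<le>o natLeq"
    using card_of_Field_ordIso[OF cardSuc_Card_order[OF natLeq_Card_order]]
      ordIso_ordLeq_trans ordIso_symmetric by blast
  then show False
    using cardSuc_greater[OF natLeq_Card_order] not_ordLess_ordLeq by blast
qed

lemma countable_lessThan_cord:
  includes cardinal_syntax
  shows "countable {..<\<alpha>::cord}"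
proof -
  let ?r = "cardSuc natLeq"
  have C: "Card_order ?r" by (rule cardSuc_Card_order[OF natLeq_Card_order])
  have "|underS ?r (Rep_cord \<alpha>)| <o ?r"
    by (rule card_of_underS[OF C Rep_cord])
  then have "|underS ?r (Rep_cord \<alpha>)| \<le>o natLeq"
    using cardSuc_ordLeq_ordLess[OF natLeq_Card_order card_of_Card_order] by blast
  then have "countable (underS ?r (Rep_cord \<alpha>))"
    by (simp add: countable_card_le_natLeq)
  moreover have "Rep_cord ` {..<\<alpha>} \<subseteq> underS ?r (Rep_cord \<alpha>)"
    by (auto simp: underS_def less_cord_def less_eq_cord_def Rep_cord_inject)
  ultimately have "countable (Rep_cord ` {..<\<alpha>})" by (rule countable_subset[rotated])
  then show ?thesis
    using countable_image_inj_on inj_on_subset[of Rep_cord UNIV]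
    by (metis Rep_cord_inject injI subset_UNIV)
qed

lemma countable_bounded_cord:
  fixes A :: "cord set"
  assumes "countable A"
  shows "\<exists>\<beta>. \<forall>\<alpha>\<in>A. \<alpha> < \<beta>"
proof (rule ccontr)
  assume "\<not> ?thesis"
  then have "UNIV = (\<Union>\<alpha>\<in>A. insert \<alpha> {..<\<alpha>})"
    by (auto simp: not_less le_less)
  then show False
    using assms uncountable_UNIV_cord countable_lessThan_cord by (metis countable_UN countable_insert)
qed

instantiation cord :: conditionally_complete_linorder
begin

definition inf_cord :: "cord \<Rightarrow> cord \<Rightarrow> cord" where "inf_cord = min"
definition sup_cord :: "cord \<Rightarrow> cord \<Rightarrow> cord" where "sup_cord = max"
definition Inf_cord :: "cord set \<Rightarrow> cord" where "Inf (A::cord set) = (LEAST \<alpha>. \<alpha> \<in> A)"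
definition Sup_cord :: "cord set \<Rightarrow> cord" where "Sup (A::cord set) = (LEAST \<beta>. \<forall>\<alpha>\<in>A. \<alpha> \<le> \<beta>)"

instance
proof (standard, goal_cases)
  case (7 x X) then show ?case by (simp add: Inf_cord_def Least_le)
next
  case (8 X z) then show ?case unfolding Inf_cord_def by (metis LeastI ex_in_conv)
next
  case (9 x X)
  then obtain b where "\<forall>\<alpha>\<in>X. \<alpha> \<le> b" by (auto simp: bdd_above_def)
  then have "\<forall>\<alpha>\<in>X. \<alpha> \<le> Sup X" unfolding Sup_cord_def by (rule LeastI)
  then show ?case using 9 by blast
next
  case (10 X z) then show ?case by (simp add: Sup_cord_def Least_le)
qed (simp_all add: inf_cord_def sup_cord_def)

end

instantiation cord :: zero
begin
definition zero_cord :: cord where "(0::cord) = (LEAST \<alpha>. True)"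
instance ..
end

lemma zero_le_cord [simp]: "(0::cord) \<le> \<alpha>"
  by (simp add: zero_cord_def Least_le)

definition osuc :: "cord \<Rightarrow> cord"
  where "osuc \<alpha> = (LEAST \<beta>. \<alpha> < \<beta>)"

definition limit_ordinal :: "cord \<Rightarrow> bool"
  where "limit_ordinal \<alpha> \<longleftrightarrow> \<alpha> \<noteq> 0 \<and> (\<forall>\<beta>. \<alpha> \<noteq> osuc \<beta>)"

lemma less_osuc: "\<alpha> < osuc \<alpha>"
  unfolding osuc_def using countable_bounded_cord[of "{\<alpha>}"] by (metis LeastI countable_insert countable_empty singletonI)

lemma osuc_le: "osuc \<alpha> \<le> \<beta> \<longleftrightarrow> \<alpha> < \<beta>"
  using less_osuc[of \<alpha>] by (auto simp: osuc_def intro: Least_le less_le_trans)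

lemma less_osuc_iff: "\<alpha> < osuc \<beta> \<longleftrightarrow> \<alpha> \<le> \<beta>"
  by (meson less_osuc osuc_le not_le le_less_trans)

lemma osuc_inject [simp]: "osuc \<alpha> = osuc \<beta> \<longleftrightarrow> \<alpha> = \<beta>"
  by (metis less_osuc_iff less_osuc order.antisym)

lemma osuc_neq_0 [simp]: "osuc \<alpha> \<noteq> 0"
  using less_osuc[of \<alpha>] zero_le_cord[of \<alpha>] by (metis not_le)

text \<open>Definition by transfinite recursion, with value \<open>z\<close> at \<open>0\<close>, step function \<open>s\<close> at
  successors, and the operation \<open>l\<close> applied to the set of all earlier values at limits.\<close>

function orec :: "'b \<Rightarrow> ('b \<Rightarrow> 'b) \<Rightarrow> ('b set \<Rightarrow> 'b) \<Rightarrow> cord \<Rightarrow> 'b" where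
  "orec z s l \<alpha> =
    (if \<alpha> = 0 then z
     else if limit_ordinal \<alpha> then l (orec z s l ` {..<\<alpha>})
     else s (orec z s l (THE \<beta>. \<alpha> = osuc \<beta>)))"
  by auto
termination
proof (relation "inv_image {(x, y). x < y} (\<lambda>(z, s, l, \<alpha>). \<alpha>)")
  show "wf (inv_image {(x::cord, y). x < y} (\<lambda>(z::'b, s::'b \<Rightarrow> 'b, l::'b set \<Rightarrow> 'b, \<alpha>). \<alpha>))"
    by (intro wf_inv_image wf)
qed (auto simp: limit_ordinal_def less_osuc)

declare orec.simps [simp del]

lemma orec_0: "orec z s l 0 = z"
  by (simp add: orec.simps)

lemma orec_suc: "orec z s l (osuc \<alpha>) = s (orec z s l \<alpha>)"
  by (subst orec.simps) (auto simp: limit_ordinal_def)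

lemma orec_limit: "limit_ordinal \<alpha> \<Longrightarrow> orec z s l \<alpha> = l (orec z s l ` {..<\<alpha>})"
  by (subst orec.simps) (auto simp: limit_ordinal_def)

definition oadd :: "cord \<Rightarrow> cord \<Rightarrow> cord"
  where "oadd \<alpha> = orec \<alpha> osuc Sup"

definition omult :: "cord \<Rightarrow> cord \<Rightarrow> cord"
  where "omult \<alpha> = orec 0 (\<lambda>\<gamma>. oadd \<gamma> \<alpha>) Sup"

text \<open>The supremum at limits is the usual clause of exponentiation only for nonzero base.\<close>

definition oexp :: "cord \<Rightarrow> cord \<Rightarrow> cord"
  where "oexp \<alpha> = orec (osuc 0) (\<lambda>\<gamma>. omult \<gamma> \<alpha>) Sup"

definition omega :: cord
  where "omega = (LEAST \<alpha>. limit_ordinal \<alpha>)"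

primrec omega_tower :: "nat \<Rightarrow> cord" where
  "omega_tower 0 = osuc 0"
| "omega_tower (Suc k) = oexp omega (omega_tower k)"

definition epsilon0 :: cord
  where "epsilon0 = Sup (range omega_tower)"

lemma bdd_above_countable_cord: "countable (A :: cord set) \<Longrightarrow> bdd_above A"
  using countable_bounded_cord[of A] by (meson bdd_aboveI less_imp_le)

lemma omega_tower_le_epsilon0: "omega_tower k \<le> epsilon0"
  unfolding epsilon0_def by (intro cSup_upper bdd_above_countable_cord) auto

lemma limit_omega: "limit_ordinal omega"
proof -
  have "\<exists>\<alpha>. limit_ordinal \<alpha>"
  proof (rule ccontr)
    assume *: "\<not> ?thesis"
    have "\<exists>n. \<alpha> = (osuc ^^ n) 0" for \<alpha>
    proof (induction \<alpha> rule: less_induct)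
      case (less \<alpha>)
      show ?case
      proof (cases "\<alpha> = 0")
        case True
        then show ?thesis by (metis funpow_0)
      next
        case False
        then obtain \<beta> where "\<alpha> = osuc \<beta>" using * by (auto simp: limit_ordinal_def)
        then show ?thesis using less[of \<beta>] less_osuc by (metis funpow.simps(2) comp_apply)
      qed
    qed
    then have "UNIV \<subseteq> range (\<lambda>n. (osuc ^^ n) 0)" by blast
    then show False
      using uncountable_UNIV_cord countable_subset by blast
  qed
  then show ?thesis unfolding omega_def by (metis LeastI)
qed


section \<open>Scattered spaces\<close>

definition scattered :: "'a topology \<Rightarrow> bool"
  where "scattered T \<longleftrightarrow>
    (\<forall>A \<subseteq> topspace T. A \<noteq> {} \<longrightarrow> (\<exists>x\<in>A. openin (subtopology T A) {x}))"

definition derived_power :: "'a topology \<Rightarrow> cord \<Rightarrow> 'a set"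
  where "derived_power T = orec (topspace T) (\<lambda>A. T derived_set_of A) Inter"

text \<open>For scattered \<open>T\<close> with countable carrier the minimum exists, see \<open>rank_exists\<close>.\<close>

definition rank_fn :: "'a topology \<Rightarrow> 'a \<Rightarrow> cord"
  where "rank_fn T x = (LEAST \<alpha>. x \<notin> derived_power T (osuc \<alpha>))"

lemma derived_power_0: "derived_power T 0 = topspace T"
  by (simp add: derived_power_def orec_0)

lemma derived_power_suc: "derived_power T (osuc \<alpha>) = T derived_set_of (derived_power T \<alpha>)"
  by (simp add: derived_power_def orec_suc)

lemma derived_power_limit:
  "limit_ordinal \<alpha> \<Longrightarrow> derived_power T \<alpha> = (\<Inter>\<beta><\<alpha>. derived_power T \<beta>)"
  by (simp add: derived_power_def orec_limit)

lemma derived_power_subset: "derived_power T \<alpha> \<subseteq> topspace T"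
proof -
  consider "\<alpha> = 0" | \<beta> where "\<alpha> = osuc \<beta>" | "limit_ordinal \<alpha>"
    by (auto simp: limit_ordinal_def)
  then show ?thesis
  proof cases
    case 3
    then have "0 < \<alpha>" by (simp add: limit_ordinal_def less_le)
    then show ?thesis using 3 derived_power_0 by (force simp: derived_power_limit)
  qed (simp_all add: derived_power_0 derived_power_suc derived_set_of_subset_topspace)
qed

lemma derived_power_step: "derived_power T (osuc \<alpha>) \<subseteq> derived_power T \<alpha>"
proof (induction \<alpha> rule: less_induct)
  case (less \<alpha>)
  consider "\<alpha> = 0" | \<beta> where "\<alpha> = osuc \<beta>" | "limit_ordinal \<alpha>"
    by (auto simp: limit_ordinal_def)
  then show ?case
  proof cases
    case 1
    then show ?thesis using derived_power_subset[of T "osuc 0"] by (simp add: derived_power_0)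
  next
    case (2 \<beta>)
    then show ?thesis
      using less[of \<beta>] less_osuc by (metis derived_power_suc derived_set_of_mono)
  next
    case 3
    show ?thesis
    proof
      fix x assume x: "x \<in> derived_power T (osuc \<alpha>)"
      have "x \<in> derived_power T \<beta>" if "\<beta> < \<alpha>" for \<beta>
      proof -
        have "derived_power T \<alpha> \<subseteq> derived_power T \<beta>"
          using 3 that by (auto simp: derived_power_limit)
        then have "x \<in> derived_power T (osuc \<beta>)"
          using x derived_set_of_mono unfolding derived_power_suc by blast
        then show ?thesis using less[OF that] by blast
      qed
      then show "x \<in> derived_power T \<alpha>" using 3 by (auto simp: derived_power_limit)
    qed
  qed
qed

lemma derived_power_antimono: "\<alpha> \<le> \<beta> \<Longrightarrow> derived_power T \<beta> \<subseteq> derived_power T \<alpha>"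
proof (induction \<beta> rule: less_induct)
  case (less \<beta>)
  consider "\<beta> = 0" | \<gamma> where "\<beta> = osuc \<gamma>" | "limit_ordinal \<beta>"
    by (auto simp: limit_ordinal_def)
  then show ?case
  proof cases
    case 1
    then show ?thesis using less.prems order.antisym[OF _ zero_le_cord] by blast
  next
    case (2 \<gamma>)
    show ?thesis
    proof (cases "\<alpha> = \<beta>")
      case False
      then have "\<alpha> \<le> \<gamma>" using less.prems 2 less_osuc_iff[of \<alpha> \<gamma>] by (simp add: less_le)
      then have "derived_power T \<gamma> \<subseteq> derived_power T \<alpha>"
        using less.IH[of \<gamma>] less_osuc 2 by simp
      then show ?thesis using derived_power_step[of T \<gamma>] 2 by simp
    qed simp
  next
    case 3
    then show ?thesis
      using less.prems by (cases "\<alpha> = \<beta>") (auto simp: derived_power_limit)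
  qed
qed

lemma rank_exists:
  assumes "scattered T" "countable (topspace T)"
  shows "\<exists>\<alpha>. x \<notin> derived_power T (osuc \<alpha>)"
proof -
  have "\<exists>\<alpha>. derived_power T (osuc \<alpha>) = derived_power T \<alpha>"
  proof (rule ccontr)
    assume "\<not> ?thesis"
    then have "\<exists>y. y \<in> derived_power T \<alpha> \<and> y \<notin> derived_power T (osuc \<alpha>)" for \<alpha>
      using derived_power_step[of T \<alpha>] by blast
    then obtain f where f: "\<And>\<alpha>. f \<alpha> \<in> derived_power T \<alpha>" "\<And>\<alpha>. f \<alpha> \<notin> derived_power T (osuc \<alpha>)"
      by metis
    have ne: "f \<alpha> \<noteq> f \<beta>" if "\<alpha> < \<beta>" for \<alpha> \<beta>
      using f(1)[of \<beta>] f(2)[of \<alpha>] derived_power_antimono[of "osuc \<alpha>" \<beta> T] that by (auto simp: osuc_le)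
    have "inj f" 
    proof (rule injI)
      fix \<alpha> \<beta> assume "f \<alpha> = f \<beta>"
      then show "\<alpha> = \<beta>" using ne[of \<alpha> \<beta>] ne[of \<beta> \<alpha>] by (cases \<alpha> \<beta> rule: linorder_cases) auto
    qed
    moreover have "countable (range f)"
    proof (rule countable_subset[OF _ assms(2)])
      show "range f \<subseteq> topspace T" using f(1) derived_power_subset by fast
    qed
    ultimately show False
      using uncountable_UNIV_cord countable_image_inj_on[of f UNIV] by blast
  qed
  then obtain \<alpha> where a: "T derived_set_of (derived_power T \<alpha>) = derived_power T \<alpha>"
    by (auto simp: derived_power_suc)
  have "derived_power T \<alpha> = {}"
  proof (rule ccontr)
    assume ne: "derived_power T \<alpha> \<noteq> {}"
    then obtain y where y: "y \<in> derived_power T \<alpha>"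
      and "openin (subtopology T (derived_power T \<alpha>)) {y}"
      using assms(1) derived_power_subset[of T \<alpha>] unfolding scattered_def by blast
    then obtain U where "openin T U" "{y} = U \<inter> derived_power T \<alpha>"
      by (auto simp: openin_subtopology)
    then have "y \<notin> T derived_set_of (derived_power T \<alpha>)"
      by (auto simp: in_derived_set_of)
    then show False using a y by simp
  qed
  then have "derived_power T (osuc \<alpha>) = {}" by (simp add: derived_power_suc a)
  then show ?thesis by blast
qed

definition extends :: "'a topology \<Rightarrow> 'a topology \<Rightarrow> bool"
  where "extends S T \<longleftrightarrow> topspace S = topspace T \<and> (\<forall>U. openin T U \<longrightarrow> openin S U)"

definition rank_preserving_extension :: "'a topology \<Rightarrow> 'a topology \<Rightarrow> bool"
  where "rank_preserving_extension S T \<longleftrightarrow>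
    scattered T \<and> scattered S \<and> extends S T \<and> (\<forall>x\<in>topspace T. rank_fn S x = rank_fn T x)"

definition l_extension :: "'a topology \<Rightarrow> 'a topology \<Rightarrow> bool"
  where "l_extension S T \<longleftrightarrow>
    rank_preserving_extension S T \<and>
    (\<forall>U x. openin S U \<and> x \<in> U \<and> \<not> limit_ordinal (rank_fn T x)
       \<longrightarrow> (\<exists>V. openin T V \<and> x \<in> V \<and> V \<subseteq> U))"

definition l_maximal :: "'a topology \<Rightarrow> bool"
  where "l_maximal T \<longleftrightarrow> scattered T \<and> (\<forall>S. l_extension S T \<longrightarrow> S = T)"

definition plus_topology :: "'a topology \<Rightarrow> 'a topology"
  where "plus_topology T = topology_generated_by
    ({U. openin T U} \<union> {T derived_set_of A | A. A \<subseteq> topspace T})"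

definition lme_space :: "'a topology \<Rightarrow> (nat \<Rightarrow> 'a topology) \<Rightarrow> bool"
  where "lme_space T \<tau> \<longleftrightarrow>
    scattered T \<and>
    l_extension (\<tau> 0) T \<and> l_maximal (\<tau> 0) \<and>
    (\<forall>n. l_extension (\<tau> (Suc n)) (plus_topology (\<tau> n)) \<and> l_maximal (\<tau> (Suc n)))"

definition order_topology_on :: "'a::linorder set \<Rightarrow> 'a topology"
  where "order_topology_on X = topology_generated_by
    ({X} \<union> {{x \<in> X. x < a} | a. a \<in> X} \<union> {{x \<in> X. a < x} | a. a \<in> X})"

definition ordinal_lme_space :: "cord set \<Rightarrow> (nat \<Rightarrow> cord topology) \<Rightarrow> bool"
  where "ordinal_lme_space X \<tau> \<longleftrightarrow>
    (\<exists>\<alpha> \<beta>. X = {\<alpha>..<\<beta>}) \<and> lme_space (order_topology_on X) \<tau>"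


section \<open>The logic GLP\<close>

datatype fm =
    FVar nat
  | FBot
  | FNeg fm
  | FOr fm fm
  | FBox nat fm

definition FImp :: "fm \<Rightarrow> fm \<Rightarrow> fm"
  where "FImp \<phi> \<psi> = FOr (FNeg \<phi>) \<psi>"

definition FDia :: "nat \<Rightarrow> fm \<Rightarrow> fm"
  where "FDia n \<phi> = FNeg (FBox n (FNeg \<phi>))"

text \<open>Truth-value assignments treat variables and boxed formulas as atoms.\<close>

primrec bool_eval :: "(fm \<Rightarrow> bool) \<Rightarrow> fm \<Rightarrow> bool" where
  "bool_eval w (FVar p) = w (FVar p)"
| "bool_eval w FBot = False"
| "bool_eval w (FNeg \<phi>) = (\<not> bool_eval w \<phi>)"
| "bool_eval w (FOr \<phi> \<psi>) = (bool_eval w \<phi> \<or> bool_eval w \<psi>)"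
| "bool_eval w (FBox n \<phi>) = w (FBox n \<phi>)"

definition tautology :: "fm \<Rightarrow> bool"
  where "tautology \<phi> \<longleftrightarrow> (\<forall>w. bool_eval w \<phi>)"

inductive GLP :: "fm \<Rightarrow> bool" where
  taut: "tautology \<phi> \<Longrightarrow> GLP \<phi>"
| distr: "GLP (FImp (FBox n (FImp \<phi> \<psi>)) (FImp (FBox n \<phi>) (FBox n \<psi>)))"
| loeb: "GLP (FImp (FBox n (FImp (FBox n \<phi>) \<phi>)) (FBox n \<phi>))"
| mono_box: "m < n \<Longrightarrow> GLP (FImp (FBox m \<phi>) (FBox n \<phi>))"
| dia_box: "m < n \<Longrightarrow> GLP (FImp (FDia m \<phi>) (FBox n (FDia m \<phi>)))"
| mp: "GLP (FImp \<phi> \<psi>) \<Longrightarrow> GLP \<phi> \<Longrightarrow> GLP \<psi>"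
| nec: "GLP \<phi> \<Longrightarrow> GLP (FBox n \<phi>)"


section \<open>Topological semantics\<close>

text \<open>A polytopological space is a carrier \<open>X\<close> with a sequence \<open>\<tau>\<close> of topologies on \<open>X\<close>.\<close>

primrec truth :: "'a set \<Rightarrow> (nat \<Rightarrow> 'a topology) \<Rightarrow> (nat \<Rightarrow> 'a set) \<Rightarrow> fm \<Rightarrow> 'a set" where
  "truth X \<tau> v (FVar p) = v p"
| "truth X \<tau> v FBot = {}"
| "truth X \<tau> v (FNeg \<phi>) = X - truth X \<tau> v \<phi>"
| "truth X \<tau> v (FOr \<phi> \<psi>) = truth X \<tau> v \<phi> \<union> truth X \<tau> v \<psi>"
| "truth X \<tau> v (FBox n \<phi>) = X - (\<tau> n) derived_set_of (X - truth X \<tau> v \<phi>)"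

definition valid_in :: "'a set \<Rightarrow> (nat \<Rightarrow> 'a topology) \<Rightarrow> fm \<Rightarrow> bool"
  where "valid_in X \<tau> \<phi> \<longleftrightarrow> (\<forall>v. (\<forall>p. v p \<subseteq> X) \<longrightarrow> truth X \<tau> v \<phi> = X)"

definition Log :: "'a set \<Rightarrow> (nat \<Rightarrow> 'a topology) \<Rightarrow> fm set"
  where "Log X \<tau> = {\<phi>. valid_in X \<tau> \<phi>}"

lemma truth_FDia:
  assumes "\<And>n. topspace (\<tau> n) = X" "\<And>p. v p \<subseteq> X"
  shows "truth X \<tau> v (FDia n \<phi>) = (\<tau> n) derived_set_of (truth X \<tau> v \<phi>)"
proof -
  have "truth X \<tau> v \<phi> \<subseteq> X" using assms(2) by (induction \<phi>) auto
  then have "X - (X - truth X \<tau> v \<phi>) = truth X \<tau> v \<phi>" by blast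
  moreover have "(\<tau> n) derived_set_of truth X \<tau> v \<phi> \<subseteq> X"
    using derived_set_of_subset_topspace[of "\<tau> n"] assms(1) by metis
  ultimately show ?thesis by (auto simp: FDia_def)
qed

end

theory Submission
  imports Defs
begin

text \<open>
  The completeness proof avoids Kripke frames. For each maximal \<open>GLP\<close>-consistent set \<open>\<Gamma>\<close> and
  each \<open>m\<close> we build an lme-space on an interval of ordinals whose points are labelled by maximal
  consistent sets, the last point by \<open>\<Gamma>\<close>, such that the modalities \<open>[m], [m+1], \<dots>\<close> (for finitely many
  formulas) are read by \<open>\<tau>\<^sub>0, \<tau>\<^sub>1, \<dots>\<close> in accordance with the labels. The construction is by
  downward induction on \<open>m\<close> and, for fixed \<open>m\<close>, by induction on the number of formulas \<open>\<psi>\<close> with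
  \<open>[m]\<psi> \<notin> \<Gamma>\<close>. By Loeb's axiom each such \<open>\<psi>\<close> is refuted in a consistent set with fewer refuted boxes,
  so that spaces for these sets are available. Copies of them fill the points of small rank \<open>\<le> \<mu>\<close>.
  A point \<open>x\<close> of larger rank \<open>\<rho>(x)\<close> gets the label of the ordinal \<open>\<rho>(x)\<close> in a space for \<open>\<Gamma>\<close>
  and \<open>m+1\<close>. This works because, for \<open>\<ell>\<close>-maximal \<open>\<tau>\<close>, neighbourhoods in \<open>\<tau>\<^sup>+\<close> are determined by ranks,
  whence \<open>\<rho>\<close> is a d-map (continuous, open, with discrete fibres) from \<open>\<tau>\<^sup>+\<close> to the ordinals,
  and \<open>\<ell>\<close>-maximal extensions lift along d-maps.
\<close>

section \<open>Rank functions\<close>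

text \<open>The obstacle is countability. In the order topology every countable limit ordinal is the
  only limit point of some \<omega>-sequence, so adding derived sets as open sets would isolate all
  points and make [1] trivial. Passing to an \<ell>-maximal extension repairs this at points of
  limit rank. But such extensions come from Zorn's lemma only, so a model cannot be looked up inside
  a given one. Instead the sequences are built around prescribed disjoint open pieces.

  Axiom (v) makes the formulas [m]\<psi> constant along [m+1]-steps. Hence all points of rank above
  \<mu> agree with \<Gamma> on [m], and one supply of witnesses, accumulating at the points of rank
  \<mu>+1, serves them all.

  The bound: if \<Gamma> and m+1 are realized with last point of rank \<delta>, then \<Gamma> and m
  are realized with last point of rank \<mu> + \<omega>^\<delta>. Each modality costs one
  exponential, and \<epsilon>0 is closed under these.\<close>

definition base_top :: "('a set \<Rightarrow> bool) \<Rightarrow> 'a topology"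
  where "base_top B = topology (\<lambda>W. \<forall>x\<in>W. \<exists>U. B U \<and> x \<in> U \<and> U \<subseteq> W)"

text \<open>Closure under binary intersections is the only condition: the carrier is whatever the
  basic sets cover. Openness gets a pointwise description, which spares an induction over generated
  topologies in each construction below.\<close>

lemma openin_base_top:
  assumes "\<And>U V. B U \<Longrightarrow> B V \<Longrightarrow> B (U \<inter> V)"
  shows "openin (base_top B) W \<longleftrightarrow> (\<forall>x\<in>W. \<exists>U. B U \<and> x \<in> U \<and> U \<subseteq> W)"
proof -
  have "istopology (\<lambda>W. \<forall>x\<in>W. \<exists>U. B U \<and> x \<in> U \<and> U \<subseteq> W)"
    unfolding istopology_def
  proof (intro conjI allI impI ballI)
    fix S T x
    assume "\<forall>x\<in>S. \<exists>U. B U \<and> x \<in> U \<and> U \<subseteq> S" "\<forall>x\<in>T. \<exists>U. B U \<and> x \<in> U \<and> U \<subseteq> T" "x \<in> S \<inter> T"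
    then obtain U V where "B U" "x \<in> U" "U \<subseteq> S" "B V" "x \<in> V" "V \<subseteq> T" by blast
    then show "\<exists>U. B U \<and> x \<in> U \<and> U \<subseteq> S \<inter> T"
      using assms by (intro exI[of _ "U \<inter> V"]) blast
  next
    fix \<K> x
    assume "\<forall>K\<in>\<K>. \<forall>x\<in>K. \<exists>U. B U \<and> x \<in> U \<and> U \<subseteq> K" "x \<in> \<Union>\<K>"
    then show "\<exists>U. B U \<and> x \<in> U \<and> U \<subseteq> \<Union>\<K>" by (meson Union_iff Union_upper order_trans)
  qed
  then show ?thesis by (simp add: base_top_def)
qed

lemma not_limit_0 [simp]: "\<not> limit_ordinal 0"
  by (simp add: limit_ordinal_def)

lemma not_limit_osuc [simp]: "\<not> limit_ordinal (osuc \<alpha>)"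
  by (simp add: limit_ordinal_def)

lemma limit_osuc_less: "limit_ordinal \<delta> \<Longrightarrow> \<beta> < \<delta> \<Longrightarrow> osuc \<beta> < \<delta>"
  by (metis limit_ordinal_def osuc_le le_less)

lemma cord_cases [case_names zero suc limit]:
  obtains "\<alpha> = 0" | \<beta> where "\<alpha> = osuc \<beta>" | "limit_ordinal \<alpha>"
  by (auto simp: limit_ordinal_def)

lemma cord_neq_0_iff: "\<alpha> \<noteq> (0::cord) \<longleftrightarrow> 0 < \<alpha>"
  by (metis zero_le_cord le_less less_irrefl)

lemma not_less_0_cord [simp]: "\<not> \<alpha> < (0::cord)"
  using zero_le_cord[of \<alpha>] by (simp add: not_less)

text \<open>A local description of the rank: \<open>r\<close> is a d-map into the ordinals whose
  open sets are the initial segments. It determines \<open>r\<close> on the carrier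
  (\<open>is_rank_rank_fn\<close>) and, in contrast to transfinite derived sets, passes directly to
  open subspaces and along d-maps.\<close>

definition is_rank :: "'a topology \<Rightarrow> ('a \<Rightarrow> cord) \<Rightarrow> bool"
  where "is_rank T r \<longleftrightarrow>
    (\<forall>U x \<beta>. openin T U \<and> x \<in> U \<and> \<beta> < r x \<longrightarrow> (\<exists>y\<in>U. r y = \<beta>)) \<and>
    (\<forall>x\<in>topspace T. \<exists>U. openin T U \<and> x \<in> U \<and> (\<forall>y\<in>U. y \<noteq> x \<longrightarrow> r y < r x))"

lemma is_rank_lower:
  "is_rank T r \<Longrightarrow> openin T U \<Longrightarrow> x \<in> U \<Longrightarrow> \<beta> < r x \<Longrightarrow> \<exists>y\<in>U. r y = \<beta>"
  unfolding is_rank_def by blast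

lemma is_rank_lower_eq:
  "is_rank T r \<Longrightarrow> openin T U \<Longrightarrow> x \<in> U \<Longrightarrow> \<beta> \<le> r x \<Longrightarrow> \<exists>y\<in>U. r y = \<beta>"
  using is_rank_lower[of T r U x \<beta>] by (cases "\<beta> = r x") auto

lemma is_rank_nbhd:
  assumes "is_rank T r" "openin T W" "x \<in> W"
  obtains U where "openin T U" "x \<in> U" "U \<subseteq> W" "\<And>y. y \<in> U \<Longrightarrow> y \<noteq> x \<Longrightarrow> r y < r x"
proof -
  have "x \<in> topspace T" using assms openin_subset by blast
  then obtain U where "openin T U" "x \<in> U" "\<forall>y\<in>U. y \<noteq> x \<longrightarrow> r y < r x"
    using assms(1) unfolding is_rank_def by blast
  then show ?thesis using that[of "U \<inter> W"] assms by auto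
qed

lemma is_rank_openin_less:
  assumes "is_rank T r" "openin T U"
  shows "openin T {x\<in>U. r x < \<beta>}"
proof (subst openin_subopen, intro ballI)
  fix x assume x: "x \<in> {x\<in>U. r x < \<beta>}"
  then obtain V where "openin T V" "x \<in> V" "V \<subseteq> U" "\<And>y. y \<in> V \<Longrightarrow> y \<noteq> x \<Longrightarrow> r y < r x"
    using is_rank_nbhd[OF assms] by auto
  then show "\<exists>V. openin T V \<and> x \<in> V \<and> V \<subseteq> {x\<in>U. r x < \<beta>}"
    using x by (intro exI[of _ V]) force
qed

lemma is_rank_subtopology:
  assumes "is_rank T r" "openin T U"
  shows "is_rank (subtopology T U) r"
  unfolding is_rank_def
proof (intro conjI allI impI ballI)
  fix W x \<beta> assume "openin (subtopology T U) W \<and> x \<in> W \<and> \<beta> < r x"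
  then show "\<exists>y\<in>W. r y = \<beta>"
    using is_rank_lower[OF assms(1)] openin_open_subtopology[OF assms(2)] by metis
next
  fix x assume "x \<in> topspace (subtopology T U)"
  then have "x \<in> U" by simp
  then obtain V where "openin T V" "x \<in> V" "V \<subseteq> U" "\<And>y. y \<in> V \<Longrightarrow> y \<noteq> x \<Longrightarrow> r y < r x"
    using is_rank_nbhd[OF assms] by metis
  then show "\<exists>V. openin (subtopology T U) V \<and> x \<in> V \<and> (\<forall>y\<in>V. y \<noteq> x \<longrightarrow> r y < r x)"
    using openin_open_subtopology[OF assms(2)] by metis
qed

lemma derived_set_rank_eq:
  assumes "is_rank T r"
  shows "T derived_set_of {x\<in>topspace T. r x = \<beta>} = {x\<in>topspace T. \<beta> < r x}"
proof (intro set_eqI iffI)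
  fix x assume x: "x \<in> T derived_set_of {x\<in>topspace T. r x = \<beta>}"
  then have "x \<in> topspace T" by (simp add: in_derived_set_of)
  then obtain U where "openin T U" "x \<in> U" and U: "\<And>y. y \<in> U \<Longrightarrow> y \<noteq> x \<Longrightarrow> r y < r x"
    using is_rank_nbhd[OF assms openin_topspace] by metis
  then obtain y where "y \<noteq> x" "y \<in> U" "r y = \<beta>" using x by (auto simp: in_derived_set_of)
  then show "x \<in> {x\<in>topspace T. \<beta> < r x}" using U \<open>x \<in> topspace T\<close> by auto
next
  fix x assume x: "x \<in> {x\<in>topspace T. \<beta> < r x}"
  have "\<exists>y. y \<noteq> x \<and> y \<in> {x\<in>topspace T. r x = \<beta>} \<and> y \<in> U" if "x \<in> U" "openin T U" for U
    using is_rank_lower[OF assms that(2,1), of \<beta>] x openin_subset[OF that(2)] by auto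
  then show "x \<in> T derived_set_of {x\<in>topspace T. r x = \<beta>}" using x by (auto simp: in_derived_set_of)
qed

lemma derived_set_rank_ge:
  assumes "is_rank T r"
  shows "T derived_set_of {x\<in>topspace T. \<beta> \<le> r x} = {x\<in>topspace T. \<beta> < r x}"
proof (intro set_eqI iffI)
  fix x assume x: "x \<in> T derived_set_of {x\<in>topspace T. \<beta> \<le> r x}"
  then have "x \<in> topspace T" by (simp add: in_derived_set_of)
  then obtain U where "openin T U" "x \<in> U" and U: "\<And>y. y \<in> U \<Longrightarrow> y \<noteq> x \<Longrightarrow> r y < r x"
    using is_rank_nbhd[OF assms openin_topspace] by metis
  then obtain y where "y \<noteq> x" "y \<in> U" "\<beta> \<le> r y" using x by (auto simp: in_derived_set_of)
  then show "x \<in> {x\<in>topspace T. \<beta> < r x}" using U[of y] \<open>x \<in> topspace T\<close> by auto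
next
  fix x assume "x \<in> {x\<in>topspace T. \<beta> < r x}"
  then have "x \<in> T derived_set_of {x\<in>topspace T. r x = \<beta>}" by (simp add: derived_set_rank_eq[OF assms])
  then show "x \<in> T derived_set_of {x\<in>topspace T. \<beta> \<le> r x}"
    using derived_set_of_mono[of "{x\<in>topspace T. r x = \<beta>}" "{x\<in>topspace T. \<beta> \<le> r x}" T] by auto
qed

lemma is_rank_derived_power:
  assumes "is_rank T r"
  shows "derived_power T \<alpha> = {x\<in>topspace T. \<alpha> \<le> r x}"
proof (induction \<alpha> rule: less_induct)
  case (less \<alpha>)
  show ?case
  proof (cases \<alpha> rule: cord_cases)
    case zero
    then show ?thesis by (simp add: derived_power_0)
  next
    case (suc \<beta>)
    then show ?thesis
      using less[of \<beta>] by (simp add: derived_power_suc less_osuc derived_set_rank_ge[OF assms] osuc_le)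
  next
    case limit
    then have "\<alpha> \<noteq> 0" by auto
    then have "0 < \<alpha>" by (simp add: cord_neq_0_iff)
    have "\<alpha> \<le> r x" if "\<And>\<beta>. \<beta> < \<alpha> \<Longrightarrow> \<beta> \<le> r x" for x
      using that[of "osuc (r x)"] limit_osuc_less[OF limit, of "r x"] less_osuc[of "r x"]
      by (meson not_le)
    then show ?thesis
      using less limit \<open>0 < \<alpha>\<close> by (auto simp: derived_power_limit)
  qed
qed

text \<open>A point of least rank in \<open>A\<close> is isolated in \<open>A\<close>, because all
  other points near it have smaller rank.\<close>

lemma is_rank_scattered:
  assumes "is_rank T r"
  shows "scattered T"
  unfolding scattered_def
proof (intro allI impI)
  fix A assume A: "A \<subseteq> topspace T" "A \<noteq> {}"
  then have "(LEAST \<beta>. \<beta> \<in> r ` A) \<in> r ` A" by (auto intro: LeastI)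
  then obtain x where "x \<in> A" "r x = (LEAST \<beta>. \<beta> \<in> r ` A)" by auto
  then have x: "x \<in> A" "\<And>y. y \<in> A \<Longrightarrow> r x \<le> r y" by (auto intro: Least_le)
  then obtain U where "openin T U" "x \<in> U" "\<And>y. y \<in> U \<Longrightarrow> y \<noteq> x \<Longrightarrow> r y < r x"
    using is_rank_nbhd[OF assms openin_topspace, of x] A x(1) by (metis subsetD)
  then have "U \<inter> A = {x}" using x by (auto simp: not_le[symmetric])
  then show "\<exists>x\<in>A. openin (subtopology T A) {x}"
    using \<open>openin T U\<close> x by (auto simp: openin_subtopology)
qed

lemma is_rank_rank_fn:
  assumes "is_rank T r" "x \<in> topspace T"
  shows "rank_fn T x = r x"
  unfolding rank_fn_def is_rank_derived_power[OF assms(1)]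
  using assms(2) by (intro Least_equality) (auto simp: osuc_le not_less)

text \<open>Countability of the carrier enters through \<open>rank_exists\<close>:
  \<open>cord\<close> contains only the countable ordinals, and the minimum defining
  \<open>rank_fn\<close> must be attained among them.\<close>

lemma in_derived_power_iff:
  assumes "scattered T" "countable (topspace T)" "x \<in> topspace T"
  shows "x \<in> derived_power T \<beta> \<longleftrightarrow> \<beta> \<le> rank_fn T x"
proof -
  let ?\<alpha> = "rank_fn T x"
  have out: "x \<notin> derived_power T (osuc ?\<alpha>)"
    using rank_exists[OF assms(1,2), of x] unfolding rank_fn_def by (rule LeastI_ex)
  have below: "x \<in> derived_power T (osuc \<gamma>)" if "\<gamma> < ?\<alpha>" for \<gamma>
    using not_less_Least[of \<gamma> "\<lambda>\<alpha>. x \<notin> derived_power T (osuc \<alpha>)"] that unfolding rank_fn_def by blast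
  have inn: "x \<in> derived_power T ?\<alpha>"
  proof (cases ?\<alpha> rule: cord_cases)
    case zero
    then show ?thesis using assms by (simp add: derived_power_0)
  next
    case (suc \<gamma>)
    then show ?thesis using below[of \<gamma>] less_osuc by metis
  next
    case limit
    then show ?thesis using below derived_power_step by (fastforce simp: derived_power_limit)
  qed
  show ?thesis
  proof
    assume "\<beta> \<le> ?\<alpha>"
    then show "x \<in> derived_power T \<beta>" using inn derived_power_antimono[of \<beta> ?\<alpha> T] by auto
  next
    assume "x \<in> derived_power T \<beta>"
    show "\<beta> \<le> ?\<alpha>"
    proof (rule ccontr)
      assume "\<not> \<beta> \<le> ?\<alpha>"
      then have "osuc ?\<alpha> \<le> \<beta>" by (simp add: osuc_le)
      then show False using out \<open>x \<in> derived_power T \<beta>\<close> derived_power_antimono[of "osuc ?\<alpha>" \<beta> T] by auto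
    qed
  qed
qed

text \<open>The competitors in the definition of \<open>l_maximal\<close> are only known to be
  scattered. This gives them a rank in the local sense.\<close>

lemma scattered_is_rank:
  assumes "scattered T" "countable (topspace T)"
  shows "is_rank T (rank_fn T)"
proof -
  let ?r = "rank_fn T"
  note iff = in_derived_power_iff[OF assms]
  have nb: "\<exists>U. openin T U \<and> x \<in> U \<and> (\<forall>y\<in>U. y \<noteq> x \<longrightarrow> ?r y < ?r x)" if x: "x \<in> topspace T" for x
  proof -
    have "x \<notin> T derived_set_of (derived_power T (?r x))"
      using iff[OF x, of "osuc (?r x)"] less_osuc[of "?r x"] by (simp add: derived_power_suc)
    then obtain U where U: "openin T U" "x \<in> U" "\<And>y. y \<in> U \<Longrightarrow> y \<noteq> x \<Longrightarrow> y \<notin> derived_power T (?r x)"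
      using x by (auto simp: in_derived_set_of)
    then have "\<forall>y\<in>U. y \<noteq> x \<longrightarrow> ?r y < ?r x"
      using iff openin_subset[OF U(1)] by (meson not_le subsetD)
    then show ?thesis using U by blast
  qed
  have step: "\<exists>y\<in>U. \<beta> \<le> ?r y \<and> ?r y < ?r x" if U: "openin T U" "x \<in> U" and \<beta>: "\<beta> < ?r x" for U x \<beta>
  proof -
    have x: "x \<in> topspace T" using U openin_subset by blast
    then obtain V where V: "openin T V" "x \<in> V" "\<forall>y\<in>V. y \<noteq> x \<longrightarrow> ?r y < ?r x" using nb by blast
    have "x \<in> T derived_set_of (derived_power T \<beta>)"
      using iff[OF x, of "osuc \<beta>"] \<beta> by (simp add: derived_power_suc osuc_le)
    moreover have "x \<in> U \<inter> V" "openin T (U \<inter> V)" using U V by auto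
    ultimately obtain y where y: "y \<noteq> x" "y \<in> derived_power T \<beta>" "y \<in> U \<inter> V"
      unfolding in_derived_set_of by metis
    then have "y \<in> topspace T" using V openin_subset by blast
    then show ?thesis using y V iff by blast
  qed
  \<comment> \<open>\<open>step\<close> yields a smaller rank that is still at least \<beta>.
    Repeating it descends, and by well-foundedness ends exactly at \<beta>.\<close>
  have "\<exists>y\<in>U. ?r y = \<beta>" if U: "openin T U" "x \<in> U" and \<beta>: "\<beta> < ?r x" for U x \<beta>
    using U \<beta>
  proof (induction "?r x" arbitrary: x rule: less_induct)
    case less
    then obtain y where "y \<in> U" "\<beta> \<le> ?r y" "?r y < ?r x" using step by blast
    then show ?case using less.hyps[of y] less.prems by (cases "\<beta> = ?r y") auto
  qed
  then show ?thesis unfolding is_rank_def using nb by blast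
qed

section \<open>Limit-maximal extensions\<close>

text \<open>The counterpart of \<open>l_extension\<close> with the common rank as a parameter. That
  \<open>T\<close> has rank \<open>r\<close> is a separate hypothesis \<open>is_rank T r\<close>
  where it is used.\<close>

definition lext :: "'a topology \<Rightarrow> 'a topology \<Rightarrow> ('a \<Rightarrow> cord) \<Rightarrow> bool"
  where "lext S T r \<longleftrightarrow> is_rank S r \<and> topspace S = topspace T \<and>
    (\<forall>U. openin T U \<longrightarrow> openin S U) \<and>
    (\<forall>U x. openin S U \<and> x \<in> U \<and> \<not> limit_ordinal (r x) \<longrightarrow> (\<exists>V. openin T V \<and> x \<in> V \<and> V \<subseteq> U))"

text \<open>A pointwise criterion for \<open>\<ell>\<close>-maximality: an open set that meets every neighbourhood of a
  point of limit rank in points of unbounded rank is itself a punctured neighbourhood of it.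
  Unlike the definition it restricts to open subspaces.\<close>

definition lmax :: "'a topology \<Rightarrow> ('a \<Rightarrow> cord) \<Rightarrow> bool"
  where "lmax T r \<longleftrightarrow>
    (\<forall>V x. openin T V \<and> x \<in> topspace T \<and> limit_ordinal (r x) \<and>
       (\<forall>U \<beta>. openin T U \<and> x \<in> U \<and> \<beta> < r x \<longrightarrow> (\<exists>y\<in>U \<inter> V. \<beta> \<le> r y)) \<longrightarrow>
       openin T (insert x V))"

lemma lextD:
  assumes "lext S T r"
  shows "is_rank S r" "topspace S = topspace T" "\<And>U. openin T U \<Longrightarrow> openin S U"
    "\<And>U x. openin S U \<Longrightarrow> x \<in> U \<Longrightarrow> \<not> limit_ordinal (r x) \<Longrightarrow> \<exists>V. openin T V \<and> x \<in> V \<and> V \<subseteq> U"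
  using assms unfolding lext_def by auto

lemma lext_refl: "is_rank T r \<Longrightarrow> lext T T r"
  unfolding lext_def by blast

lemma lext_trans: "lext S' S r \<Longrightarrow> lext S T r \<Longrightarrow> lext S' T r"
  unfolding lext_def by (metis order_trans)

lemma lmaxD:
  assumes "lmax T r" "openin T V" "x \<in> topspace T" "limit_ordinal (r x)"
    and "\<And>U \<beta>. openin T U \<Longrightarrow> x \<in> U \<Longrightarrow> \<beta> < r x \<Longrightarrow> \<exists>y\<in>U \<inter> V. \<beta> \<le> r y"
  shows "openin T (insert x V)"
  by (rule assms(1)[unfolded lmax_def, rule_format]) (use assms in simp)

text \<open>Induction on the rank of a point \<open>x\<close> of \<open>W\<close>. Below the rank of
  \<open>x\<close> the set \<open>W\<close> is \<open>T\<close>-open by induction. If that rank is a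
  limit, this lower part meets every neighbourhood of \<open>x\<close> in unbounded ranks, since
  \<open>S\<close> has rank \<open>r\<close>, and then \<open>lmax\<close> returns a
  \<open>T\<close>-neighbourhood of \<open>x\<close>. At all other ranks \<open>S\<close> has no new
  neighbourhoods.\<close>

lemma lmax_lext_openin:
  assumes max: "lmax T r" and T: "is_rank T r" and ext: "lext S T r" and W: "openin S W"
  shows "openin T W"
proof -
  have "\<exists>V. openin T V \<and> x \<in> V \<and> V \<subseteq> W" if "x \<in> W" for x
    using that
  proof (induction "r x" arbitrary: x rule: less_induct)
    case less
    show ?case
    proof (cases "limit_ordinal (r x)")
      case False
      then show ?thesis using lextD(4)[OF ext W less.prems] by blast
    next
      case limit: True
      define V where "V = {y\<in>W. r y < r x}"
      have VS: "openin S V"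
        unfolding V_def by (rule is_rank_openin_less[OF lextD(1)[OF ext] W])
      have VT: "openin T V"
      proof (subst openin_subopen, intro ballI)
        fix y assume y: "y \<in> V"
        then obtain U where U: "openin T U" "y \<in> U" "U \<subseteq> W" using less.hyps[of y] by (auto simp: V_def)
        then have "openin T {z\<in>U. r z < r x}" using is_rank_openin_less[OF T] by blast
        then show "\<exists>U. openin T U \<and> y \<in> U \<and> U \<subseteq> V"
          using U y by (intro exI[of _ "{z\<in>U. r z < r x}"]) (auto simp: V_def)
      qed
      have x: "x \<in> topspace T" using W less.prems openin_subset lextD(2)[OF ext] by blast
      have "\<exists>y\<in>U \<inter> V. \<beta> \<le> r y" if "openin T U" "x \<in> U" "\<beta> < r x" for U \<beta>
      proof -
        have "openin S (U \<inter> W)" "x \<in> U \<inter> W" using that W less.prems lextD(3)[OF ext] by auto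
        then obtain y where "y \<in> U \<inter> W" "r y = \<beta>" using is_rank_lower[OF lextD(1)[OF ext], of "U \<inter> W" x \<beta>] \<open>\<beta> < r x\<close> by blast
        then show ?thesis using that by (auto simp: V_def)
      qed
      then have "openin T (insert x V)" by (rule lmaxD[OF max VT x limit])
      then show ?thesis using less.prems by (intro exI[of _ "insert x V"]) (auto simp: V_def)
    qed
  qed
  then show ?thesis by (subst openin_subopen) blast
qed

lemma lmax_lext_eq:
  assumes "lmax T r" "is_rank T r" "lext S T r"
  shows "S = T"
  unfolding topology_eq using lmax_lext_openin[OF assms] lextD(3)[OF assms(3)] by blast

text \<open>Only the neighbourhoods of \<open>x\<close> change, and \<open>x\<close> has limit rank,
  so the clause on other ranks survives. The rank of \<open>x\<close> does not drop, because
  \<open>V\<close> contains points of unbounded rank near \<open>x\<close> and, being open, all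
  smaller ranks as well.\<close>

lemma lext_insert_nbhd:
  assumes M: "is_rank M r" and V: "openin M V" and x: "x \<in> topspace M" "limit_ordinal (r x)"
    and unb: "\<And>U \<beta>. openin M U \<Longrightarrow> x \<in> U \<Longrightarrow> \<beta> < r x \<Longrightarrow> \<exists>y\<in>U \<inter> V. \<beta> \<le> r y"
  obtains S where "lext S M r" "openin S (insert x V)"
proof -
  define B where "B = (\<lambda>W. \<exists>U. openin M U \<and> (W = U \<or> W = U \<inter> insert x V))"
  have int: "B (U \<inter> U')" if "B U" "B U'" for U U'
  proof -
    obtain A where A: "openin M A" "U = A \<or> U = A \<inter> insert x V"
      using \<open>B U\<close> unfolding B_def by auto
    obtain A' where A': "openin M A'" "U' = A' \<or> U' = A' \<inter> insert x V"
      using \<open>B U'\<close> unfolding B_def by auto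
    from A A' have "openin M (A \<inter> A')" by blast
    moreover have "U \<inter> U' = A \<inter> A' \<or> U \<inter> U' = (A \<inter> A') \<inter> insert x V"
      using A(2) A'(2) by (elim disjE) auto
    ultimately show ?thesis unfolding B_def by auto
  qed
  have op: "openin (base_top B) W \<longleftrightarrow> (\<forall>x\<in>W. \<exists>U. B U \<and> x \<in> U \<and> U \<subseteq> W)" for W
    by (rule openin_base_top) (rule int)
  define S where "S = base_top B"
  have old: "openin S U" if "openin M U" for U
  proof -
    have "B U" unfolding B_def using that by auto
    then show ?thesis unfolding S_def op by blast
  qed
  have basic: "\<exists>U. openin M U \<and> y \<in> U \<and> U \<subseteq> W" if "B W" "y \<in> W" "y \<noteq> x" for W y
  proof -
    obtain U where "openin M U" "W = U \<or> W = U \<inter> insert x V"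
      using \<open>B W\<close> unfolding B_def by auto
    then have "openin M (U \<inter> V)" "openin M W \<or> y \<in> U \<inter> V \<and> U \<inter> V \<subseteq> W" using that V by auto
    then show ?thesis using that by blast
  qed
  have top: "topspace S = topspace M"
  proof
    show "topspace M \<subseteq> topspace S" using old[OF openin_topspace] openin_subset by blast
    show "topspace S \<subseteq> topspace M"
    proof
      fix y assume "y \<in> topspace S"
      then obtain U where "B U" "y \<in> U" using openin_topspace[of S] unfolding S_def op by blast
      then show "y \<in> topspace M" using basic[of U y] x openin_subset by (cases "y = x") blast+
    qed
  qed
  have "is_rank S r"
    unfolding is_rank_def
  proof (intro conjI allI impI ballI)
    fix U y \<beta> assume *: "openin S U \<and> y \<in> U \<and> \<beta> < r y"
    then obtain W where W: "B W" "y \<in> W" "W \<subseteq> U" unfolding S_def op by blast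
    have "\<exists>z\<in>W. r z = \<beta>"
    proof (cases "y = x")
      case False
      then obtain A where "openin M A" "y \<in> A" "A \<subseteq> W" using basic[OF W(1,2)] by auto
      then show ?thesis using is_rank_lower[OF M, of A y \<beta>] * by blast
    next
      case True
      show ?thesis
      proof (cases "openin M W")
        case True
        then show ?thesis using is_rank_lower[OF M, of W y \<beta>] * W by blast
      next
        case False
        then obtain A where A: "openin M A" "W = A \<inter> insert x V" using W(1) unfolding B_def by auto
        then obtain z where "z \<in> A \<inter> V" "\<beta> \<le> r z" using unb[of A \<beta>] True W * by blast
        then show ?thesis using is_rank_lower_eq[OF M, of "A \<inter> V" z \<beta>] A V by blast
      qed
    qed
    then show "\<exists>z\<in>U. r z = \<beta>" using W by blast
  next
    fix y assume "y \<in> topspace S"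
    then show "\<exists>U. openin S U \<and> y \<in> U \<and> (\<forall>z\<in>U. z \<noteq> y \<longrightarrow> r z < r y)"
      using is_rank_nbhd[OF M openin_topspace, of y] old unfolding top by metis
  qed
  moreover have "\<exists>U. openin M U \<and> y \<in> U \<and> U \<subseteq> W" if "openin S W" "y \<in> W" "\<not> limit_ordinal (r y)" for W y
  proof -
    obtain U where "B U" "y \<in> U" "U \<subseteq> W" using \<open>openin S W\<close> \<open>y \<in> W\<close> unfolding S_def op by blast
    then show ?thesis using basic[of U y] that x by blast
  qed
  ultimately have "lext S M r" unfolding lext_def using top old by simp
  moreover have "openin S (insert x V)"
  proof -
    have "insert x V = topspace M \<inter> insert x V" using x openin_subset[OF V] by blast
    then have "B (insert x V)" unfolding B_def using openin_topspace by blast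
    then show ?thesis unfolding S_def op by blast
  qed
  ultimately show ?thesis using that by blast
qed

lemma lmaxI:
  assumes M: "is_rank M r" and "\<And>S. lext S M r \<Longrightarrow> S = M"
  shows "lmax M r"
  unfolding lmax_def
proof (intro allI impI; elim conjE)
  fix V x assume "openin M V" "x \<in> topspace M" "limit_ordinal (r x)"
    "\<forall>U \<beta>. openin M U \<and> x \<in> U \<and> \<beta> < r x \<longrightarrow> (\<exists>y\<in>U \<inter> V. \<beta> \<le> r y)"
  then obtain S where "lext S M r" "openin S (insert x V)" using lext_insert_nbhd[OF M, of V x] by metis
  then show "openin M (insert x V)" using assms(2) by metis
qed

lemma ex_lmax:
  assumes T: "is_rank T r"
  obtains M where "lext M T r" "lmax M r"
proof -
  define A where "A = {Collect (openin S) | S. lext S T r}"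
  have "\<exists>M\<in>A. \<forall>X\<in>A. M \<subseteq> X \<longrightarrow> X = M"
  proof (rule subset_Zorn)
    fix C assume C2: "subset.chain A C"
    show "\<exists>U\<in>A. \<forall>X\<in>C. X \<subseteq> U"
    proof (cases "C = {}")
      case True
      then show ?thesis using lext_refl[OF T] unfolding A_def by blast
    next
      case False
      with C2 have C: "C \<noteq> {}" "subset.chain A C" by auto
      \<comment> \<open>The union of a chain of topologies is closed under finite intersections but
        in general not under unions, hence the topology generated by it. Each basic set is open in
        one member of the chain and inherits the conditions on ranks from there.\<close>
      define S where "S = base_top (\<lambda>W. W \<in> \<Union>C)"
      have CA: "\<exists>S. lext S T r \<and> c = Collect (openin S)" if "c \<in> C" for c
        using that C(2) unfolding A_def subset.chain_def by blast
      have int: "U \<inter> V \<in> \<Union>C" if UV: "U \<in> \<Union>C" "V \<in> \<Union>C" for U V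
      proof -
        obtain c d where cd: "c \<in> C" "U \<in> c" "d \<in> C" "V \<in> d" using UV by blast
        then have "c \<subseteq> d \<or> d \<subseteq> c" using C(2) unfolding subset_chain_def by blast
        then obtain e where e: "e \<in> C" "U \<in> e" "V \<in> e" using cd by blast
        then show ?thesis using CA[OF e(1)] by blast
      qed
      have S: "openin S W \<longleftrightarrow> (\<forall>x\<in>W. \<exists>U. U \<in> \<Union>C \<and> x \<in> U \<and> U \<subseteq> W)" for W
        unfolding S_def by (rule openin_base_top) (rule int)
      have up: "openin S U" if "c \<in> C" "U \<in> c" for c U
        using that unfolding S by blast
      obtain c0 S0 where c0: "c0 \<in> C" "lext S0 T r" "c0 = Collect (openin S0)" using C(1) CA by blast
      have old: "openin S U" if "openin T U" for U
        using up[OF c0(1)] lextD(3)[OF c0(2) that] c0(3) by blast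
      have top: "topspace S = topspace T"
      proof
        show "topspace T \<subseteq> topspace S" using old[OF openin_topspace] openin_subset by blast
        show "topspace S \<subseteq> topspace T"
        proof
          fix y assume "y \<in> topspace S"
          then obtain U c where c: "c \<in> C" "U \<in> c" "y \<in> U" using openin_topspace[of S] unfolding S by blast
          then obtain S' where "lext S' T r" "openin S' U" using CA[of c] by blast
          then show "y \<in> topspace T" using lextD(2)[of S' T r] openin_subset[of S' U] c by blast
        qed
      qed
      have "lext S T r"
        unfolding lext_def
      proof (intro conjI allI impI)
        show "is_rank S r" unfolding is_rank_def
        proof (intro conjI allI impI ballI)
          fix U x \<beta> assume *: "openin S U \<and> x \<in> U \<and> \<beta> < r x"
          then obtain c V where c: "c \<in> C" "V \<in> c" "x \<in> V" "V \<subseteq> U" unfolding S by blast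
          then obtain S' where "lext S' T r" "openin S' V" using CA[of c] by blast
          then show "\<exists>y\<in>U. r y = \<beta>" using is_rank_lower[OF lextD(1), of S' T r V x \<beta>] c * by blast
        next
          fix x assume "x \<in> topspace S"
          then show "\<exists>U. openin S U \<and> x \<in> U \<and> (\<forall>y\<in>U. y \<noteq> x \<longrightarrow> r y < r x)"
            using is_rank_nbhd[OF T openin_topspace, of x] old unfolding top by metis
        qed
      next
        fix U x assume *: "openin S U \<and> x \<in> U \<and> \<not> limit_ordinal (r x)"
        then obtain c V where c: "c \<in> C" "V \<in> c" "x \<in> V" "V \<subseteq> U" unfolding S by blast
        then obtain S' where "lext S' T r" "openin S' V" using CA[of c] by blast
        then show "\<exists>V. openin T V \<and> x \<in> V \<and> V \<subseteq> U" using lextD(4)[of S' T r V x] * c by blast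
      qed (use top old in auto)
      then show ?thesis
        unfolding A_def using up by (intro bexI[of _ "Collect (openin S)"]) auto
    qed
  qed
  then obtain M where M: "lext M T r" and max: "\<And>S. lext S T r \<Longrightarrow> Collect (openin M) \<subseteq> Collect (openin S) \<Longrightarrow>
      Collect (openin S) = Collect (openin M)"
    unfolding A_def by blast
  have "lmax M r"
  proof (rule lmaxI[OF lextD(1)[OF M]])
    fix S assume S: "lext S M r"
    then have "Collect (openin S) = Collect (openin M)"
      using max[OF lext_trans[OF S M]] lextD(3)[OF S] by blast
    then show "S = M" by (simp add: topology_eq set_eq_iff)
  qed
  then show ?thesis using that M by blast
qed

text \<open>First the prescribed topologies are added to \<open>T\<close> as basic open sets, which
  is harmless since the pieces are disjoint and open; then the result is extended to an
  \<open>lmax\<close> topology \<open>M\<close>. On a piece \<open>U\<close> the restriction of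
  \<open>M\<close> is an extension of \<open>\<sigma> U\<close>, and as \<open>\<sigma> U\<close> is
  already maximal, nothing was added there.\<close>

lemma ex_lmax_pieces:
  assumes T: "is_rank T r" and P: "disjoint P" "\<And>U. U \<in> P \<Longrightarrow> openin T U"
    and ext: "\<And>U. U \<in> P \<Longrightarrow> lext (\<sigma> U) (subtopology T U) r"
    and max: "\<And>U. U \<in> P \<Longrightarrow> lmax (\<sigma> U) r"
  obtains M where "lext M T r" "lmax M r" "\<And>U. U \<in> P \<Longrightarrow> subtopology M U = \<sigma> U"
proof -
  define B where "B = (\<lambda>W. openin T W \<or> (\<exists>U\<in>P. openin (\<sigma> U) W))"
  have sub: "openin (subtopology T U) W \<longleftrightarrow> openin T W \<and> W \<subseteq> U" if "U \<in> P" for U W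
    using openin_open_subtopology[OF P(2)[OF that]] by blast
  have top\<sigma>: "topspace (\<sigma> U) = U" if "U \<in> P" for U
    using lextD(2)[OF ext[OF that]] openin_subset[OF P(2)[OF that]] by auto
  have mixed: "openin (\<sigma> U) (V \<inter> W)" if "U \<in> P" "openin (\<sigma> U) W" "openin T V" for U V W
  proof -
    have "openin (\<sigma> U) (V \<inter> U)" 
      by (rule lextD(3)[OF ext[OF that(1)]]) (use that P(2) sub in auto)
    moreover have "V \<inter> W = (V \<inter> U) \<inter> W" using openin_subset[OF that(2)] top\<sigma>[OF that(1)] by blast
    ultimately show ?thesis using that(2) by auto
  qed
  have int: "B (V \<inter> W)" if VW: "B V" "B W" for V W
  proof -
    consider "openin T V" "openin T W" | U where "U \<in> P" "openin (\<sigma> U) W" "openin T V"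
      | U where "U \<in> P" "openin (\<sigma> U) V" "openin T W"
      | U U' where "U \<in> P" "openin (\<sigma> U) V" "U' \<in> P" "openin (\<sigma> U') W"
      using VW unfolding B_def by blast
    then show ?thesis
    proof cases
      case (2 U)
      then show ?thesis using mixed[of U W V] unfolding B_def by blast
    next
      case (3 U)
      then show ?thesis using mixed[of U V W] unfolding B_def by (auto simp: Int_commute)
    next
      case (4 U U')
      show ?thesis
      proof (cases "U = U'")
        case False
        then have "U \<inter> U' = {}" using P(1) 4 by (auto simp: disjoint_def)
        then have "V \<inter> W = {}" using openin_subset 4 top\<sigma> by blast
        then show ?thesis by (simp add: B_def)
      qed (use 4 in \<open>auto simp: B_def\<close>)
    qed (auto simp: B_def)
  qed
  define S where "S = base_top B"
  have op: "openin S W \<longleftrightarrow> (\<forall>x\<in>W. \<exists>U. B U \<and> x \<in> U \<and> U \<subseteq> W)" for W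
    unfolding S_def by (rule openin_base_top) (rule int)
  have up: "openin S W" if "B W" for W using that unfolding op by blast
  have Btop: "W \<subseteq> topspace T" if "B W" for W
  proof -
    consider "openin T W" | D where "D \<in> P" "openin (\<sigma> D) W" using \<open>B W\<close> unfolding B_def by blast
    then show ?thesis
    proof cases
      case (2 D)
      then have "W \<subseteq> D" "D \<subseteq> topspace T" using openin_subset[of "\<sigma> D" W] top\<sigma>[of D] openin_subset[OF P(2)[OF 2(1)]] by auto
      then show ?thesis by blast
    qed (rule openin_subset)
  qed
  have top: "topspace S = topspace T"
  proof
    show "topspace T \<subseteq> topspace S" using up[of "topspace T"] openin_subset by (auto simp: B_def)
    show "topspace S \<subseteq> topspace T"
    proof
      fix x assume "x \<in> topspace S"
      then obtain U where "B U" "x \<in> U" using op[of "topspace S"] openin_topspace[of S] by blast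
      then show "x \<in> topspace T" using Btop by blast
    qed
  qed
  have S: "lext S T r"
    unfolding lext_def
  proof (intro conjI allI impI)
    show "is_rank S r" unfolding is_rank_def
    proof (intro conjI allI impI ballI)
      fix U x \<beta> assume *: "openin S U \<and> x \<in> U \<and> \<beta> < r x"
      then obtain W where W: "B W" "x \<in> W" "W \<subseteq> U" unfolding op by blast
      then consider "openin T W" | D where "D \<in> P" "openin (\<sigma> D) W" unfolding B_def by blast
      then have "\<exists>y\<in>W. r y = \<beta>"
      proof cases
        case 1
        then show ?thesis using is_rank_lower[OF T, of W x \<beta>] W * by blast
      next
        case (2 D)
        then show ?thesis using is_rank_lower[OF lextD(1)[OF ext[OF 2(1)]], of W x \<beta>] W * by blast
      qed
      then show "\<exists>y\<in>U. r y = \<beta>" using W by blast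
    next
      fix x assume "x \<in> topspace S"
      then show "\<exists>U. openin S U \<and> x \<in> U \<and> (\<forall>y\<in>U. y \<noteq> x \<longrightarrow> r y < r x)"
        using is_rank_nbhd[OF T openin_topspace, of x] up unfolding top B_def by metis
    qed
  next
    fix U x assume *: "openin S U \<and> x \<in> U \<and> \<not> limit_ordinal (r x)"
    then obtain W where W: "B W" "x \<in> W" "W \<subseteq> U" unfolding op by blast
    then consider "openin T W" | D where "D \<in> P" "openin (\<sigma> D) W" unfolding B_def by blast
    then show "\<exists>V. openin T V \<and> x \<in> V \<and> V \<subseteq> U"
    proof cases
      case (2 D)
      then obtain V where "openin (subtopology T D) V" "x \<in> V" "V \<subseteq> W"
        using lextD(4)[OF ext[OF 2(1)] 2(2) W(2)] * by blast
      then have "openin T V" "V \<subseteq> U" using sub[OF 2(1)] W by auto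
      then show ?thesis using \<open>x \<in> V\<close> by blast
    next
      case 1
      then show ?thesis using W by (intro exI[of _ W]) simp
    qed
  qed (use top up in \<open>auto simp: B_def\<close>)
  obtain M where M: "lext M S r" "lmax M r" using ex_lmax[OF lextD(1)[OF S]] .
  have "subtopology M U = \<sigma> U" if U: "U \<in> P" for U
  proof (rule lmax_lext_eq[OF max[OF U] lextD(1)[OF ext[OF U]]])
    have MU: "openin M U" using lextD(3)[OF M(1)] up[of U] P(2)[OF U] by (simp add: B_def)
    show "lext (subtopology M U) (\<sigma> U) r"
      unfolding lext_def
    proof (intro conjI allI impI)
      show "is_rank (subtopology M U) r" by (rule is_rank_subtopology[OF lextD(1)[OF M(1)] MU])
      show "topspace (subtopology M U) = topspace (\<sigma> U)"
        using top\<sigma>[OF U] openin_subset[OF MU] by auto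
    next
      fix W assume W: "openin (\<sigma> U) W"
      then have "B W" using U unfolding B_def by blast
      then have "openin M W" using lextD(3)[OF M(1) up] by blast
      then show "openin (subtopology M U) W"
        using openin_subset[OF W] top\<sigma>[OF U] by (simp add: openin_open_subtopology[OF MU])
    next
      fix W x assume *: "openin (subtopology M U) W \<and> x \<in> W \<and> \<not> limit_ordinal (r x)"
      then have "openin M W" "W \<subseteq> U" using openin_open_subtopology[OF MU] by auto
      then obtain V where V: "openin T V" "x \<in> V" "V \<subseteq> W"
        using lextD(4)[OF lext_trans[OF M(1) S], of W x] * by blast
      then have "openin (subtopology T U) V" using sub[OF U] \<open>W \<subseteq> U\<close> by simp
      then have "openin (\<sigma> U) V" by (rule lextD(3)[OF ext[OF U]])
      then show "\<exists>V. openin (\<sigma> U) V \<and> x \<in> V \<and> V \<subseteq> W" using V by blast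
    qed
  qed
  then show ?thesis using that lext_trans[OF M(1) S] M(2) by blast
qed

section \<open>d-maps and the topology \<open>\<tau>\<^sup>+\<close>\<close>

definition dmap :: "('a \<Rightarrow> 'b) \<Rightarrow> 'a topology \<Rightarrow> 'b topology \<Rightarrow> bool"
  where "dmap f T S \<longleftrightarrow>
    (\<forall>x\<in>topspace T. f x \<in> topspace S) \<and>
    (\<forall>V. openin S V \<longrightarrow> openin T {x\<in>topspace T. f x \<in> V}) \<and>
    (\<forall>U. openin T U \<longrightarrow> openin S (f ` U)) \<and>
    (\<forall>x\<in>topspace T. \<exists>U. openin T U \<and> x \<in> U \<and> (\<forall>y\<in>U. f y = f x \<longrightarrow> y = x))"

lemma dmapD:
  assumes "dmap f T S"
  shows "\<And>x. x \<in> topspace T \<Longrightarrow> f x \<in> topspace S"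
    "\<And>V. openin S V \<Longrightarrow> openin T {x\<in>topspace T. f x \<in> V}"
    "\<And>U. openin T U \<Longrightarrow> openin S (f ` U)"
    "\<And>x. x \<in> topspace T \<Longrightarrow> \<exists>U. openin T U \<and> x \<in> U \<and> (\<forall>y\<in>U. f y = f x \<longrightarrow> y = x)"
  using assms unfolding dmap_def by auto

text \<open>Openness of \<open>f\<close> provides all smaller ranks; continuity, together with
  discreteness of fibres, provides the neighbourhood in which the other ranks are smaller.\<close>

lemma dmap_is_rank:
  assumes f: "dmap f T S" and S: "is_rank S s"
  shows "is_rank T (\<lambda>x. s (f x))"
  unfolding is_rank_def
proof (intro conjI allI impI ballI)
  fix U x \<beta> assume *: "openin T U \<and> x \<in> U \<and> \<beta> < s (f x)"
  then have "openin S (f ` U)" "f x \<in> f ` U" using dmapD(3)[OF f] by auto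
  then obtain y where "y \<in> f ` U" "s y = \<beta>" using is_rank_lower[OF S, of "f ` U" "f x" \<beta>] * by blast
  then show "\<exists>y\<in>U. s (f y) = \<beta>" by blast
next
  fix x assume x: "x \<in> topspace T"
  obtain V where V: "openin S V" "f x \<in> V" "\<And>y. y \<in> V \<Longrightarrow> y \<noteq> f x \<Longrightarrow> s y < s (f x)"
    using is_rank_nbhd[OF S openin_topspace dmapD(1)[OF f x]] by metis
  obtain U where U: "openin T U" "x \<in> U" "\<And>y. y \<in> U \<Longrightarrow> f y = f x \<Longrightarrow> y = x"
    using dmapD(4)[OF f x] by blast
  have "openin T (U \<inter> {x\<in>topspace T. f x \<in> V})" using U(1) dmapD(2)[OF f V(1)] by blast
  then show "\<exists>U. openin T U \<and> x \<in> U \<and> (\<forall>y\<in>U. y \<noteq> x \<longrightarrow> s (f y) < s (f x))"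
    using U V x by (intro exI[of _ "U \<inter> {x\<in>topspace T. f x \<in> V}"]) auto
qed

lemma derived_setD:
  "x \<in> T derived_set_of A \<Longrightarrow> openin T U \<Longrightarrow> x \<in> U \<Longrightarrow> \<exists>y. y \<noteq> x \<and> y \<in> A \<and> y \<in> U"
  by (simp add: in_derived_set_of)

text \<open>The reason for using d-maps: the derived set of a preimage is the preimage of the
  derived set, so truth of modal formulas can be pulled back.\<close>

lemma dmap_derived_set:
  assumes f: "dmap f T S" and x: "x \<in> topspace T"
  shows "x \<in> T derived_set_of {y\<in>topspace T. f y \<in> A} \<longleftrightarrow> f x \<in> S derived_set_of A"
proof
  assume d: "x \<in> T derived_set_of {y\<in>topspace T. f y \<in> A}"
  have "\<exists>y. y \<noteq> f x \<and> y \<in> A \<and> y \<in> V" if V: "f x \<in> V" "openin S V" for V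
  proof -
    obtain U where U: "openin T U" "x \<in> U" "\<And>y. y \<in> U \<Longrightarrow> f y = f x \<Longrightarrow> y = x"
      using dmapD(4)[OF f x] by blast
    have o: "openin T (U \<inter> {x\<in>topspace T. f x \<in> V})" "x \<in> U \<inter> {x\<in>topspace T. f x \<in> V}"
      using U dmapD(2)[OF f V(2)] x V by auto
    obtain y where "y \<noteq> x" "f y \<in> A" "y \<in> U \<inter> {x\<in>topspace T. f x \<in> V}"
      using derived_setD[OF d o] by auto
    then show ?thesis using U(3) by blast
  qed
  then show "f x \<in> S derived_set_of A" using dmapD(1)[OF f x] by (auto simp: in_derived_set_of)
next
  assume d: "f x \<in> S derived_set_of A"
  have "\<exists>y. y \<noteq> x \<and> y \<in> {y\<in>topspace T. f y \<in> A} \<and> y \<in> U" if U: "x \<in> U" "openin T U" for U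
  proof -
    have o: "openin S (f ` U)" "f x \<in> f ` U" using U dmapD(3)[OF f] by auto
    obtain y where "y \<noteq> f x" "y \<in> A" "y \<in> f ` U" using derived_setD[OF d o] by auto
    then obtain z where "z \<in> U" "y = f z" by blast
    then show ?thesis using openin_subset[OF U(2)] \<open>y \<noteq> f x\<close> \<open>y \<in> A\<close> by (intro exI[of _ z]) auto
  qed
  then show "x \<in> T derived_set_of {y\<in>topspace T. f y \<in> A}" using x by (auto simp: in_derived_set_of)
qed

lemma dmap_subtopology:
  assumes f: "dmap f T S" and D: "openin S D"
  shows "dmap f (subtopology T {x\<in>topspace T. f x \<in> D}) (subtopology S D)"
proof -
  let ?R = "{x\<in>topspace T. f x \<in> D}"
  have R: "openin T ?R" by (rule dmapD(2)[OF f D])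
  have sR: "openin (subtopology T ?R) U \<longleftrightarrow> openin T U \<and> U \<subseteq> ?R" for U
    using openin_open_subtopology[OF R] by blast
  have sD: "openin (subtopology S D) U \<longleftrightarrow> openin S U \<and> U \<subseteq> D" for U
    using openin_open_subtopology[OF D] by blast
  show ?thesis
    unfolding dmap_def sR sD
  proof (intro conjI allI impI ballI)
    fix x assume "x \<in> topspace (subtopology T ?R)"
    then show "f x \<in> topspace (subtopology S D)" using openin_subset[OF D] by auto
  next
    fix V assume V: "openin S V \<and> V \<subseteq> D"
    have "{x \<in> topspace (subtopology T ?R). f x \<in> V} = {x\<in>topspace T. f x \<in> V}" using V by auto
    then show "openin T {x \<in> topspace (subtopology T ?R). f x \<in> V}" using dmapD(2)[OF f] V by auto
  next
    fix x assume "x \<in> topspace (subtopology T ?R)"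
    then have x: "x \<in> topspace T" "f x \<in> D" by auto
    then obtain U where "openin T U" "x \<in> U" "\<And>y. y \<in> U \<Longrightarrow> f y = f x \<Longrightarrow> y = x"
      using dmapD(4)[OF f x(1)] by blast
    then show "\<exists>U. (openin T U \<and> U \<subseteq> ?R) \<and> x \<in> U \<and> (\<forall>y\<in>U. f y = f x \<longrightarrow> y = x)"
      using R x by (intro exI[of _ "U \<inter> ?R"]) auto
  qed (use dmapD(3)[OF f] in auto)
qed

text \<open>\<open>S0\<close> is the coarsest refinement of \<open>T\<close> for which
  \<open>f\<close> is continuous into \<open>S'\<close>, and \<open>T'\<close> is any maximal
  extension of it. The danger is that \<open>f\<close> is no longer open, since \<open>T'\<close>
  has new open sets; maximality of \<open>S'\<close> excludes this.\<close>

lemma lmax_dmap_lift: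
  assumes f: "dmap f T S" and S: "is_rank S s" and ext: "lext S' S s" and max: "lmax S' s"
  obtains T' where "lext T' T (\<lambda>x. s (f x))" "lmax T' (\<lambda>x. s (f x))" "dmap f T' S'"
proof -
  let ?r = "\<lambda>x. s (f x)"
  have T: "is_rank T ?r" by (rule dmap_is_rank[OF f S])
  have S': "is_rank S' s" by (rule lextD(1)[OF ext])
  have topS: "topspace S' = topspace S" by (rule lextD(2)[OF ext])
  define B where "B = (\<lambda>W. \<exists>U V. openin T U \<and> openin S' V \<and> W = {x\<in>U. f x \<in> V})"
  have int: "B (W \<inter> W')" if "B W" "B W'" for W W'
  proof -
    obtain U V where 1: "openin T U" "openin S' V" "W = {x\<in>U. f x \<in> V}"
      using \<open>B W\<close> unfolding B_def by auto
    obtain U' V' where 2: "openin T U'" "openin S' V'" "W' = {x\<in>U'. f x \<in> V'}"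
      using \<open>B W'\<close> unfolding B_def by auto
    have "openin T (U \<inter> U')" "openin S' (V \<inter> V')" "W \<inter> W' = {x\<in>U \<inter> U'. f x \<in> V \<inter> V'}"
      using 1 2 by auto
    then show ?thesis unfolding B_def by blast
  qed
  define S0 where "S0 = base_top B"
  have op: "openin S0 W \<longleftrightarrow> (\<forall>x\<in>W. \<exists>U. B U \<and> x \<in> U \<and> U \<subseteq> W)" for W
    unfolding S0_def by (rule openin_base_top) (rule int)
  have up: "openin S0 W" if "B W" for W using that unfolding op by blast
  have old: "openin S0 U" if U: "openin T U" for U
  proof (rule up)
    have "U = {x\<in>U. f x \<in> topspace S'}" using openin_subset[OF U] dmapD(1)[OF f] topS by auto
    then show "B U" unfolding B_def using U openin_topspace by blast
  qed
  have top: "topspace S0 = topspace T"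
  proof
    show "topspace T \<subseteq> topspace S0" using old[OF openin_topspace] openin_subset by blast
    show "topspace S0 \<subseteq> topspace T"
    proof
      fix x assume "x \<in> topspace S0"
      then obtain W where "B W" "x \<in> W" using op[of "topspace S0"] openin_topspace[of S0] by blast
      then obtain U where "openin T U" "x \<in> U" unfolding B_def by auto
      then show "x \<in> topspace T" using openin_subset by blast
    qed
  qed
  have cont0: "openin S0 {x\<in>topspace T. f x \<in> V}" if "openin S' V" for V
    by (rule up) (use that in \<open>auto simp: B_def\<close>)
  have d0: "dmap f S0 S'"
    unfolding dmap_def top topS
  proof (intro conjI allI impI ballI)
    fix U assume U: "openin S0 U"
    show "openin S' (f ` U)"
    proof (subst openin_subopen, intro ballI)
      fix y assume "y \<in> f ` U"
      then obtain x where x: "x \<in> U" "y = f x" by blast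
      then obtain W where W: "B W" "x \<in> W" "W \<subseteq> U" using U unfolding op by blast
      then obtain U' V where V: "openin T U'" "openin S' V" "W = {x\<in>U'. f x \<in> V}" unfolding B_def by auto
      have "openin S' (f ` U' \<inter> V)" using lextD(3)[OF ext dmapD(3)[OF f V(1)]] V(2) by blast
      then show "\<exists>V. openin S' V \<and> y \<in> V \<and> V \<subseteq> f ` U"
        using W V x by (intro exI[of _ "f ` U' \<inter> V"]) auto
    qed
  next
    fix x assume "x \<in> topspace T"
    then show "\<exists>U. openin S0 U \<and> x \<in> U \<and> (\<forall>y\<in>U. f y = f x \<longrightarrow> y = x)"
      using dmapD(4)[OF f, of x] old by blast
  qed (use dmapD(1)[OF f] cont0 in auto)
  have S0T: "lext S0 T ?r"
    unfolding lext_def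
  proof (intro conjI allI impI)
    show "is_rank S0 ?r" by (rule dmap_is_rank[OF d0 S'])
    fix U x assume *: "openin S0 U \<and> x \<in> U \<and> \<not> limit_ordinal (s (f x))"
    then obtain W where W: "B W" "x \<in> W" "W \<subseteq> U" unfolding op by blast
    then obtain U' V where V: "openin T U'" "openin S' V" "W = {x\<in>U'. f x \<in> V}" unfolding B_def by auto
    then obtain V' where V': "openin S V'" "f x \<in> V'" "V' \<subseteq> V" using lextD(4)[OF ext V(2), of "f x"] W * by auto
    have "openin T (U' \<inter> {x\<in>topspace T. f x \<in> V'})" using V(1) dmapD(2)[OF f V'(1)] by blast
    moreover have "x \<in> U' \<inter> {x\<in>topspace T. f x \<in> V'}" using W V V' openin_subset[OF V(1)] by auto
    moreover have "U' \<inter> {x\<in>topspace T. f x \<in> V'} \<subseteq> U" using W V V' by auto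
    ultimately show "\<exists>V. openin T V \<and> x \<in> V \<and> V \<subseteq> U" by blast
  qed (use top old in auto)
  obtain T' where T': "lext T' S0 ?r" "lmax T' ?r" using ex_lmax[OF lextD(1)[OF S0T]] by blast
  \<comment> \<open>Induction on rank. At a limit rank the image of the lower part of
    \<open>U\<close> is open by induction and has unbounded ranks near \<open>f x\<close>, because
    \<open>T'\<close> keeps the rank and \<open>f\<close> is continuous. By \<open>lmax\<close> for
    \<open>S'\<close> it becomes open after adding \<open>f x\<close>.\<close>
  have op': "\<exists>V. openin S' V \<and> f x \<in> V \<and> V \<subseteq> f ` U" if "openin T' U" "x \<in> U" for U x
    using that
  proof (induction "s (f x)" arbitrary: x U rule: less_induct)
    case less
    note U = less.prems(1) and x = less.prems(2)
    show ?case
    proof (cases "limit_ordinal (s (f x))")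
      case False
      then obtain V where V: "openin S0 V" "x \<in> V" "V \<subseteq> U" using lextD(4)[OF T'(1) U x] by blast
      then show ?thesis using dmapD(3)[OF d0 V(1)] by (intro exI[of _ "f ` V"]) auto
    next
      case limit: True
      define U1 where "U1 = {y\<in>U. s (f y) < s (f x)}"
      have U1: "openin T' U1" unfolding U1_def by (rule is_rank_openin_less[OF lextD(1)[OF T'(1)] U])
      have "openin S' (f ` U1)"
      proof (subst openin_subopen, intro ballI)
        fix z assume "z \<in> f ` U1"
        then obtain y where "y \<in> U1" "z = f y" by blast
        then show "\<exists>V. openin S' V \<and> z \<in> V \<and> V \<subseteq> f ` U1" using less.hyps[OF _ U1, of y] by (auto simp: U1_def)
      qed
      moreover have "f x \<in> topspace S'"
        using openin_subset[OF U] x lextD(2)[OF T'(1)] top dmapD(1)[OF f] topS by auto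
      moreover have "\<exists>y\<in>V \<inter> f ` U1. \<beta> \<le> s y" if V: "openin S' V" "f x \<in> V" "\<beta> < s (f x)" for V \<beta>
      proof -
        have "openin T' (U \<inter> {x\<in>topspace T. f x \<in> V})" using U lextD(3)[OF T'(1) cont0[OF V(1)]] by blast
        moreover have "x \<in> U \<inter> {x\<in>topspace T. f x \<in> V}"
          using x V openin_subset[OF U] lextD(2)[OF T'(1)] top by auto
        ultimately obtain y where "y \<in> U \<inter> {x\<in>topspace T. f x \<in> V}" "s (f y) = \<beta>"
          using is_rank_lower[OF lextD(1)[OF T'(1)] _ _ V(3)] by blast
        then show ?thesis using V by (intro bexI[of _ "f y"]) (auto simp: U1_def)
      qed
      ultimately have "openin S' (insert (f x) (f ` U1))" by (rule lmaxD[OF max _ _ limit])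
      then show ?thesis using x by (intro exI[of _ "insert (f x) (f ` U1)"]) (auto simp: U1_def)
    qed
  qed
  have top': "topspace T' = topspace T" using lextD(2)[OF T'(1)] top by simp
  have "dmap f T' S'"
    unfolding dmap_def top' topS
  proof (intro conjI allI impI ballI)
    fix U assume "openin T' U"
    then show "openin S' (f ` U)" using op' by (subst openin_subopen) blast
  next
    fix x assume "x \<in> topspace T"
    then obtain U where U: "openin T U" "x \<in> U" "\<forall>y\<in>U. f y = f x \<longrightarrow> y = x"
      using dmapD(4)[OF f, of x] by blast
    then have "openin T' U" using old lextD(3)[OF T'(1)] by blast
    then show "\<exists>U. openin T' U \<and> x \<in> U \<and> (\<forall>y\<in>U. f y = f x \<longrightarrow> y = x)" using U by blast
  qed (use dmapD(1)[OF f] cont0 lextD(3)[OF T'(1)] in auto)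
  then show ?thesis using that lext_trans[OF T'(1) S0T] T'(2) by blast
qed

section \<open>The topology \<open>plus_topology T\<close> over an \<ell>-maximal
  \<open>T\<close>\<close>

lemma plus_topology_openin: "openin T U \<Longrightarrow> openin (plus_topology T) U"
  unfolding plus_topology_def by (rule topology_generated_by_Basis) blast

lemma plus_topology_derived: "A \<subseteq> topspace T \<Longrightarrow> openin (plus_topology T) (T derived_set_of A)"
  unfolding plus_topology_def by (rule topology_generated_by_Basis) blast

lemma topspace_plus_topology: "topspace (plus_topology T) = topspace T"
  unfolding plus_topology_def topology_generated_by_topspace
  using derived_set_of_subset_topspace[of T] openin_subset[of T] openin_topspace[of T] by blast

text \<open>For \<beta> = \<gamma>+1 the set is the derived set of the level of rank \<gamma>, for
  \<beta> = 0 it is the whole space. This is why thresholds for ranks are non-limit ordinals from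
  here on.\<close>

lemma rank_ge_openin_plus:
  assumes "is_rank T r" "\<not> limit_ordinal \<beta>"
  shows "openin (plus_topology T) {x\<in>topspace T. \<beta> \<le> r x}"
proof (cases \<beta> rule: cord_cases)
  case zero
  then show ?thesis using plus_topology_openin[OF openin_topspace] by simp
next
  case (suc \<gamma>)
  have "openin (plus_topology T) (T derived_set_of {x\<in>topspace T. r x = \<gamma>})"
    by (rule plus_topology_derived) auto
  then show ?thesis by (simp add: suc derived_set_rank_eq[OF assms(1)] osuc_le)
qed (use assms in simp)

text \<open>Let \<open>V\<close> be the complement of the closure of \<open>A\<close>. At a point
  \<open>x\<close> of limit rank, if \<open>V\<close> met all neighbourhoods in unbounded ranks,
  then \<open>lmax\<close> would make \<open>V\<close> with \<open>x\<close> added a neighbourhood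
  of \<open>x\<close> without further points of \<open>A\<close>. So near \<open>x\<close> the ranks
  on \<open>V\<close> are bounded, and beyond the bound every point is a limit point of
  \<open>A\<close>. At the other ranks, \<open>x\<close> is the only point of its rank or more in a
  suitable neighbourhood.\<close>

lemma derived_set_rank_nbhd:
  assumes T: "is_rank T r" and max: "lmax T r" and x: "x \<in> T derived_set_of A"
  obtains U \<beta> where "openin T U" "x \<in> U" "\<not> limit_ordinal \<beta>" "\<beta> \<le> r x"
    "{y\<in>U. \<beta> \<le> r y} \<subseteq> T derived_set_of A"
proof (cases "limit_ordinal (r x)")
  case False
  have "x \<in> topspace T" using x by (simp add: in_derived_set_of)
  then obtain U where "openin T U" "x \<in> U" "\<And>y. y \<in> U \<Longrightarrow> y \<noteq> x \<Longrightarrow> r y < r x"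
    using is_rank_nbhd[OF T openin_topspace] by metis
  then have "{y\<in>U. r x \<le> r y} \<subseteq> T derived_set_of A" using x by (force simp: not_less[symmetric])
  then show ?thesis using that[of U "r x"] False \<open>openin T U\<close> \<open>x \<in> U\<close> by simp
next
  case limit: True
  have xT: "x \<in> topspace T" using x by (simp add: in_derived_set_of)
  define V where "V = topspace T - T closure_of A"
  have V: "openin T V" unfolding V_def by (rule openin_diff) simp_all
  have cl: "y \<in> V \<or> y \<in> A \<or> y \<in> T derived_set_of A" if "y \<in> topspace T" for y
    using that by (auto simp: V_def closure_of)
  have "\<exists>U \<beta>. openin T U \<and> x \<in> U \<and> \<beta> < r x \<and> (\<forall>y\<in>U \<inter> V. r y < \<beta>)"
  proof (rule ccontr)
    assume neg: "\<not> ?thesis"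
    have "openin T (insert x V)"
    proof (rule lmaxD[OF max V xT limit])
      fix U \<beta> assume "openin T U" "x \<in> U" "\<beta> < r x"
      with neg have "\<not> (\<forall>y\<in>U \<inter> V. r y < \<beta>)" by blast
      then show "\<exists>y\<in>U \<inter> V. \<beta> \<le> r y" by (auto simp: not_less)
    qed
    then obtain y where "y \<noteq> x" "y \<in> A" "y \<in> insert x V" using x unfolding in_derived_set_of by auto
    then show False by (auto simp: V_def closure_of)
  qed
  then obtain U \<beta> where U: "openin T U" "x \<in> U" "\<beta> < r x" "\<And>y. y \<in> U \<Longrightarrow> y \<in> V \<Longrightarrow> r y < \<beta>" by blast
  \<comment> \<open>The bound leaves open whether \<open>y\<close> is an isolated point of
    \<open>A\<close>. In that case a neighbourhood \<open>W\<close> of \<open>y\<close> has no other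
    points of \<open>A\<close>, but it contains some \<open>z\<close> of rank exactly \<beta>, which
    lies neither in \<open>V\<close> nor in \<open>A\<close> and so is a limit point of
    \<open>A\<close>. Near \<open>z\<close> the other ranks are below \<beta>, so the points of
    \<open>A\<close> found there differ from \<open>y\<close>.\<close>
  have "y \<in> T derived_set_of A" if y: "y \<in> U" "\<beta> < r y" for y
  proof (rule ccontr)
    assume n: "y \<notin> T derived_set_of A"
    have yT: "y \<in> topspace T" using y U openin_subset by blast
    then obtain W where W: "openin T W" "y \<in> W" "\<And>z. z \<in> W \<Longrightarrow> z \<noteq> y \<Longrightarrow> z \<notin> A"
      using n by (auto simp: in_derived_set_of)
    have "openin T (U \<inter> W)" "y \<in> U \<inter> W" using U W y by auto
    then obtain z where z: "z \<in> U \<inter> W" "r z = \<beta>" using is_rank_lower[OF T, of "U \<inter> W" y \<beta>] y(2) by blast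
    then have zT: "z \<in> topspace T" and zy: "z \<noteq> y" using openin_subset[OF U(1)] y by auto
    then have "z \<notin> A" "z \<notin> V" using W z U(4)[of z] by auto
    then have zd: "z \<in> T derived_set_of A" using cl[OF zT] by blast
    obtain W' where W': "openin T W'" "z \<in> W'" "\<And>u. u \<in> W' \<Longrightarrow> u \<noteq> z \<Longrightarrow> r u < r z"
      using is_rank_nbhd[OF T openin_topspace zT] by metis
    have "openin T (W \<inter> W')" "z \<in> W \<inter> W'" using W W' z by auto
    then obtain u where "u \<noteq> z" "u \<in> A" "u \<in> W \<inter> W'" using zd unfolding in_derived_set_of by auto
    then show False using W'(3)[of u] W(3)[of u] y z by (cases "u = y") auto
  qed
  then have "{y\<in>U. osuc \<beta> \<le> r y} \<subseteq> T derived_set_of A" by (auto simp: osuc_le)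
  then show ?thesis using that[of U "osuc \<beta>"] U by (simp add: osuc_le)
qed

text \<open>The neighbourhoods of \<open>x\<close> in \<open>\<tau>\<^sup>+\<close> are cut out by ranks alone. For \<open>r x\<close> not a limit,
  the choice \<open>\<beta> = r x\<close> shows that \<open>x\<close> becomes isolated.\<close>

lemma openin_plus_iff:
  assumes T: "is_rank T r" and max: "lmax T r"
  shows "openin (plus_topology T) W \<longleftrightarrow> W \<subseteq> topspace T \<and>
    (\<forall>x\<in>W. \<exists>U \<beta>. openin T U \<and> x \<in> U \<and> \<not> limit_ordinal \<beta> \<and> \<beta> \<le> r x \<and> {y\<in>U. \<beta> \<le> r y} \<subseteq> W)"
    (is "_ \<longleftrightarrow> _ \<and> ?nb W")
proof
  assume W: "openin (plus_topology T) W"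
  have "?nb W"
    using W[unfolded plus_topology_def openin_topology_generated_by_iff]
  proof (induction rule: generate_topology_on.induct)
    case (Int a b)
    show ?case
    proof
      fix x assume "x \<in> a \<inter> b"
      then have x: "x \<in> a" "x \<in> b" by auto
      obtain U \<beta> where 1: "openin T U" "x \<in> U" "\<not> limit_ordinal \<beta>" "\<beta> \<le> r x" "{y\<in>U. \<beta> \<le> r y} \<subseteq> a"
        using bspec[OF Int.IH(1) x(1)] by (elim exE conjE) (rule that)
      obtain U' \<beta>' where 2: "openin T U'" "x \<in> U'" "\<not> limit_ordinal \<beta>'" "\<beta>' \<le> r x" "{y\<in>U'. \<beta>' \<le> r y} \<subseteq> b"
        using bspec[OF Int.IH(2) x(2)] by (elim exE conjE) (rule that)
      have "\<not> limit_ordinal (max \<beta> \<beta>')" "max \<beta> \<beta>' \<le> r x" "{y\<in>U \<inter> U'. max \<beta> \<beta>' \<le> r y} \<subseteq> a \<inter> b"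
        using 1 2 by (auto simp: max_def)
      then show "\<exists>U \<beta>. openin T U \<and> x \<in> U \<and> \<not> limit_ordinal \<beta> \<and> \<beta> \<le> r x \<and> {y\<in>U. \<beta> \<le> r y} \<subseteq> a \<inter> b"
        using 1 2 by (intro exI[of _ "U \<inter> U'"] exI[of _ "max \<beta> \<beta>'"]) auto
    qed
  next
    case (UN K)
    show ?case
    proof
      fix x assume "x \<in> \<Union>K"
      then obtain k where "k \<in> K" "x \<in> k" by blast
      then obtain U \<beta> where "openin T U" "x \<in> U" "\<not> limit_ordinal \<beta>" "\<beta> \<le> r x" "{y\<in>U. \<beta> \<le> r y} \<subseteq> k"
        using bspec[OF UN.IH[OF \<open>k \<in> K\<close>] \<open>x \<in> k\<close>] by (elim exE conjE) (rule that)
      then show "\<exists>U \<beta>. openin T U \<and> x \<in> U \<and> \<not> limit_ordinal \<beta> \<and> \<beta> \<le> r x \<and> {y\<in>U. \<beta> \<le> r y} \<subseteq> \<Union>K"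
        using \<open>k \<in> K\<close> by (intro exI[of _ U] exI[of _ \<beta>]) auto
    qed
  next
    case (Basis s)
    then consider "openin T s" | A where "s = T derived_set_of A" by blast
    then show ?case
    proof cases
      case 1
      show ?thesis
      proof
        fix x assume "x \<in> s"
        then show "\<exists>U \<beta>. openin T U \<and> x \<in> U \<and> \<not> limit_ordinal \<beta> \<and> \<beta> \<le> r x \<and> {y\<in>U. \<beta> \<le> r y} \<subseteq> s"
          using 1 by (intro exI[of _ s] exI[of _ 0]) auto
      qed
    next
      case (2 A)
      show ?thesis
      proof
        fix x assume "x \<in> s"
        then obtain U \<beta> where "openin T U" "x \<in> U" "\<not> limit_ordinal \<beta>" "\<beta> \<le> r x" "{y\<in>U. \<beta> \<le> r y} \<subseteq> s"
          using derived_set_rank_nbhd[OF T max \<open>x \<in> s\<close>[unfolded 2]] unfolding 2 by blast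
        then show "\<exists>U \<beta>. openin T U \<and> x \<in> U \<and> \<not> limit_ordinal \<beta> \<and> \<beta> \<le> r x \<and> {y\<in>U. \<beta> \<le> r y} \<subseteq> s" by blast
      qed
    qed
  qed simp
  then show "W \<subseteq> topspace T \<and> ?nb W" using openin_subset[OF W] by (simp add: topspace_plus_topology)
next
  assume W: "W \<subseteq> topspace T \<and> ?nb W"
  show "openin (plus_topology T) W"
  proof (subst openin_subopen, intro ballI)
    fix x assume x: "x \<in> W"
    then obtain U \<beta> where U: "openin T U" "x \<in> U" "\<not> limit_ordinal \<beta>" "\<beta> \<le> r x" "{y\<in>U. \<beta> \<le> r y} \<subseteq> W"
      using bspec[OF conjunct2[OF W] x] by (elim exE conjE) (rule that)
    have "openin (plus_topology T) (U \<inter> {y\<in>topspace T. \<beta> \<le> r y})"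
      using plus_topology_openin[OF U(1)] rank_ge_openin_plus[OF T U(3)] by blast
    then show "\<exists>V. openin (plus_topology T) V \<and> x \<in> V \<and> V \<subseteq> W"
      using U x W by (intro exI[of _ "U \<inter> {y\<in>topspace T. \<beta> \<le> r y}"]) auto
  qed
qed

text \<open>By \<open>openin_plus_iff\<close> both sides have neighbourhoods of the form "open set
  cut at a rank threshold", and \<open>f\<close> preserves ranks.\<close>

lemma dmap_plus:
  assumes f: "dmap f T S" and S: "is_rank S s" and maxS: "lmax S s" and maxT: "lmax T (\<lambda>x. s (f x))"
  shows "dmap f (plus_topology T) (plus_topology S)"
proof -
  note opS = openin_plus_iff[OF S maxS] and opT = openin_plus_iff[OF dmap_is_rank[OF f S] maxT]
  show ?thesis
    unfolding dmap_def topspace_plus_topology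
  proof (intro conjI allI impI ballI)
    fix V assume V: "openin (plus_topology S) V"
    show "openin (plus_topology T) {x\<in>topspace T. f x \<in> V}"
      unfolding opT
    proof (intro conjI ballI)
      fix x assume x: "x \<in> {x\<in>topspace T. f x \<in> V}"
      then obtain U \<beta> where U: "openin S U" "f x \<in> U" "\<not> limit_ordinal \<beta>" "\<beta> \<le> s (f x)" "{y\<in>U. \<beta> \<le> s y} \<subseteq> V"
        using bspec[OF conjunct2[OF V[unfolded opS]], of "f x"] by auto
      then have "openin T {x\<in>topspace T. f x \<in> U}" using dmapD(2)[OF f] by blast
      then show "\<exists>U \<beta>. openin T U \<and> x \<in> U \<and> \<not> limit_ordinal \<beta> \<and> \<beta> \<le> s (f x) \<and>
          {y\<in>U. \<beta> \<le> s (f y)} \<subseteq> {x\<in>topspace T. f x \<in> V}"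
        using U x by (intro exI[of _ "{x\<in>topspace T. f x \<in> U}"] exI[of _ \<beta>]) auto
    qed auto
  next
    fix W assume W: "openin (plus_topology T) W"
    show "openin (plus_topology S) (f ` W)"
      unfolding opS
    proof (intro conjI ballI)
      show "f ` W \<subseteq> topspace S"
        using openin_subset[OF W] dmapD(1)[OF f] by (auto simp: topspace_plus_topology)
      fix z assume "z \<in> f ` W"
      then obtain x where x: "x \<in> W" "z = f x" by blast
      then obtain U \<beta> where U: "openin T U" "x \<in> U" "\<not> limit_ordinal \<beta>" "\<beta> \<le> s (f x)" "{y\<in>U. \<beta> \<le> s (f y)} \<subseteq> W"
        using bspec[OF conjunct2[OF W[unfolded opT]] x(1)] by auto
      then show "\<exists>U \<beta>. openin S U \<and> z \<in> U \<and> \<not> limit_ordinal \<beta> \<and> \<beta> \<le> s z \<and> {y\<in>U. \<beta> \<le> s y} \<subseteq> f ` W"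
        using x dmapD(3)[OF f U(1)] by (intro exI[of _ "f ` U"] exI[of _ \<beta>]) auto
    qed
  next
    fix x assume "x \<in> topspace T"
    then show "\<exists>U. openin (plus_topology T) U \<and> x \<in> U \<and> (\<forall>y\<in>U. f y = f x \<longrightarrow> y = x)"
      using dmapD(4)[OF f, of x] plus_topology_openin by blast
  qed (use dmapD(1)[OF f] in auto)
qed

text \<open>The description by ranks is local: the same thresholds work in \<open>U\<close> and in
  the whole space. Gluing uses this to continue from one topology of the sequence to the
  next.\<close>

lemma subtopology_plus:
  assumes T: "is_rank T r" and max: "lmax T r" and U: "openin T U" and maxU: "lmax (subtopology T U) r"
  shows "subtopology (plus_topology T) U = plus_topology (subtopology T U)"
  unfolding topology_eq
proof
  fix W
  note opU = openin_plus_iff[OF is_rank_subtopology[OF T U] maxU]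
  have s: "openin (subtopology T U) V \<longleftrightarrow> openin T V \<and> V \<subseteq> U" for V
    using openin_open_subtopology[OF U] by blast
  have tU: "topspace (subtopology T U) = U" using openin_subset[OF U] by auto
  have eq: "openin (subtopology (plus_topology T) U) W \<longleftrightarrow> openin (plus_topology T) W \<and> W \<subseteq> U"
    using openin_open_subtopology[OF plus_topology_openin[OF U]] by blast
  show "openin (subtopology (plus_topology T) U) W \<longleftrightarrow> openin (plus_topology (subtopology T U)) W"
  proof
    assume "openin (subtopology (plus_topology T) U) W"
    then have W: "openin (plus_topology T) W" "W \<subseteq> U" using eq by auto
    show "openin (plus_topology (subtopology T U)) W"
      unfolding opU tU s
    proof (intro conjI ballI)
      fix x assume x: "x \<in> W"
      then obtain V \<beta> where "openin T V" "x \<in> V" "\<not> limit_ordinal \<beta>" "\<beta> \<le> r x" "{y\<in>V. \<beta> \<le> r y} \<subseteq> W"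
        using bspec[OF conjunct2[OF W(1)[unfolded openin_plus_iff[OF T max]]] x] by auto
      then show "\<exists>V \<beta>. (openin T V \<and> V \<subseteq> U) \<and> x \<in> V \<and> \<not> limit_ordinal \<beta> \<and> \<beta> \<le> r x \<and> {y\<in>V. \<beta> \<le> r y} \<subseteq> W"
        using U x W(2) by (intro exI[of _ "V \<inter> U"] exI[of _ \<beta>]) auto
    qed (rule W(2))
  next
    assume W: "openin (plus_topology (subtopology T U)) W"
    have WU: "W \<subseteq> U" using W[unfolded opU tU s] by (rule conjunct1)
    have "openin (plus_topology T) W"
      unfolding openin_plus_iff[OF T max]
    proof (intro conjI ballI)
      show "W \<subseteq> topspace T" using WU openin_subset[OF U] by blast
      fix x assume x: "x \<in> W"
      then obtain V \<beta> where "openin T V" "x \<in> V" "\<not> limit_ordinal \<beta>" "\<beta> \<le> r x" "{y\<in>V. \<beta> \<le> r y} \<subseteq> W"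
        using bspec[OF conjunct2[OF W[unfolded opU tU s]] x] by auto
      then show "\<exists>V \<beta>. openin T V \<and> x \<in> V \<and> \<not> limit_ordinal \<beta> \<and> \<beta> \<le> r x \<and> {y\<in>V. \<beta> \<le> r y} \<subseteq> W"
        by (intro exI[of _ V] exI[of _ \<beta>]) simp
    qed
    then show "openin (subtopology (plus_topology T) U) W" using eq WU by simp
  qed
qed

section \<open>The space of ordinals\<close>

text \<open>The Cantor-Bendixson rank in the order topology, for x > 0 the last exponent in the
  Cantor normal form of x. The recursion avoids normal forms: the rank of x is the least strict
  bound for the ranks on some left neighbourhood of x.\<close>

function orank :: "cord \<Rightarrow> cord" where
  "orank x = (LEAST \<beta>. \<exists>\<alpha>\<le>x. \<not> limit_ordinal \<alpha> \<and> (\<forall>y. \<alpha> \<le> y \<and> y < x \<longrightarrow> orank y < \<beta>))"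
  by auto
termination by (relation "{(x, y). x < y}") (auto intro: wf)

declare orank.simps [simp del]

lemma orank_nbhd:
  obtains \<alpha> where "\<alpha> \<le> x" "\<not> limit_ordinal \<alpha>" "\<And>y. \<alpha> \<le> y \<Longrightarrow> y < x \<Longrightarrow> orank y < orank x"
proof -
  \<comment> \<open>Needed for the \<open>LEAST\<close> to be attained: only countably many ordinals
    precede x, so their ranks are bounded in \<open>cord\<close>, and the left end 0 will
    do.\<close>
  obtain \<beta> where "\<forall>\<gamma>\<in>orank ` {..<x}. \<gamma> < \<beta>"
    using countable_bounded_cord[of "orank ` {..<x}"] countable_lessThan_cord by blast
  then have "\<exists>\<beta>. \<exists>\<alpha>\<le>x. \<not> limit_ordinal \<alpha> \<and> (\<forall>y. \<alpha> \<le> y \<and> y < x \<longrightarrow> orank y < \<beta>)"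
    by (intro exI[of _ \<beta>] exI[of _ 0]) auto
  then have "\<exists>\<alpha>\<le>x. \<not> limit_ordinal \<alpha> \<and> (\<forall>y. \<alpha> \<le> y \<and> y < x \<longrightarrow> orank y < orank x)"
    unfolding orank.simps[of x] by (rule LeastI_ex)
  then show ?thesis using that by auto
qed

lemma orank_lower:
  "\<not> limit_ordinal \<alpha> \<Longrightarrow> \<alpha> \<le> x \<Longrightarrow> \<beta> < orank x \<Longrightarrow> \<exists>y. \<alpha> \<le> y \<and> y < x \<and> orank y = \<beta>"
proof (induction x rule: less_induct)
  case (less x)
  have "\<not> (\<exists>\<alpha>\<le>x. \<not> limit_ordinal \<alpha> \<and> (\<forall>y. \<alpha> \<le> y \<and> y < x \<longrightarrow> orank y < \<beta>))"
    using less.prems(3) unfolding orank.simps[of x] by (rule not_less_Least)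
  then obtain y where y: "\<alpha> \<le> y" "y < x" "\<beta> \<le> orank y" using less.prems by (auto simp: not_less)
  then show ?case
  proof (cases "\<beta> = orank y")
    case False
    then have "\<beta> < orank y" using y(3) by simp
    then obtain z where "\<alpha> \<le> z" "z < y" "orank z = \<beta>" using less.IH[OF y(2) less.prems(1) y(1)] by blast
    then show ?thesis using y(2) by (intro exI[of _ z]) auto
  qed auto
qed

text \<open>The order topology of all countable ordinals. An interval [\<alpha>, \<gamma>] is open
  exactly because \<alpha> is 0 or a successor; these intervals form a base in which [\<alpha>, x]
  are the neighbourhoods of x, matching the non-limit thresholds of
  \<open>openin_plus_iff\<close>.\<close>

definition otop :: "cord topology"
  where "otop = base_top (\<lambda>W. \<exists>\<alpha> \<gamma>. \<not> limit_ordinal \<alpha> \<and> W = {\<alpha>..\<gamma>})"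

lemma openin_otop: "openin otop W \<longleftrightarrow> (\<forall>x\<in>W. \<exists>\<alpha>\<le>x. \<not> limit_ordinal \<alpha> \<and> {\<alpha>..x} \<subseteq> W)"
proof -
  have "openin otop W \<longleftrightarrow> (\<forall>x\<in>W. \<exists>U. (\<exists>\<alpha> \<gamma>. \<not> limit_ordinal \<alpha> \<and> U = {\<alpha>..\<gamma>}) \<and> x \<in> U \<and> U \<subseteq> W)"
    unfolding otop_def
  proof (rule openin_base_top)
    fix U V :: "cord set"
    assume "\<exists>\<alpha> \<gamma>. \<not> limit_ordinal \<alpha> \<and> U = {\<alpha>..\<gamma>}" "\<exists>\<alpha> \<gamma>. \<not> limit_ordinal \<alpha> \<and> V = {\<alpha>..\<gamma>}"
    then obtain \<alpha> \<gamma> \<alpha>' \<gamma>' where *: "\<not> limit_ordinal \<alpha>" "U = {\<alpha>..\<gamma>}" "\<not> limit_ordinal \<alpha>'" "V = {\<alpha>'..\<gamma>'}"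
      by (elim exE conjE)
    then have "U \<inter> V = {max \<alpha> \<alpha>'..min \<gamma> \<gamma>'}" "\<not> limit_ordinal (max \<alpha> \<alpha>')" by (auto simp: max_def)
    then show "\<exists>\<alpha> \<gamma>. \<not> limit_ordinal \<alpha> \<and> U \<inter> V = {\<alpha>..\<gamma>}" by (intro exI conjI)
  qed
  also have "\<dots> \<longleftrightarrow> (\<forall>x\<in>W. \<exists>\<alpha>\<le>x. \<not> limit_ordinal \<alpha> \<and> {\<alpha>..x} \<subseteq> W)"
  proof (rule ball_cong[OF refl])
    fix x assume "x \<in> W"
    show "(\<exists>U. (\<exists>\<alpha> \<gamma>. \<not> limit_ordinal \<alpha> \<and> U = {\<alpha>..\<gamma>}) \<and> x \<in> U \<and> U \<subseteq> W) \<longleftrightarrow>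
      (\<exists>\<alpha>\<le>x. \<not> limit_ordinal \<alpha> \<and> {\<alpha>..x} \<subseteq> W)" (is "?L \<longleftrightarrow> ?R")
    proof
      assume ?L
      then obtain \<alpha> \<gamma> where *: "\<not> limit_ordinal \<alpha>" "x \<in> {\<alpha>..\<gamma>}" "{\<alpha>..\<gamma>} \<subseteq> W" by (elim exE conjE) simp
      have "{\<alpha>..x} \<subseteq> {\<alpha>..\<gamma>}" using * by auto
      then have "{\<alpha>..x} \<subseteq> W" using *(3) by blast
      then show ?R using * by (intro exI[of _ \<alpha>]) simp
    next
      assume ?R
      then obtain \<alpha> where *: "\<alpha> \<le> x" "\<not> limit_ordinal \<alpha>" "{\<alpha>..x} \<subseteq> W" by (elim exE conjE)
      then show ?L by (intro exI[of _ "{\<alpha>..x}"] conjI exI[of _ \<alpha>] exI[of _ x]) auto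
    qed
  qed
  finally show ?thesis .
qed

lemma topspace_otop [simp]: "topspace otop = UNIV"
proof -
  have "openin otop UNIV" unfolding openin_otop by (auto intro!: exI[of _ 0])
  then show ?thesis using openin_subset by blast
qed

lemma openin_otop_interval: "openin otop {\<alpha><..\<gamma>}"
  unfolding openin_otop
proof
  fix x assume "x \<in> {\<alpha><..\<gamma>}"
  then show "\<exists>\<beta>\<le>x. \<not> limit_ordinal \<beta> \<and> {\<beta>..x} \<subseteq> {\<alpha><..\<gamma>}"
    by (intro exI[of _ "osuc \<alpha>"]) (auto simp: osuc_le)
qed

lemma openin_otop_lessThan: "openin otop {..<\<gamma>}"
  unfolding openin_otop
proof
  fix x assume "x \<in> {..<\<gamma>}"
  then show "\<exists>\<beta>\<le>x. \<not> limit_ordinal \<beta> \<and> {\<beta>..x} \<subseteq> {..<\<gamma>}"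
    by (intro exI[of _ 0]) auto
qed

lemma is_rank_otop: "is_rank otop orank"
  unfolding is_rank_def
proof (intro conjI allI impI ballI)
  fix U x \<beta> assume *: "openin otop U \<and> x \<in> U \<and> \<beta> < orank x"
  then obtain \<alpha> where \<alpha>: "\<alpha> \<le> x" "\<not> limit_ordinal \<alpha>" "{\<alpha>..x} \<subseteq> U" unfolding openin_otop by auto
  then obtain y where "\<alpha> \<le> y" "y < x" "orank y = \<beta>" using orank_lower * by blast
  then show "\<exists>y\<in>U. orank y = \<beta>" using \<alpha> by (intro bexI[of _ y]) auto
next
  fix x
  obtain \<alpha> where \<alpha>: "\<alpha> \<le> x" "\<not> limit_ordinal \<alpha>" "\<And>y. \<alpha> \<le> y \<Longrightarrow> y < x \<Longrightarrow> orank y < orank x"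
    using orank_nbhd[of x] by metis
  have "openin otop {\<alpha>..x}" unfolding openin_otop
  proof
    fix y assume "y \<in> {\<alpha>..x}"
    then show "\<exists>\<beta>\<le>y. \<not> limit_ordinal \<beta> \<and> {\<beta>..y} \<subseteq> {\<alpha>..x}" using \<alpha> by (intro exI[of _ \<alpha>]) auto
  qed
  then show "\<exists>U. openin otop U \<and> x \<in> U \<and> (\<forall>y\<in>U. y \<noteq> x \<longrightarrow> orank y < orank x)"
    using \<alpha> by (intro exI[of _ "{\<alpha>..x}"]) auto
qed

text \<open>The tool for lower bounds of ranks. The hypothesis \<open>a < x\<close> excludes that
  the cofinality condition holds vacuously.\<close>

lemma orank_gt_if_cofinal:
  assumes "a < x" "\<And>c. a \<le> c \<Longrightarrow> c < x \<Longrightarrow> \<exists>y. c < y \<and> y < x \<and> \<beta> \<le> orank y"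
  shows "\<beta> < orank x"
proof -
  obtain \<alpha> where \<alpha>: "\<alpha> \<le> x" "\<not> limit_ordinal \<alpha>" "\<And>y. \<alpha> \<le> y \<Longrightarrow> y < x \<Longrightarrow> orank y < orank x"
    using orank_nbhd[of x] by metis
  have "\<alpha> < x"
  proof (rule ccontr)
    assume "\<not> \<alpha> < x"
    then have "\<alpha> = x" using \<alpha>(1) by simp
    then obtain \<gamma> where \<gamma>: "x = osuc \<gamma>" using \<alpha>(2) assms(1) by (cases x rule: cord_cases) auto
    then obtain y where "\<gamma> < y" "y < x" using assms(2)[of \<gamma>] assms(1) less_osuc[of \<gamma>] less_osuc_iff by blast
    then show False using \<gamma> by (simp add: less_osuc_iff)
  qed
  then obtain y where "max a \<alpha> < y" "y < x" "\<beta> \<le> orank y" using assms(2)[of "max a \<alpha>"] assms(1) by auto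
  moreover have "\<alpha> \<le> y" using \<open>max a \<alpha> < y\<close> by (simp add: less_imp_le)
  ultimately show ?thesis using \<alpha>(3)[of y] by (auto intro: le_less_trans)
qed

text \<open>A neighbourhood of x cut at the threshold \<beta> is mapped onto a set containing
  [\<beta>, r x], since an open set takes all smaller ranks. Conversely, in a neighbourhood where x
  has the strictly largest rank, cutting at \<beta> keeps only ranks in [\<beta>, r x].\<close>

lemma dmap_rank:
  assumes T: "is_rank T r" and max: "lmax T r"
  shows "dmap r (plus_topology T) otop"
proof -
  note opT = openin_plus_iff[OF T max]
  show ?thesis
    unfolding dmap_def topspace_plus_topology
  proof (intro conjI allI impI ballI)
    fix V assume V: "openin otop V"
    show "openin (plus_topology T) {x\<in>topspace T. r x \<in> V}"
      unfolding opT
    proof (intro conjI ballI)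
      fix x assume x: "x \<in> {x\<in>topspace T. r x \<in> V}"
      then obtain \<beta> where \<beta>: "\<beta> \<le> r x" "\<not> limit_ordinal \<beta>" "{\<beta>..r x} \<subseteq> V" using V unfolding openin_otop by auto
      have "x \<in> topspace T" using x by simp
      then obtain U where U: "openin T U" "x \<in> U" "\<And>y. y \<in> U \<Longrightarrow> y \<noteq> x \<Longrightarrow> r y < r x"
        using is_rank_nbhd[OF T openin_topspace] by metis
      have "y \<in> {x\<in>topspace T. r x \<in> V}" if "y \<in> U" "\<beta> \<le> r y" for y
        using that U(3)[of y] x \<beta>(3) openin_subset[OF U(1)] by (cases "y = x") (auto simp: subset_eq)
      then show "\<exists>U \<beta>. openin T U \<and> x \<in> U \<and> \<not> limit_ordinal \<beta> \<and> \<beta> \<le> r x \<and>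
          {y\<in>U. \<beta> \<le> r y} \<subseteq> {x\<in>topspace T. r x \<in> V}"
        using U \<beta> by (intro exI[of _ U] exI[of _ \<beta>]) auto
    qed auto
  next
    fix W assume W: "openin (plus_topology T) W"
    show "openin otop (r ` W)"
      unfolding openin_otop
    proof
      fix z assume "z \<in> r ` W"
      then obtain x where x: "x \<in> W" "z = r x" by blast
      then obtain U \<beta> where U: "openin T U" "x \<in> U" "\<not> limit_ordinal \<beta>" "\<beta> \<le> r x" "{y\<in>U. \<beta> \<le> r y} \<subseteq> W"
        using bspec[OF conjunct2[OF W[unfolded opT]] x(1)] by auto
      have "\<gamma> \<in> r ` W" if "\<gamma> \<in> {\<beta>..r x}" for \<gamma>
      proof -
        obtain y where "y \<in> U" "r y = \<gamma>" using is_rank_lower_eq[OF T U(1,2), of \<gamma>] \<open>\<gamma> \<in> {\<beta>..r x}\<close> by auto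
        then show ?thesis using U(5) that by auto
      qed
      then show "\<exists>\<alpha>\<le>z. \<not> limit_ordinal \<alpha> \<and> {\<alpha>..z} \<subseteq> r ` W" using U x by (intro exI[of _ \<beta>]) auto
    qed
  next
    fix x assume "x \<in> topspace T"
    then obtain U where U: "openin T U" "x \<in> U" "\<And>y. y \<in> U \<Longrightarrow> y \<noteq> x \<Longrightarrow> r y < r x"
      using is_rank_nbhd[OF T openin_topspace] by metis
    then show "\<exists>U. openin (plus_topology T) U \<and> x \<in> U \<and> (\<forall>y\<in>U. r y = r x \<longrightarrow> y = x)"
      using plus_topology_openin[OF U(1)] by (intro exI[of _ U]) force
  qed simp
qed

lemma is_rank_plus:
  assumes "is_rank T r" "lmax T r"
  shows "is_rank (plus_topology T) (orank \<circ> r)"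
  using dmap_is_rank[OF dmap_rank[OF assms] is_rank_otop] by (simp add: comp_def)

section \<open>Sequences of limit-maximal extensions\<close>

fun lme_base :: "'a topology \<Rightarrow> (nat \<Rightarrow> 'a topology) \<Rightarrow> nat \<Rightarrow> 'a topology" where
  "lme_base T \<tau> 0 = T"
| "lme_base T \<tau> (Suc n) = plus_topology (\<tau> n)"

text \<open>The counterpart of \<open>lme_space\<close> with all ranks explicit: by
  \<open>is_rank_plus\<close> each passage to \<open>plus_topology\<close> applies
  \<open>orank\<close> once more.\<close>

definition lmes :: "'a topology \<Rightarrow> ('a \<Rightarrow> cord) \<Rightarrow> (nat \<Rightarrow> 'a topology) \<Rightarrow> bool"
  where "lmes T r \<tau> \<longleftrightarrow>
    (\<forall>n. lext (\<tau> n) (lme_base T \<tau> n) ((orank ^^ n) \<circ> r) \<and> lmax (\<tau> n) ((orank ^^ n) \<circ> r))"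

lemma lmesD:
  assumes "lmes T r \<tau>"
  shows "lext (\<tau> 0) T r" "lmax (\<tau> n) ((orank ^^ n) \<circ> r)" "is_rank (\<tau> n) ((orank ^^ n) \<circ> r)"
    "lext (\<tau> (Suc n)) (plus_topology (\<tau> n)) ((orank ^^ Suc n) \<circ> r)"
proof -
  have *: "lext (\<tau> n) (lme_base T \<tau> n) ((orank ^^ n) \<circ> r)" "lmax (\<tau> n) ((orank ^^ n) \<circ> r)" for n
    using assms unfolding lmes_def by auto
  show "lext (\<tau> 0) T r" using *(1)[of 0] by simp
  show "lmax (\<tau> n) ((orank ^^ n) \<circ> r)" by (rule *)
  show "is_rank (\<tau> n) ((orank ^^ n) \<circ> r)" by (rule lextD(1)[OF *(1)])
  show "lext (\<tau> (Suc n)) (plus_topology (\<tau> n)) ((orank ^^ Suc n) \<circ> r)"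
    using *(1)[of "Suc n"] by simp
qed

lemma lmes_topspace:
  assumes "lmes T r \<tau>"
  shows "topspace (\<tau> n) = topspace T"
proof (induction n)
  case 0
  then show ?case using lextD(2)[OF lmesD(1)[OF assms]] .
next
  case (Suc n)
  then show ?case using lextD(2)[OF lmesD(4)[OF assms, of n]] by (simp add: topspace_plus_topology)
qed

lemma lmes_mono:
  assumes "lmes T r \<tau>" "m \<le> n" "openin (\<tau> m) U"
  shows "openin (\<tau> n) U"
  using assms(2,3)
proof (induction rule: dec_induct)
  case (step k)
  then show ?case using lextD(3)[OF lmesD(4)[OF assms(1)]] plus_topology_openin by blast
qed

lemma lmes_base_mono: "lmes T r \<tau> \<Longrightarrow> openin T U \<Longrightarrow> openin (\<tau> n) U"
  using lmes_mono[of T r \<tau> 0 n U] lextD(3)[OF lmesD(1)] by blast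

lemma funpow_Suc_comp: "(orank ^^ Suc n) \<circ> r = (orank ^^ n) \<circ> (orank \<circ> r)"
  by (simp add: funpow_swap1 fun_eq_iff del: funpow.simps) (simp add: funpow_swap1)

text \<open>Splits off the first topology. Thereby the modalities from m+1 on are read in a sequence
  of the same kind, based on \<open>plus_topology (\<tau> 0)\<close>.\<close>

lemma lmes_Suc_iff:
  "lmes T r \<tau> \<longleftrightarrow> lext (\<tau> 0) T r \<and> lmax (\<tau> 0) r \<and> lmes (plus_topology (\<tau> 0)) (orank \<circ> r) (\<lambda>n. \<tau> (Suc n))"
proof -
  have b: "lme_base (plus_topology (\<tau> 0)) (\<lambda>n. \<tau> (Suc n)) n = lme_base T \<tau> (Suc n)" for n
    by (cases n) auto
  have "(\<forall>n. P n) \<longleftrightarrow> P 0 \<and> (\<forall>n. P (Suc n))" for P :: "nat \<Rightarrow> bool" by (metis nat.exhaust)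
  from this[of "\<lambda>n. lext (\<tau> n) (lme_base T \<tau> n) ((orank ^^ n) \<circ> r) \<and> lmax (\<tau> n) ((orank ^^ n) \<circ> r)"]
  show ?thesis
    unfolding lmes_def b funpow_Suc_comp by simp
qed

lemma derived_set_of_open_subtopology:
  assumes U: "openin T U" and x: "x \<in> U"
  shows "x \<in> T derived_set_of A \<longleftrightarrow> x \<in> (subtopology T U) derived_set_of (A \<inter> U)"
proof
  have s: "openin (subtopology T U) V \<longleftrightarrow> openin T V \<and> V \<subseteq> U" for V
    using openin_open_subtopology[OF U] by blast
  {
    assume d: "x \<in> T derived_set_of A"
    have "\<exists>y. y \<noteq> x \<and> y \<in> A \<inter> U \<and> y \<in> V" if "x \<in> V" "openin (subtopology T U) V" for V
      using derived_setD[OF d, of V] that unfolding s by blast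
    then show "x \<in> (subtopology T U) derived_set_of (A \<inter> U)"
      using d x by (simp add: in_derived_set_of)
  next
    assume d: "x \<in> (subtopology T U) derived_set_of (A \<inter> U)"
    have "\<exists>y. y \<noteq> x \<and> y \<in> A \<and> y \<in> V" if "x \<in> V" "openin T V" for V
    proof -
      have "openin (subtopology T U) (V \<inter> U)" "x \<in> V \<inter> U" using that U x unfolding s by auto
      from derived_setD[OF d this] show ?thesis by blast
    qed
    then show "x \<in> T derived_set_of A"
      using x openin_subset[OF U] by (auto simp: in_derived_set_of)
  }
qed

text \<open>Dependent choice, with \<open>ex_lmax_pieces\<close> at every stage. The invariant
  \<open>Q\<close> says that the restriction to each piece is the prescribed one; by
  \<open>subtopology_plus\<close> it provides the right base for the next stage.\<close>

lemma lmes_glue: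
  assumes T: "is_rank T r" and P: "disjoint P" "\<And>U. U \<in> P \<Longrightarrow> openin T U"
    and \<sigma>: "\<And>U. U \<in> P \<Longrightarrow> lmes (subtopology T U) r (\<sigma> U)"
  obtains \<tau> where "lmes T r \<tau>" "\<And>n U. U \<in> P \<Longrightarrow> subtopology (\<tau> n) U = \<sigma> U n"
proof -
  define Q where "Q = (\<lambda>n S. is_rank S ((orank ^^ n) \<circ> r) \<and> lmax S ((orank ^^ n) \<circ> r) \<and>
    (\<forall>U\<in>P. openin S U \<and> subtopology S U = \<sigma> U n) \<and> (n = 0 \<longrightarrow> lext S T r))"
  have "\<exists>\<tau>. \<forall>n. Q n (\<tau> n) \<and> lext (\<tau> (Suc n)) (plus_topology (\<tau> n)) ((orank ^^ Suc n) \<circ> r)"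
  proof (rule dependent_nat_choice)
    obtain M where M: "lext M T r" "lmax M r" "\<And>U. U \<in> P \<Longrightarrow> subtopology M U = \<sigma> U 0"
    proof (rule ex_lmax_pieces[OF T P])
      show "lext (\<sigma> U 0) (subtopology T U) r" "lmax (\<sigma> U 0) r" if "U \<in> P" for U
        using lmesD(1)[OF \<sigma>[OF that]] lmesD(2)[OF \<sigma>[OF that], of 0] by auto
    qed auto
    then show "\<exists>M. Q 0 M" unfolding Q_def using P(2) lextD(1,3)[OF M(1)] by (intro exI[of _ M]) auto
  next
    fix S n assume "Q n S"
    then have S: "is_rank S ((orank ^^ n) \<circ> r)" "lmax S ((orank ^^ n) \<circ> r)"
      "\<And>U. U \<in> P \<Longrightarrow> openin S U" "\<And>U. U \<in> P \<Longrightarrow> subtopology S U = \<sigma> U n"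
      unfolding Q_def by auto
    have sub: "subtopology (plus_topology S) U = plus_topology (\<sigma> U n)" if "U \<in> P" for U
      using subtopology_plus[OF S(1,2) S(3)[OF that]] lmesD(2)[OF \<sigma>[OF that], of n] S(4)[OF that] by simp
    have rk: "is_rank (plus_topology S) ((orank ^^ Suc n) \<circ> r)"
      using is_rank_plus[OF S(1,2)] by (simp add: comp_assoc)
    obtain M where M: "lext M (plus_topology S) ((orank ^^ Suc n) \<circ> r)" "lmax M ((orank ^^ Suc n) \<circ> r)"
      "\<And>U. U \<in> P \<Longrightarrow> subtopology M U = \<sigma> U (Suc n)"
    proof (rule ex_lmax_pieces[OF rk P(1), of "\<lambda>U. \<sigma> U (Suc n)"])
      show "openin (plus_topology S) U" if "U \<in> P" for U using plus_topology_openin[OF S(3)[OF that]] .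
      show "lext (\<sigma> U (Suc n)) (subtopology (plus_topology S) U) ((orank ^^ Suc n) \<circ> r)" if "U \<in> P" for U
        unfolding sub[OF that] by (rule lmesD(4)[OF \<sigma>[OF that]])
      show "lmax (\<sigma> U (Suc n)) ((orank ^^ Suc n) \<circ> r)" if "U \<in> P" for U
        by (rule lmesD(2)[OF \<sigma>[OF that]])
    qed blast
    have "openin M U" if "U \<in> P" for U
      by (rule lextD(3)[OF M(1) plus_topology_openin[OF S(3)[OF that]]])
    then have "Q (Suc n) M" unfolding Q_def using M lextD(1)[OF M(1)] by auto
    then show "\<exists>M. Q (Suc n) M \<and> lext M (plus_topology S) ((orank ^^ Suc n) \<circ> r)" using M(1) by blast
  qed
  then obtain \<tau> where \<tau>: "\<And>n. Q n (\<tau> n)" "\<And>n. lext (\<tau> (Suc n)) (plus_topology (\<tau> n)) ((orank ^^ Suc n) \<circ> r)"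
    by blast
  have "lext (\<tau> n) (lme_base T \<tau> n) ((orank ^^ n) \<circ> r)" for n
    using \<tau>(1)[of 0] \<tau>(2) by (cases n) (auto simp: Q_def)
  then have "lmes T r \<tau>" unfolding lmes_def using \<tau>(1) by (auto simp: Q_def)
  then show ?thesis using that \<tau>(1) by (auto simp: Q_def)
qed

text \<open>\<open>lmax_dmap_lift\<close> produces the next topology, and \<open>dmap_plus\<close>
  keeps the map a d-map between the bases of the stage after it.\<close>

lemma lmes_lift:
  assumes f: "dmap f T S" and S: "is_rank S s" and \<sigma>: "lmes S s \<sigma>"
  obtains \<tau> where "lmes T (s \<circ> f) \<tau>" "\<And>n. dmap f (\<tau> n) (\<sigma> n)"
proof -
  define r where "r = s \<circ> f"
  have r: "(orank ^^ n) \<circ> r = (\<lambda>x. ((orank ^^ n) \<circ> s) (f x))" for n by (auto simp: r_def)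
  define Q where "Q = (\<lambda>n M. lmax M ((orank ^^ n) \<circ> r) \<and> dmap f M (\<sigma> n) \<and> (n = 0 \<longrightarrow> lext M T r))"
  have "\<exists>\<tau>. \<forall>n. Q n (\<tau> n) \<and> lext (\<tau> (Suc n)) (plus_topology (\<tau> n)) ((orank ^^ Suc n) \<circ> r)"
  proof (rule dependent_nat_choice)
    obtain M where "lext M T (\<lambda>x. s (f x))" "lmax M (\<lambda>x. s (f x))" "dmap f M (\<sigma> 0)"
      using lmax_dmap_lift[OF f S lmesD(1)[OF \<sigma>]] lmesD(2)[OF \<sigma>, of 0] by auto
    then show "\<exists>M. Q 0 M" unfolding Q_def by (intro exI[of _ M]) (auto simp: r_def comp_def)
  next
    fix M n assume "Q n M"
    then have M: "lmax M ((orank ^^ n) \<circ> r)" "dmap f M (\<sigma> n)" unfolding Q_def by auto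
    have "dmap f (plus_topology M) (plus_topology (\<sigma> n))"
      by (rule dmap_plus[OF M(2) lmesD(3)[OF \<sigma>] lmesD(2)[OF \<sigma>]]) (use M(1) r in simp)
    moreover have "is_rank (plus_topology (\<sigma> n)) ((orank ^^ Suc n) \<circ> s)"
      using is_rank_plus[OF lmesD(3)[OF \<sigma>] lmesD(2)[OF \<sigma>], of n] by (simp add: comp_assoc)
    ultimately obtain M' where "lext M' (plus_topology M) (\<lambda>x. ((orank ^^ Suc n) \<circ> s) (f x))"
      "lmax M' (\<lambda>x. ((orank ^^ Suc n) \<circ> s) (f x))" "dmap f M' (\<sigma> (Suc n))"
      using lmax_dmap_lift[OF _ _ lmesD(4)[OF \<sigma>] lmesD(2)[OF \<sigma>]] by blast
    then show "\<exists>M'. Q (Suc n) M' \<and> lext M' (plus_topology M) ((orank ^^ Suc n) \<circ> r)"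
      unfolding Q_def r by auto
  qed
  then obtain \<tau> where \<tau>: "\<And>n. Q n (\<tau> n)" "\<And>n. lext (\<tau> (Suc n)) (plus_topology (\<tau> n)) ((orank ^^ Suc n) \<circ> r)"
    by blast
  have "lext (\<tau> n) (lme_base T \<tau> n) ((orank ^^ n) \<circ> r)" for n
    using \<tau>(1)[of 0] \<tau>(2) by (cases n) (auto simp: Q_def)
  then have "lmes T r \<tau>" unfolding lmes_def using \<tau>(1) by (auto simp: Q_def)
  then show ?thesis using that \<tau>(1) by (auto simp: Q_def r_def)
qed

section \<open>Ranks below \<open>\<epsilon>\<^sub>0\<close>\<close>

lemma Sup_cord_upper: "countable A \<Longrightarrow> x \<in> A \<Longrightarrow> x \<le> Sup (A :: cord set)"
  by (intro cSup_upper bdd_above_countable_cord)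

lemma less_Sup_cord:
  assumes "countable A" "A \<noteq> {}" "c < Sup A"
  shows "\<exists>x\<in>A. c < (x::cord)"
  using less_cSup_iff[OF assms(2) bdd_above_countable_cord[OF assms(1)], of c] assms(3) by simp

lemma countable_image_lessThan_cord: "countable (f ` {..<\<alpha>::cord})"
  using countable_lessThan_cord by blast

lemma limit_ordinal_pos: "limit_ordinal \<delta> \<Longrightarrow> 0 < \<delta>"
  using cord_neq_0_iff[of \<delta>] by (auto simp: limit_ordinal_def)

lemma orec_limit_less:
  assumes "limit_ordinal \<delta>" "c < orec z s Sup \<delta>"
  shows "\<exists>\<beta><\<delta>. c < (orec z s Sup \<beta> :: cord)"
proof -
  have "orec z s Sup ` {..<\<delta>} \<noteq> {}" using limit_ordinal_pos[OF assms(1)] by blast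
  from less_Sup_cord[OF countable_image_lessThan_cord this, of c] assms(2)
  show ?thesis unfolding orec_limit[OF assms(1)] by blast
qed

text \<open>Covers addition, multiplication and exponentiation at once. The step function is only
  assumed increasing from \<open>z\<close> on, since multiplication by \<omega> fixes 0 and
  exponentiation starts at 1.\<close>

lemma orec_strict_mono:
  assumes s: "\<And>x::cord. z \<le> x \<Longrightarrow> x < s x"
  shows "\<alpha> < \<beta> \<Longrightarrow> orec z s Sup \<alpha> < orec z s Sup \<beta>" and "z \<le> orec z s Sup \<beta>"
proof -
  let ?f = "orec z s Sup"
  have "(\<forall>\<alpha><\<beta>. ?f \<alpha> < ?f \<beta>) \<and> z \<le> ?f \<beta>"
  proof (induction \<beta> rule: less_induct)
    case (less \<beta>)
    show ?case
    proof (cases \<beta> rule: cord_cases)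
      case zero
      then show ?thesis by (simp add: orec_0)
    next
      case (suc \<gamma>)
      then have IH: "\<forall>\<alpha><\<gamma>. ?f \<alpha> < ?f \<gamma>" "z \<le> ?f \<gamma>" using less[of \<gamma>] less_osuc by auto
      have "?f \<gamma> < ?f \<beta>" unfolding suc orec_suc using s IH(2) by blast
      moreover have "?f \<alpha> \<le> ?f \<gamma>" if "\<alpha> < \<beta>" for \<alpha>
        using that IH(1) unfolding suc less_osuc_iff by (cases "\<alpha> = \<gamma>") (auto intro: less_imp_le)
      ultimately show ?thesis using IH(2) by (auto intro: le_less_trans less_imp_le)
    next
      case limit
      have le: "?f \<alpha> \<le> ?f \<beta>" if "\<alpha> < \<beta>" for \<alpha>
        unfolding orec_limit[OF limit] using that by (intro Sup_cord_upper countable_image_lessThan_cord) auto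
      have "?f \<alpha> < ?f \<beta>" if "\<alpha> < \<beta>" for \<alpha>
      proof -
        have "osuc \<alpha> < \<beta>" using that limit by (rule limit_osuc_less[rotated])
        then have "?f \<alpha> < ?f (osuc \<alpha>)" "?f (osuc \<alpha>) \<le> ?f \<beta>" using less[of "osuc \<alpha>"] less_osuc le by auto
        then show ?thesis by simp
      qed
      moreover have "z \<le> ?f \<beta>" using le[OF limit_ordinal_pos[OF limit]] by (simp add: orec_0)
      ultimately show ?thesis by blast
    qed
  qed
  then show "\<alpha> < \<beta> \<Longrightarrow> ?f \<alpha> < ?f \<beta>" "z \<le> ?f \<beta>" by auto
qed

lemma le_strict_mono_cord:
  assumes "\<And>\<alpha> \<beta>. \<alpha> < \<beta> \<Longrightarrow> f \<alpha> < (f \<beta> :: cord)"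
  shows "(\<alpha>::cord) \<le> f \<alpha>"
proof (induction \<alpha> rule: less_induct)
  case (less \<alpha>)
  show ?case
  proof (rule ccontr)
    assume "\<not> \<alpha> \<le> f \<alpha>"
    then have "f \<alpha> < \<alpha>" by simp
    then show False using less[of "f \<alpha>"] assms[of "f \<alpha>" \<alpha>] by simp
  qed
qed

section \<open>Ordinal arithmetic and the ranks of powers of \<omega>\<close>

lemma oadd_strict_mono: "\<beta> < \<gamma> \<Longrightarrow> oadd \<alpha> \<beta> < oadd \<alpha> \<gamma>"
  unfolding oadd_def by (rule orec_strict_mono) (auto simp: less_osuc)

lemma oadd_0: "oadd \<alpha> 0 = \<alpha>"
  by (simp add: oadd_def orec_0)

lemma less_oadd: "0 < \<beta> \<Longrightarrow> \<alpha> < oadd \<alpha> \<beta>"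
  using oadd_strict_mono[of 0 \<beta> \<alpha>] by (simp add: oadd_0)

lemma omult_strict_mono: "0 < \<alpha> \<Longrightarrow> \<beta> < \<gamma> \<Longrightarrow> omult \<alpha> \<beta> < omult \<alpha> \<gamma>"
  unfolding omult_def by (rule orec_strict_mono) (auto simp: less_oadd)

lemma osuc_0_le_iff: "osuc 0 \<le> \<alpha> \<longleftrightarrow> 0 < \<alpha>"
  by (simp add: osuc_le)

lemma less_omult_omega: "0 < \<gamma> \<Longrightarrow> \<gamma> < omult \<gamma> omega"
proof -
  assume \<gamma>: "0 < \<gamma>"
  have "\<gamma> \<le> oadd 0 \<gamma>" by (rule le_strict_mono_cord) (rule oadd_strict_mono)
  also have "\<dots> = omult \<gamma> (osuc 0)" by (simp add: omult_def orec_suc orec_0)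
  also have "\<dots> < omult \<gamma> omega"
    using limit_osuc_less[OF limit_omega limit_ordinal_pos[OF limit_omega]] by (rule omult_strict_mono[OF \<gamma>])
  finally show ?thesis .
qed

lemma oexp_omega_strict_mono: "\<beta> < \<gamma> \<Longrightarrow> oexp omega \<beta> < oexp omega \<gamma>"
  unfolding oexp_def by (rule orec_strict_mono) (auto simp: osuc_0_le_iff less_omult_omega)

lemma oexp_omega_pos: "0 < oexp omega \<beta>"
proof -
  have "osuc 0 \<le> oexp omega \<beta>"
    unfolding oexp_def by (rule orec_strict_mono) (auto simp: osuc_0_le_iff less_omult_omega)
  then show ?thesis by (simp add: osuc_0_le_iff)
qed

lemma cord_leI: "(\<And>\<beta>. \<beta> < \<gamma> \<Longrightarrow> \<beta> < \<delta>) \<Longrightarrow> \<gamma> \<le> (\<delta>::cord)"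
  by (meson less_irrefl not_le)

text \<open>A point x with ranks below its own is a limit, and translates of points of rank \<beta>
  cofinal in x are cofinal in a + x. The inequality may be strict at x = 0.\<close>

lemma orank_oadd: "orank x \<le> orank (oadd a x)"
proof (induction x rule: less_induct)
  case (less x)
  show ?case
  proof (rule cord_leI)
    fix \<beta> assume \<beta>: "\<beta> < orank x"
    have lim: "limit_ordinal x"
    proof (rule ccontr)
      assume "\<not> limit_ordinal x"
      from orank_lower[OF this order_refl \<beta>] show False by auto
    qed
    show "\<beta> < orank (oadd a x)"
    proof (rule orank_gt_if_cofinal)
      show "a < oadd a x" by (rule less_oadd[OF limit_ordinal_pos[OF lim]])
      fix c assume "c < oadd a x"
      then obtain y where y: "y < x" "c < oadd a y" using orec_limit_less[OF lim] unfolding oadd_def by blast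
      then have "osuc y \<le> x" by (simp add: osuc_le)
      then obtain y' where y': "osuc y \<le> y'" "y' < x" "orank y' = \<beta>"
        using orank_lower[OF not_limit_osuc _ \<beta>] by blast
      then have "oadd a y < oadd a y'" "oadd a y' < oadd a x" by (auto intro!: oadd_strict_mono simp: osuc_le)
      moreover have "\<beta> \<le> orank (oadd a y')" using less[OF y'(2)] y'(3) by simp
      ultimately show "\<exists>y. c < y \<and> y < oadd a x \<and> \<beta> \<le> orank y" using y(2) by (intro exI[of _ "oadd a y'"]) auto
    qed
  qed
qed

lemma le_orank_oexp: "\<gamma> \<le> orank (oexp omega \<gamma>)"
proof (induction \<gamma> rule: less_induct)
  case (less \<gamma>)
  show ?case
  proof (cases \<gamma> rule: cord_cases)
    case zero
    then show ?thesis by simp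
  next
    case (suc \<beta>)
    let ?g = "oexp omega \<beta>"
    have g: "0 < ?g" by (rule oexp_omega_pos)
    have eq: "oexp omega \<gamma> = omult ?g omega" by (simp add: suc oexp_def orec_suc)
    have "\<beta> < orank (omult ?g omega)"
    proof (rule orank_gt_if_cofinal)
      show "0 < omult ?g omega" using less_trans[OF g less_omult_omega[OF g]] .
      fix c assume "c < omult ?g omega"
      then obtain n where n: "n < omega" "c < omult ?g n" using orec_limit_less[OF limit_omega] unfolding omult_def by blast
      have "osuc n < omega" by (rule limit_osuc_less[OF limit_omega n(1)])
      then have "omult ?g (osuc n) < omult ?g omega" "omult ?g n < omult ?g (osuc n)"
        by (auto intro: omult_strict_mono[OF g] less_osuc)
      moreover have "omult ?g (osuc n) = oadd (omult ?g n) ?g" by (simp add: omult_def orec_suc)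
      moreover have "\<beta> \<le> orank (oadd (omult ?g n) ?g)"
        using order_trans[OF less[of \<beta>] orank_oadd] less_osuc suc by blast
      ultimately show "\<exists>y. c < y \<and> y < omult ?g omega \<and> \<beta> \<le> orank y"
        using n(2) by (intro exI[of _ "omult ?g (osuc n)"]) auto
    qed
    then show ?thesis using suc eq by (simp add: osuc_le)
  next
    case limit
    show ?thesis
    proof (rule cord_leI)
      fix \<beta> assume \<beta>: "\<beta> < \<gamma>"
      show "\<beta> < orank (oexp omega \<gamma>)"
      proof (rule orank_gt_if_cofinal)
        show "0 < oexp omega \<gamma>" by (rule oexp_omega_pos)
        fix c assume "c < oexp omega \<gamma>"
        then obtain \<beta>' where \<beta>': "\<beta>' < \<gamma>" "c < oexp omega \<beta>'" using orec_limit_less[OF limit] unfolding oexp_def by blast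
        let ?b = "max \<beta> \<beta>'"
        have b: "?b < \<gamma>" using \<beta> \<beta>' by simp
        have "oexp omega \<beta>' \<le> oexp omega ?b"
          using oexp_omega_strict_mono[of \<beta>' ?b] by (cases "\<beta>' < ?b") (auto simp: max_def)
        moreover have "oexp omega ?b < oexp omega \<gamma>" by (rule oexp_omega_strict_mono[OF b])
        moreover have "\<beta> \<le> orank (oexp omega ?b)" using less[OF b] by simp
        ultimately show "\<exists>y. c < y \<and> y < oexp omega \<gamma> \<and> \<beta> \<le> orank y"
          using \<beta>'(2) by (intro exI[of _ "oexp omega ?b"]) auto
      qed
    qed
  qed
qed

lemma omega_tower_mono: "m \<le> n \<Longrightarrow> omega_tower m \<le> omega_tower n"
proof (induction rule: dec_induct)
  case (step n)
  have "omega_tower n \<le> oexp omega (omega_tower n)"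
    by (rule le_strict_mono_cord) (rule oexp_omega_strict_mono)
  then show ?case using step by simp
qed simp

lemma less_epsilon0_tower: "\<alpha> < epsilon0 \<Longrightarrow> \<exists>k. \<alpha> < omega_tower k"
  using less_Sup_cord[of "range omega_tower" \<alpha>] unfolding epsilon0_def by auto

text \<open>The only property of \<epsilon>0 that the construction of models uses: past every point
  below \<epsilon>0 all ranks below \<epsilon>0 still occur. A level of the tower above a and
  \<beta> is the exponent of the next level, whose rank therefore exceeds \<beta>.\<close>

lemma ex_orank_below_epsilon0:
  assumes "a < epsilon0" "\<beta> < epsilon0"
  obtains x where "a < x" "x < epsilon0" "orank x = \<beta>"
proof -
  obtain k l where "a < omega_tower k" "\<beta> < omega_tower l" using assms less_epsilon0_tower by blast
  then obtain n where n: "a < omega_tower n" "\<beta> < omega_tower n"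
    using omega_tower_mono[of k "max k l"] omega_tower_mono[of l "max k l"] by (meson less_le_trans max.cobounded1 max.cobounded2)
  let ?x = "omega_tower (Suc n)"
  have "\<beta> < orank ?x" using n(2) le_orank_oexp[of "omega_tower n"] by simp
  moreover have "osuc a \<le> ?x" using n(1) omega_tower_mono[of n "Suc n"] by (simp add: osuc_le)
  ultimately obtain y where "osuc a \<le> y" "y < ?x" "orank y = \<beta>" using orank_lower[OF not_limit_osuc] by blast
  then show ?thesis using that[of y] omega_tower_le_epsilon0[of "Suc n"] by (simp add: osuc_le)
qed

lemma epsilon0_pos: "0 < epsilon0"
  using omega_tower_le_epsilon0[of 0] by (simp add: osuc_le)

lemma order_topology_on_epsilon0:
  "order_topology_on {..<epsilon0} = subtopology otop {..<epsilon0}"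
proof -
  let ?X = "{..<epsilon0}"
  let ?G = "{?X} \<union> {{x \<in> ?X. x < a} | a. a \<in> ?X} \<union> {{x \<in> ?X. a < x} | a. a \<in> ?X}"
  have sub: "openin (subtopology otop ?X) W \<longleftrightarrow> openin otop W \<and> W \<subseteq> ?X" for W
    using openin_open_subtopology[OF openin_otop_lessThan] by blast
  have "openin otop W" if W: "openin (topology_generated_by ?G) W" for W
    using W[unfolded openin_topology_generated_by_iff]
  proof (induction rule: generate_topology_on.induct)
    case (Basis s)
    then consider "s = ?X" | a where "a \<in> ?X" "s = {x\<in>?X. x < a}" | a where "a \<in> ?X" "s = {x\<in>?X. a < x}" by blast
    then show ?case
    proof cases
      case (2 a)
      then have "s = {..<a}" by auto
      then show ?thesis by (simp add: openin_otop_lessThan)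
    next
      case (3 a)
      show ?thesis
        unfolding openin_otop
      proof
        fix x assume "x \<in> s"
        then show "\<exists>\<beta>\<le>x. \<not> limit_ordinal \<beta> \<and> {\<beta>..x} \<subseteq> s"
          using 3 by (intro exI[of _ "osuc a"]) (auto simp: osuc_le)
      qed
    qed (simp add: openin_otop_lessThan)
  qed auto
  moreover have "W \<subseteq> ?X" if "openin (topology_generated_by ?G) W" for W
    using openin_subset[OF that] by (auto simp: topology_generated_by_topspace)
  moreover have "openin (topology_generated_by ?G) W" if W: "openin otop W" "W \<subseteq> ?X" for W
  proof (subst openin_subopen, intro ballI)
    fix x assume x: "x \<in> W"
    then obtain \<beta> where \<beta>: "\<beta> \<le> x" "\<not> limit_ordinal \<beta>" "{\<beta>..x} \<subseteq> W" using W(1) unfolding openin_otop by blast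
    have "x < epsilon0" using x W by auto
    then obtain y where y: "x < y" "y < epsilon0" using ex_orank_below_epsilon0[of x 0] epsilon0_pos by blast
    then have s: "osuc x < epsilon0" using osuc_le[of x y] by auto
    have 1: "openin (topology_generated_by ?G) {z\<in>?X. z < osuc x}"
      by (rule topology_generated_by_Basis) (use s in blast)
    have "openin (topology_generated_by ?G) {z\<in>?X. \<beta> \<le> z}"
    proof (cases \<beta> rule: cord_cases)
      case zero
      have "openin (topology_generated_by ?G) ?X" by (rule topology_generated_by_Basis) blast
      then show ?thesis using zero by (simp add: lessThan_def)
    next
      case (suc \<gamma>)
      have "openin (topology_generated_by ?G) {z\<in>?X. \<gamma> < z}"
      proof (rule topology_generated_by_Basis)
        have "\<gamma> < epsilon0" using suc \<beta>(1) \<open>x < epsilon0\<close> by (auto simp: osuc_le)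
        then show "{z\<in>?X. \<gamma> < z} \<in> ?G" by blast
      qed
      then show ?thesis by (simp add: suc osuc_le)
    qed (use \<beta> in simp)
    with 1 have "openin (topology_generated_by ?G) ({z\<in>?X. z < osuc x} \<inter> {z\<in>?X. \<beta> \<le> z})" by (rule openin_Int)
    moreover have "x \<in> {z\<in>?X. z < osuc x} \<inter> {z\<in>?X. \<beta> \<le> z}" using \<beta> \<open>x < epsilon0\<close> by (auto simp: less_osuc)
    moreover have "{z\<in>?X. z < osuc x} \<inter> {z\<in>?X. \<beta> \<le> z} \<subseteq> W" using \<beta>(3) by (auto simp: less_osuc_iff)
    ultimately show "\<exists>V. openin (topology_generated_by ?G) V \<and> x \<in> V \<and> V \<subseteq> W" by blast
  qed
  ultimately show ?thesis unfolding topology_eq order_topology_on_def sub by blast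
qed

section \<open>Maximal consistent sets\<close>

text \<open>Closure under modus ponens but not under necessitation. Thus maximal consistent sets,
  the sets {\<theta>. [n]\<theta> \<in> \<Gamma>} and the sets {\<theta>. (\<psi> \<rightarrow>
  \<theta>) \<in> F} are all of this kind, and derivability from hypotheses need not be
  formalized.\<close>

definition glp_theory :: "fm set \<Rightarrow> bool"
  where "glp_theory F \<longleftrightarrow> (\<forall>\<phi>. GLP \<phi> \<longrightarrow> \<phi> \<in> F) \<and> (\<forall>\<phi> \<psi>. FImp \<phi> \<psi> \<in> F \<longrightarrow> \<phi> \<in> F \<longrightarrow> \<psi> \<in> F)"

definition mcs :: "fm set \<Rightarrow> bool"
  where "mcs \<Gamma> \<longleftrightarrow> glp_theory \<Gamma> \<and> FBot \<notin> \<Gamma> \<and> (\<forall>\<phi>. \<phi> \<in> \<Gamma> \<or> FNeg \<phi> \<in> \<Gamma>)"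

lemma glp_theory_GLP: "glp_theory F \<Longrightarrow> GLP \<phi> \<Longrightarrow> \<phi> \<in> F"
  unfolding glp_theory_def by blast

lemma glp_theory_mp: "glp_theory F \<Longrightarrow> FImp \<phi> \<psi> \<in> F \<Longrightarrow> \<phi> \<in> F \<Longrightarrow> \<psi> \<in> F"
  unfolding glp_theory_def by blast

lemma glp_theory_taut: "glp_theory F \<Longrightarrow> tautology \<phi> \<Longrightarrow> \<phi> \<in> F"
  using glp_theory_GLP GLP.taut by blast

lemma glp_theory_taut1: "glp_theory F \<Longrightarrow> tautology (FImp \<phi> \<psi>) \<Longrightarrow> \<phi> \<in> F \<Longrightarrow> \<psi> \<in> F"
  using glp_theory_mp glp_theory_taut by metis

lemma glp_theory_taut2:
  "glp_theory F \<Longrightarrow> tautology (FImp \<phi> (FImp \<psi> \<theta>)) \<Longrightarrow> \<phi> \<in> F \<Longrightarrow> \<psi> \<in> F \<Longrightarrow> \<theta> \<in> F"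
  using glp_theory_mp glp_theory_taut1 by metis

lemma glp_theory_deduction:
  assumes F: "glp_theory F"
  shows "glp_theory {\<theta>. FImp \<psi> \<theta> \<in> F}"
  unfolding glp_theory_def
proof (intro conjI allI impI; unfold mem_Collect_eq)
  fix \<phi> assume "GLP \<phi>"
  then have "\<phi> \<in> F" by (rule glp_theory_GLP[OF F])
  then show "FImp \<psi> \<phi> \<in> F" by (rule glp_theory_taut1[OF F, rotated]) (simp add: tautology_def FImp_def)
next
  fix \<phi> \<theta> assume "FImp \<psi> (FImp \<phi> \<theta>) \<in> F" "FImp \<psi> \<phi> \<in> F"
  then show "FImp \<psi> \<theta> \<in> F" by (rule glp_theory_taut2[OF F, rotated]) (auto simp: tautology_def FImp_def)
qed

text \<open>A theory maximal among those omitting \<phi> is complete: if it omits \<psi>, it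
  contains \<psi> \<rightarrow> \<phi>, for otherwise adjoining \<psi> would give a larger theory
  omitting \<phi>. If it omitted both \<psi> and its negation, it would contain \<phi>.\<close>

lemma ex_mcs:
  assumes F: "glp_theory F" "\<phi> \<notin> F"
  obtains \<Gamma> where "mcs \<Gamma>" "F \<subseteq> \<Gamma>" "\<phi> \<notin> \<Gamma>"
proof -
  let ?A = "{G. glp_theory G \<and> F \<subseteq> G \<and> \<phi> \<notin> G}"
  have "\<exists>M\<in>?A. \<forall>X\<in>?A. M \<subseteq> X \<longrightarrow> X = M"
  proof (rule subset_Zorn_nonempty)
    fix C assume C: "C \<noteq> {}" "subset.chain ?A C"
    have CA: "glp_theory G" "F \<subseteq> G" "\<phi> \<notin> G" if "G \<in> C" for G
      using C(2) that unfolding subset.chain_def by auto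
    have "glp_theory (\<Union>C)"
      unfolding glp_theory_def
    proof (intro conjI allI impI)
      fix \<psi> assume "GLP \<psi>"
      then show "\<psi> \<in> \<Union>C" using C(1) glp_theory_GLP CA(1) by blast
    next
      fix \<psi> \<theta> assume "FImp \<psi> \<theta> \<in> \<Union>C" "\<psi> \<in> \<Union>C"
      then obtain G H where GH: "G \<in> C" "FImp \<psi> \<theta> \<in> G" "H \<in> C" "\<psi> \<in> H" by blast
      then have "G \<subseteq> H \<or> H \<subseteq> G" using C(2) unfolding subset_chain_def by blast
      then obtain K where "K \<in> C" "FImp \<psi> \<theta> \<in> K" "\<psi> \<in> K" using GH by blast
      then show "\<theta> \<in> \<Union>C" using glp_theory_mp[OF CA(1)] by blast
    qed
    then show "\<Union>C \<in> ?A" using C(1) CA by blast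
  qed (use F in blast)
  then obtain M where M0: "M \<in> ?A" and max0: "\<forall>X\<in>?A. M \<subseteq> X \<longrightarrow> X = M" by (elim bexE)
  have M: "glp_theory M" "F \<subseteq> M" "\<phi> \<notin> M" using M0 by auto
  have max: "X = M" if "glp_theory X" "\<phi> \<notin> X" "M \<subseteq> X" for X
    using bspec[OF max0, of X] that M(2) by auto
  have ded: "FImp \<psi> \<phi> \<in> M" if \<psi>: "\<psi> \<notin> M" for \<psi>
  proof (rule ccontr)
    assume n: "FImp \<psi> \<phi> \<notin> M"
    let ?X = "{\<theta>. FImp \<psi> \<theta> \<in> M}"
    have sub: "M \<subseteq> ?X"
    proof
      fix \<theta> assume "\<theta> \<in> M"
      then have "FImp \<psi> \<theta> \<in> M" by (rule glp_theory_taut1[OF M(1), rotated]) (simp add: tautology_def FImp_def)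
      then show "\<theta> \<in> ?X" by simp
    qed
    have "?X = M" by (rule max) (use glp_theory_deduction[OF M(1)] M(2) sub n in auto)
    moreover have "FImp \<psi> \<psi> \<in> M" by (rule glp_theory_taut[OF M(1)]) (simp add: tautology_def FImp_def)
    ultimately show False using \<psi> by blast
  qed
  have "mcs M"
    unfolding mcs_def
  proof (intro conjI allI)
    show "FBot \<notin> M"
    proof
      assume "FBot \<in> M"
      then have "\<phi> \<in> M" by (rule glp_theory_taut1[OF M(1), rotated]) (simp add: tautology_def FImp_def)
      then show False using M(3) by blast
    qed
    fix \<psi> show "\<psi> \<in> M \<or> FNeg \<psi> \<in> M"
    proof (rule ccontr)
      assume "\<not> (\<psi> \<in> M \<or> FNeg \<psi> \<in> M)"
      then have "FImp \<psi> \<phi> \<in> M" "FImp (FNeg \<psi>) \<phi> \<in> M" using ded by auto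
      then have "\<phi> \<in> M" by (rule glp_theory_taut2[OF M(1), rotated]) (auto simp: tautology_def FImp_def)
      then show False using M(3) by blast
    qed
  qed (rule M)
  then show ?thesis using that M by blast
qed

lemma mcs_theory: "mcs \<Gamma> \<Longrightarrow> glp_theory \<Gamma>"
  by (simp add: mcs_def)

lemma mcs_FNeg:
  assumes "mcs \<Gamma>"
  shows "FNeg \<phi> \<in> \<Gamma> \<longleftrightarrow> \<phi> \<notin> \<Gamma>"
proof
  assume n: "FNeg \<phi> \<in> \<Gamma>"
  show "\<phi> \<notin> \<Gamma>"
  proof
    assume "\<phi> \<in> \<Gamma>"
    from n this have "FBot \<in> \<Gamma>" by (rule glp_theory_taut2[OF mcs_theory[OF assms], rotated]) (simp add: tautology_def FImp_def)
    then show False using assms by (simp add: mcs_def)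
  qed
qed (use assms in \<open>auto simp: mcs_def\<close>)

lemma mcs_FOr:
  assumes "mcs \<Gamma>"
  shows "FOr \<phi> \<psi> \<in> \<Gamma> \<longleftrightarrow> \<phi> \<in> \<Gamma> \<or> \<psi> \<in> \<Gamma>"
proof
  note taut2 = glp_theory_taut2[OF mcs_theory[OF assms], rotated]
  note taut1 = glp_theory_taut1[OF mcs_theory[OF assms], rotated]
  {
    assume "FOr \<phi> \<psi> \<in> \<Gamma>"
    then have "\<psi> \<in> \<Gamma>" if "FNeg \<phi> \<in> \<Gamma>"
      using that by (rule taut2) (auto simp: tautology_def FImp_def)
    then show "\<phi> \<in> \<Gamma> \<or> \<psi> \<in> \<Gamma>" using mcs_FNeg[OF assms] by blast
  next
    assume "\<phi> \<in> \<Gamma> \<or> \<psi> \<in> \<Gamma>"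
    then show "FOr \<phi> \<psi> \<in> \<Gamma>"
    proof
      assume "\<phi> \<in> \<Gamma>"
      then show ?thesis by (rule taut1) (auto simp: tautology_def FImp_def)
    next
      assume "\<psi> \<in> \<Gamma>"
      then show ?thesis by (rule taut1) (auto simp: tautology_def FImp_def)
    qed
  }
qed

lemma glp_theory_box:
  assumes \<Gamma>: "glp_theory \<Gamma>"
  shows "glp_theory {\<theta>. FBox n \<theta> \<in> \<Gamma>}"
  unfolding glp_theory_def
proof (intro conjI allI impI; unfold mem_Collect_eq)
  fix \<phi> assume "GLP \<phi>"
  then show "FBox n \<phi> \<in> \<Gamma>" by (intro glp_theory_GLP[OF \<Gamma>] GLP.nec)
next
  fix \<phi> \<psi> assume "FBox n (FImp \<phi> \<psi>) \<in> \<Gamma>" "FBox n \<phi> \<in> \<Gamma>"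
  then show "FBox n \<psi> \<in> \<Gamma>" using glp_theory_mp[OF \<Gamma>] glp_theory_GLP[OF \<Gamma> GLP.distr] by blast
qed

lemma glp_theory_loeb:
  assumes \<Gamma>: "glp_theory \<Gamma>" "FBox n (FImp (FBox n \<phi>) \<phi>) \<in> \<Gamma>"
  shows "FBox n \<phi> \<in> \<Gamma>"
  using glp_theory_mp[OF \<Gamma>(1) glp_theory_GLP[OF \<Gamma>(1) GLP.loeb] \<Gamma>(2)] .

lemma GLP_box_mono:
  assumes "GLP (FImp \<phi> \<psi>)"
  shows "GLP (FImp (FBox n \<phi>) (FBox n \<psi>))"
  by (rule GLP.mp[OF GLP.distr GLP.nec[OF assms]])

text \<open>Transitivity is no axiom of the calculus; it follows from Loeb's axiom for the
  conjunction \<theta> of \<phi> and [n]\<phi>.\<close>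

lemma glp_theory_box_trans:
  assumes \<Gamma>: "glp_theory \<Gamma>" and \<phi>: "FBox n \<phi> \<in> \<Gamma>"
  shows "FBox n (FBox n \<phi>) \<in> \<Gamma>"
proof -
  define F where "F = {\<theta>. FBox n \<theta> \<in> \<Gamma>}"
  have F: "glp_theory F" unfolding F_def by (rule glp_theory_box[OF \<Gamma>])
  define \<theta> where "\<theta> = FNeg (FOr (FNeg \<phi>) (FNeg (FBox n \<phi>)))"
  have 1: "GLP (FImp \<theta> \<phi>)" "GLP (FImp \<theta> (FBox n \<phi>))"
    by (rule GLP.taut; simp add: tautology_def FImp_def \<theta>_def)+
  have "FImp (FBox n \<theta>) (FBox n \<phi>) \<in> F" by (rule glp_theory_GLP[OF F GLP_box_mono[OF 1(1)]])
  moreover have "\<phi> \<in> F" using \<phi> by (simp add: F_def)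
  ultimately have "FImp (FBox n \<theta>) \<theta> \<in> F"
    by (rule glp_theory_taut2[OF F, rotated]) (auto simp: tautology_def FImp_def \<theta>_def)
  then have "FBox n (FImp (FBox n \<theta>) \<theta>) \<in> \<Gamma>" by (simp add: F_def)
  then have "FBox n \<theta> \<in> \<Gamma>" by (rule glp_theory_loeb[OF \<Gamma>])
  then show ?thesis using glp_theory_mp[OF \<Gamma> glp_theory_GLP[OF \<Gamma> GLP_box_mono[OF 1(2)]]] by blast
qed

text \<open>Loeb's axiom says precisely that \<psi> is missing from the theory \<open>F'\<close> of
  those \<theta> with [n]([n]\<psi> \<rightarrow> \<theta>) in \<Gamma>. Any maximal consistent
  extension of \<open>F'\<close> omitting \<psi> contains [n]\<psi> in addition to all boxes
  [n]\<theta> of \<Gamma>.\<close>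

lemma mcs_witness:
  assumes \<Gamma>: "mcs \<Gamma>" and \<psi>: "FBox n \<psi> \<notin> \<Gamma>"
  obtains \<Delta> where "mcs \<Delta>" "\<psi> \<notin> \<Delta>" "FBox n \<psi> \<in> \<Delta>" "\<And>\<theta>. FBox n \<theta> \<in> \<Gamma> \<Longrightarrow> \<theta> \<in> \<Delta> \<and> FBox n \<theta> \<in> \<Delta>"
proof -
  note th = mcs_theory[OF \<Gamma>]
  define F where "F = {\<theta>. FBox n \<theta> \<in> \<Gamma>}"
  have F: "glp_theory F" unfolding F_def by (rule glp_theory_box[OF th])
  define F' where "F' = {\<theta>. FImp (FBox n \<psi>) \<theta> \<in> F}"
  have F': "glp_theory F'" unfolding F'_def by (rule glp_theory_deduction[OF F])
  have "\<psi> \<notin> F'"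
  proof
    assume "\<psi> \<in> F'"
    then have "FBox n (FImp (FBox n \<psi>) \<psi>) \<in> \<Gamma>" by (simp add: F'_def F_def)
    from glp_theory_loeb[OF th this] show False using \<psi> by blast
  qed
  then obtain \<Delta> where \<Delta>: "mcs \<Delta>" "F' \<subseteq> \<Delta>" "\<psi> \<notin> \<Delta>" using ex_mcs[OF F'] by blast
  have "FImp (FBox n \<psi>) (FBox n \<psi>) \<in> F" by (rule glp_theory_taut[OF F]) (simp add: tautology_def FImp_def)
  then have 1: "FBox n \<psi> \<in> F'" by (simp add: F'_def)
  have 2: "\<theta> \<in> F'" if "\<theta> \<in> F" for \<theta>
    using glp_theory_taut1[OF F _ that, of "FImp (FBox n \<psi>) \<theta>"] by (simp add: F'_def tautology_def FImp_def)
  have "\<theta> \<in> \<Delta> \<and> FBox n \<theta> \<in> \<Delta>" if "FBox n \<theta> \<in> \<Gamma>" for \<theta>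
    using 2[of \<theta>] 2[of "FBox n \<theta>"] glp_theory_box_trans[OF th that] that \<Delta>(2) by (auto simp: F_def)
  then show ?thesis using that \<Delta> 1 by blast
qed

lemma mcs_box_mono:
  assumes \<Gamma>: "mcs \<Gamma>" and "m \<le> n" "FBox m \<theta> \<in> \<Gamma>"
  shows "FBox n \<theta> \<in> \<Gamma>"
proof (cases "m = n")
  case False
  then have "GLP (FImp (FBox m \<theta>) (FBox n \<theta>))" using assms by (intro GLP.mono_box) simp
  then show ?thesis using assms glp_theory_mp glp_theory_GLP mcs_theory by blast
qed (use assms in simp)

text \<open>Along a step for [m+1] boxes [m]\<theta> persist by monotonicity and transitivity, and
  refuted ones persist by axiom (v). So \<Gamma> and \<Delta> contain the same formulas of the form
  [m]\<theta>.\<close>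

lemma mcs_Suc_step:
  assumes \<Gamma>: "mcs \<Gamma>" and \<Delta>: "mcs \<Delta>" and step: "\<And>\<theta>. FBox (Suc m) \<theta> \<in> \<Gamma> \<Longrightarrow> \<theta> \<in> \<Delta>"
  shows "FBox m \<theta> \<in> \<Delta> \<longleftrightarrow> FBox m \<theta> \<in> \<Gamma>" and "FBox m \<theta> \<in> \<Gamma> \<Longrightarrow> \<theta> \<in> \<Delta>"
proof -
  note th = mcs_theory[OF \<Gamma>]
  show "\<theta> \<in> \<Delta>" if "FBox m \<theta> \<in> \<Gamma>"
    by (rule step) (rule mcs_box_mono[OF \<Gamma> _ that], simp)
  show "FBox m \<theta> \<in> \<Delta> \<longleftrightarrow> FBox m \<theta> \<in> \<Gamma>"
  proof
    assume "FBox m \<theta> \<in> \<Gamma>"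
    then show "FBox m \<theta> \<in> \<Delta>"
      by (intro step mcs_box_mono[OF \<Gamma> _ glp_theory_box_trans[OF th]]) simp
  next
    assume d: "FBox m \<theta> \<in> \<Delta>"
    show "FBox m \<theta> \<in> \<Gamma>"
    proof (rule ccontr)
      assume n: "FBox m \<theta> \<notin> \<Gamma>"
      \<comment> \<open>The diamond of a negation unfolds to a box with a double negation inside,
        which has to be moved through the box.\<close>
      have "GLP (FImp (FNeg (FNeg \<theta>)) \<theta>)" "GLP (FImp \<theta> (FNeg (FNeg \<theta>)))"
        by (rule GLP.taut; simp add: tautology_def FImp_def)+
      note nn = this[THEN GLP_box_mono, of m]
      have "FBox m (FNeg (FNeg \<theta>)) \<notin> \<Gamma>" using n glp_theory_mp[OF th glp_theory_GLP[OF th nn(1)]] by blast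
      then have "FDia m (FNeg \<theta>) \<in> \<Gamma>" by (simp add: FDia_def mcs_FNeg[OF \<Gamma>])
      then have "FBox (Suc m) (FDia m (FNeg \<theta>)) \<in> \<Gamma>"
        using glp_theory_mp[OF th glp_theory_GLP[OF th GLP.dia_box[of m "Suc m"]]] by blast
      then have "FDia m (FNeg \<theta>) \<in> \<Delta>" by (rule step)
      then have "FBox m (FNeg (FNeg \<theta>)) \<notin> \<Delta>" by (simp add: FDia_def mcs_FNeg[OF \<Delta>])
      then show False using d glp_theory_mp[OF mcs_theory[OF \<Delta>] glp_theory_GLP[OF mcs_theory[OF \<Delta>] nn(2)]] by blast
    qed
  qed
qed

section \<open>Cutting intervals of ordinals into pieces\<close>

definition top_interval :: "cord \<Rightarrow> cord \<Rightarrow> cord \<Rightarrow> bool"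
  where "top_interval a b \<delta> \<longleftrightarrow> a < b \<and> orank b = \<delta> \<and> (\<forall>x. a < x \<and> x < b \<longrightarrow> orank x < \<delta>)"

definition next_rank :: "cord \<Rightarrow> cord \<Rightarrow> cord"
  where "next_rank \<delta> p = (LEAST x. p < x \<and> \<delta> \<le> orank x)"

text \<open>The point \<open>q\<close> shows that the minimum exists. Its rank cannot exceed
  \<delta>, since a point of rank exactly \<delta> would then come earlier.\<close>

lemma next_rank:
  assumes "p < q" "\<delta> \<le> orank q"
  shows "top_interval p (next_rank \<delta> p) \<delta>" "next_rank \<delta> p \<le> q"
proof -
  let ?b = "next_rank \<delta> p"
  have b: "p < ?b \<and> \<delta> \<le> orank ?b"
    unfolding next_rank_def by (rule LeastI[of _ q]) (use assms in blast)
  have less: "orank x < \<delta>" if "p < x" "x < ?b" for x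
    using not_less_Least[of x "\<lambda>x. p < x \<and> \<delta> \<le> orank x"] that unfolding next_rank_def by (auto simp: not_le)
  have "orank ?b = \<delta>"
  proof (rule ccontr)
    assume "orank ?b \<noteq> \<delta>"
    then have "\<delta> < orank ?b" using b by auto
    moreover have "osuc p \<le> ?b" using b by (simp add: osuc_le)
    ultimately obtain y where "osuc p \<le> y" "y < ?b" "orank y = \<delta>" using orank_lower[OF not_limit_osuc] by blast
    then show False using less[of y] by (simp add: osuc_le)
  qed
  then show "top_interval p ?b \<delta>" using b less by (simp add: top_interval_def)
  show "?b \<le> q" unfolding next_rank_def by (rule Least_le) (use assms in blast)
qed

primrec cuts :: "(nat \<Rightarrow> cord) \<Rightarrow> cord \<Rightarrow> nat \<Rightarrow> cord" where
  "cuts \<delta> p 0 = p"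
| "cuts \<delta> p (Suc n) = next_rank (\<delta> n) (cuts \<delta> p n)"

context
  fixes \<delta> :: "nat \<Rightarrow> cord" and \<mu> p q :: cord
  assumes \<delta>: "\<And>n. \<delta> n \<le> \<mu>" and inf: "\<And>N. \<exists>n\<ge>N. \<delta> n = \<mu>"
    and pq: "top_interval p q (osuc \<mu>)"
begin

lemma cuts_less: "cuts \<delta> p n < q"
  and cuts_top_interval: "top_interval (cuts \<delta> p n) (cuts \<delta> p (Suc n)) (\<delta> n)"
proof -
  have step: "top_interval x (next_rank (\<delta> n) x) (\<delta> n) \<and> next_rank (\<delta> n) x < q" if "x < q" for x n
  proof -
    have q: "\<delta> n < orank q" using \<delta>[of n] pq by (simp add: top_interval_def less_osuc_iff)
    have "osuc x \<le> q" using that by (simp add: osuc_le)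
    then obtain y where y: "osuc x \<le> y" "y < q" "orank y = \<delta> n" using orank_lower[OF not_limit_osuc _ q] by blast
    then have "x < y" "\<delta> n \<le> orank y" by (auto simp: osuc_le)
    then show ?thesis using next_rank[of x y "\<delta> n"] y(2) by auto
  qed
  have *: "cuts \<delta> p n < q" for n
    by (induction n) (use pq step in \<open>auto simp: top_interval_def\<close>)
  then show "cuts \<delta> p n < q" .
  show "top_interval (cuts \<delta> p n) (cuts \<delta> p (Suc n)) (\<delta> n)" using step[OF *] by simp
qed

lemma cuts_Suc: "cuts \<delta> p n < cuts \<delta> p (Suc n)"
  using cuts_top_interval by (simp add: top_interval_def)

lemma cuts_mono: "m \<le> n \<Longrightarrow> cuts \<delta> p m \<le> cuts \<delta> p n"
  by (rule lift_Suc_mono_le[of "cuts \<delta> p"]) (use cuts_Suc in \<open>auto simp: less_imp_le simp del: cuts.simps\<close>)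

text \<open>The value \<mu> recurs, so points of rank \<mu> are cofinal below the supremum of the
  cuts, which has rank above \<mu> for this reason. No point strictly between \<open>p\<close> and
  \<open>q\<close> has such a rank.\<close>

lemma cuts_cofinal:
  assumes "c < q"
  shows "\<exists>N. \<forall>n\<ge>N. c < cuts \<delta> p n"
proof (rule ccontr)
  assume neg: "\<not> ?thesis"
  have bound: "cuts \<delta> p n \<le> c" for n
  proof (rule ccontr)
    assume "\<not> cuts \<delta> p n \<le> c"
    then have "\<forall>k\<ge>n. c < cuts \<delta> p k" using cuts_mono by (meson less_le_trans not_le)
    then show False using neg by blast
  qed
  define s where "s = Sup (range (cuts \<delta> p))"
  have s: "cuts \<delta> p n < s" for n
    using less_le_trans[OF cuts_Suc[of n] Sup_cord_upper[of "range (cuts \<delta> p)" "cuts \<delta> p (Suc n)"]]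
    by (simp add: s_def del: cuts.simps)
  have "s \<le> c" unfolding s_def by (rule cSup_least) (use bound in auto)
  then have "s < q" using assms by simp
  have "p < s" using s[of 0] by simp
  then have "orank s < osuc \<mu>" using pq \<open>s < q\<close> by (simp add: top_interval_def)
  moreover have "\<mu> < orank s"
  proof (rule orank_gt_if_cofinal[OF \<open>p < s\<close>])
    fix d assume "d < s"
    then obtain m where "d < cuts \<delta> p m"
      using less_Sup_cord[of "range (cuts \<delta> p)" d] unfolding s_def by auto
    moreover obtain n where n: "n \<ge> m" "\<delta> n = \<mu>" using inf by blast
    moreover have "cuts \<delta> p m \<le> cuts \<delta> p (Suc n)" by (rule cuts_mono) (use n in simp)
    moreover have "orank (cuts \<delta> p (Suc n)) = \<mu>" using cuts_top_interval[of n] n by (simp add: top_interval_def)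
    ultimately show "\<exists>y. d < y \<and> y < s \<and> \<mu> \<le> orank y"
      using s[of "Suc n"] by (intro exI[of _ "cuts \<delta> p (Suc n)"]) (auto simp del: cuts.simps)
  qed
  ultimately show False by (auto simp: less_osuc_iff)
qed

end

text \<open>The points of rank above \<open>\<mu>\<close>, together with the left end point, divide an interval into
  blocks of order type \<open>\<omega>\<^bsup>\<mu>+1\<^esup>\<close>, and each block is cut into intervals with largest
  ranks \<open>\<delta> 0, \<delta> 1, \<dots>\<close>.\<close>

lemma ordinal_pieces:
  assumes \<delta>: "\<And>n. \<delta> n \<le> \<mu>" and inf: "\<And>N. \<exists>n\<ge>N. \<delta> n = \<mu>" and ac: "a < c" "\<mu> < orank c"
  obtains I :: "(cord \<times> nat) set" and lo hi where
    "\<And>i. i \<in> I \<Longrightarrow> top_interval (lo i) (hi i) (\<delta> (snd i)) \<and> a \<le> lo i \<and> hi i \<le> c"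
    "\<And>i j. i \<in> I \<Longrightarrow> j \<in> I \<Longrightarrow> i \<noteq> j \<Longrightarrow> {lo i<..hi i} \<inter> {lo j<..hi j} = {}"
    "\<And>x. a < x \<Longrightarrow> x \<le> c \<Longrightarrow> orank x \<le> \<mu> \<Longrightarrow> \<exists>i\<in>I. x \<in> {lo i<..hi i}"
    "\<And>x y. a < x \<Longrightarrow> x \<le> c \<Longrightarrow> orank x = osuc \<mu> \<Longrightarrow> y < x \<Longrightarrow>
       \<exists>N. \<forall>n\<ge>N. \<exists>i\<in>I. snd i = n \<and> y \<le> lo i \<and> hi i < x"
proof -
  \<comment> \<open>The left end points of the blocks. The block of p ends at \<open>nx p\<close>,
    the next point of rank above \<mu>; its rank is exactly \<mu>+1, and it belongs to no
    piece.\<close>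
  define R where "R = {x. a \<le> x \<and> x < c \<and> (x = a \<or> \<mu> < orank x)}"
  define nx where "nx = next_rank (osuc \<mu>)"
  have nx: "top_interval p (nx p) (osuc \<mu>)" "nx p \<le> c" if "p \<in> R" for p
    using next_rank[of p c "osuc \<mu>"] that ac(2) unfolding nx_def R_def by (auto simp: osuc_le)
  have nx_le: "nx p \<le> q" if "p < q" "\<mu> < orank q" for p q
    using next_rank(2)[of p q "osuc \<mu>"] that unfolding nx_def by (simp add: osuc_le)
  define I where "I = R \<times> (UNIV :: nat set)"
  define lo where "lo = (\<lambda>(p, n). cuts \<delta> p n)"
  define hi where "hi = (\<lambda>(p, n). cuts \<delta> p (Suc n))"
  note cl = cuts_less[OF \<delta> inf nx(1)] and ct = cuts_top_interval[OF \<delta> inf nx(1)]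
    and cm = cuts_mono[OF \<delta> inf nx(1)] and cc = cuts_cofinal[OF \<delta> inf nx(1)]
  have low: "p \<le> cuts \<delta> p n" if "p \<in> R" for p n
    using cm[OF that, of 0 n] by simp
  \<comment> \<open>The least p from which on all ranks before x are at most \<mu>. If p were not in
    \<open>R\<close>, its own rank would be at most \<mu>, and a left neighbourhood of p could be
    added.\<close>
  have block: "\<exists>p\<in>R. p < x \<and> (\<forall>y. p < y \<and> y < x \<longrightarrow> orank y \<le> \<mu>)" if x: "a < x" "x \<le> c" "orank x \<le> osuc \<mu>" for x
  proof -
    let ?C = "\<lambda>p. a \<le> p \<and> p < x \<and> (\<forall>y. p < y \<and> y < x \<longrightarrow> orank y \<le> \<mu>)"
    have cand: "\<exists>p. a \<le> p \<and> p < z \<and> (\<forall>y. p < y \<and> y < z \<longrightarrow> orank y < orank z)" if "a < z" for z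
    proof -
      obtain \<alpha> where \<alpha>: "\<alpha> \<le> z" "\<not> limit_ordinal \<alpha>" "\<And>y. \<alpha> \<le> y \<Longrightarrow> y < z \<Longrightarrow> orank y < orank z"
        using orank_nbhd[of z] by metis
      show ?thesis
      proof (cases \<alpha> rule: cord_cases)
        case zero
        then show ?thesis using \<alpha>(3) that by (intro exI[of _ a]) simp
      next
        case (suc \<gamma>)
        then show ?thesis using \<alpha>(1,3) that by (intro exI[of _ "max a \<gamma>"]) (auto simp: osuc_le)
      qed (use \<alpha> in simp)
    qed
    obtain p0 where "a \<le> p0" "p0 < x" "\<And>y. p0 < y \<Longrightarrow> y < x \<Longrightarrow> orank y < orank x"
      using cand[OF x(1)] by blast
    then have "?C p0" using x(3) by (meson less_le_trans less_osuc_iff)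
    define p where "p = (LEAST p. ?C p)"
    have p: "?C p" unfolding p_def by (rule LeastI) (rule \<open>?C p0\<close>)
    have "p \<in> R"
    proof (rule ccontr)
      assume "p \<notin> R"
      then have np: "a < p" "orank p \<le> \<mu>" using p x(2) by (auto simp: R_def)
      obtain p' where p': "a \<le> p'" "p' < p" "\<And>y. p' < y \<Longrightarrow> y < p \<Longrightarrow> orank y < orank p"
        using cand[OF np(1)] by blast
      have "orank y \<le> \<mu>" if "p' < y" "y < x" for y
      proof (cases y p rule: linorder_cases)
        case less
        then show ?thesis using p'(3)[OF that(1) less] np(2) by simp
      qed (use np p that in auto)
      then have "?C p'" using p' p by auto
      then have "p \<le> p'" unfolding p_def by (rule Least_le)
      then show False using p'(2) by simp
    qed
    then show ?thesis using p by blast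
  qed
  have apart: "hi (p, n) \<le> lo (p', n')" if "p \<in> R" "p' \<in> R" "p < p'" for p p' n n'
  proof -
    have "\<mu> < orank p'" using that by (auto simp: R_def)
    then have "cuts \<delta> p (Suc n) < p'" using cl[OF that(1), of "Suc n"] nx_le[OF that(3)] by (meson less_le_trans)
    then show ?thesis using low[OF that(2), of n'] unfolding hi_def lo_def by (auto simp del: cuts.simps)
  qed
  have apart2: "hi (p, n) \<le> lo (p, n')" if "p \<in> R" "n < n'" for p n n'
    using cm[OF that(1), of "Suc n" n'] that(2) unfolding hi_def lo_def by (simp del: cuts.simps)
  show ?thesis
  proof (rule that[of I lo hi])
    fix i assume "i \<in> I"
    then obtain p n where i: "i = (p, n)" "p \<in> R" unfolding I_def by auto
    have "a \<le> p" using i(2) by (simp add: R_def)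
    then have "a \<le> lo i" using low[OF i(2), of n] i(1) by (auto simp: lo_def)
    moreover have "hi i \<le> c" using cl[OF i(2), of "Suc n"] nx(2)[OF i(2)] i(1) by (auto simp: hi_def simp del: cuts.simps)
    ultimately show "top_interval (lo i) (hi i) (\<delta> (snd i)) \<and> a \<le> lo i \<and> hi i \<le> c"
      using ct[OF i(2), of n] i(1) by (simp add: lo_def hi_def)
  next
    fix i j assume "i \<in> I" "j \<in> I" and ne: "i \<noteq> j"
    then obtain p n p' n' where ij: "i = (p, n)" "j = (p', n')" "p \<in> R" "p' \<in> R" unfolding I_def by auto
    then consider "p < p'" | "p' < p" | "p = p'" "n < n'" | "p = p'" "n' < n" using ne by (metis linorder_neqE)
    then have "hi i \<le> lo j \<or> hi j \<le> lo i"
      using apart apart2 ij by cases auto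
    then show "{lo i<..hi i} \<inter> {lo j<..hi j} = {}" by auto
  next
    fix x assume x: "a < x" "x \<le> c" "orank x \<le> \<mu>"
    have "orank x \<le> osuc \<mu>" using x(3) less_osuc[of \<mu>] by simp
    then obtain p where p: "p \<in> R" "p < x" "\<And>y. p < y \<Longrightarrow> y < x \<Longrightarrow> orank y \<le> \<mu>" using block[OF x(1,2)] by blast
    have q: "p < nx p" "orank (nx p) = osuc \<mu>" using nx(1)[OF p(1)] by (auto simp: top_interval_def)
    have "x < nx p"
    proof (rule ccontr)
      assume "\<not> x < nx p"
      then have "nx p = x \<or> nx p < x" by auto
      then have "orank (nx p) \<le> \<mu>" using p(3)[OF q(1)] x(3) by auto
      then show False using q(2) less_osuc[of \<mu>] by simp
    qed
    then obtain N where "x < cuts \<delta> p N" using cc[OF p(1)] by blast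
    then have ex: "\<exists>n. x \<le> cuts \<delta> p n" by (auto intro: less_imp_le)
    define n where "n = (LEAST n. x \<le> cuts \<delta> p n)"
    have n: "x \<le> cuts \<delta> p n" unfolding n_def using ex by (rule LeastI_ex)
    then have "n \<noteq> 0" using p(2) by (metis cuts.simps(1) not_le)
    then obtain m where m: "n = Suc m" by (cases n) auto
    then have "\<not> x \<le> cuts \<delta> p m" using not_less_Least[of m "\<lambda>n. x \<le> cuts \<delta> p n"] unfolding n_def by auto
    then have "x \<in> {lo (p, m)<..hi (p, m)}" using n m by (auto simp: lo_def hi_def simp del: cuts.simps)
    then show "\<exists>i\<in>I. x \<in> {lo i<..hi i}" using p(1) by (intro bexI[of _ "(p, m)"]) (auto simp: I_def)
  next
    fix x y assume x: "a < x" "x \<le> c" "orank x = osuc \<mu>" and y: "y < x"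
    obtain p where p: "p \<in> R" "p < x" "\<And>y. p < y \<Longrightarrow> y < x \<Longrightarrow> orank y \<le> \<mu>"
      using block[OF x(1,2)] x(3) by auto
    have q: "p < nx p" "orank (nx p) = osuc \<mu>" using nx(1)[OF p(1)] by (auto simp: top_interval_def)
    have "nx p \<le> x" using nx_le[OF p(2)] x(3) less_osuc[of \<mu>] by simp
    moreover have "\<not> nx p < x" using p(3)[OF q(1)] q(2) less_osuc[of \<mu>] by auto
    ultimately have xq: "nx p = x" by simp
    then obtain N where N: "\<And>n. n \<ge> N \<Longrightarrow> y < cuts \<delta> p n" using cc[OF p(1)] y by blast
    have "\<exists>i\<in>I. snd i = n \<and> y \<le> lo i \<and> hi i < x" if "n \<ge> N" for n
      using N[OF that] cl[OF p(1), of "Suc n"] xq p(1)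
      by (intro bexI[of _ "(p, n)"]) (auto simp: lo_def hi_def I_def less_imp_le simp del: cuts.simps)
    then show "\<exists>N. \<forall>n\<ge>N. \<exists>i\<in>I. snd i = n \<and> y \<le> lo i \<and> hi i < x" by blast
  qed
qed

section \<open>Labelled spaces\<close>

lemma ex_lmax_family:
  assumes T: "is_rank T r"
    and D: "\<And>i j. i \<in> I \<Longrightarrow> j \<in> I \<Longrightarrow> i \<noteq> j \<Longrightarrow> D i \<inter> D j = {}" "\<And>i. i \<in> I \<Longrightarrow> D i \<noteq> {}"
      "\<And>i. i \<in> I \<Longrightarrow> openin T (D i)"
    and \<sigma>: "\<And>i. i \<in> I \<Longrightarrow> lext (\<sigma> i) (subtopology T (D i)) r" "\<And>i. i \<in> I \<Longrightarrow> lmax (\<sigma> i) r"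
  obtains M where "lext M T r" "lmax M r" "\<And>i. i \<in> I \<Longrightarrow> subtopology M (D i) = \<sigma> i"
proof -
  have inj: "inj_on D I"
  proof (rule inj_onI)
    fix i j assume "i \<in> I" "j \<in> I" "D i = D j"
    then show "i = j" using D(1)[of i j] D(2)[of i] by (cases "i = j") auto
  qed
  define s where "s = (\<lambda>U. \<sigma> (the_inv_into I D U))"
  have s: "s (D i) = \<sigma> i" if "i \<in> I" for i by (simp add: s_def the_inv_into_f_f[OF inj that])
  obtain M where "lext M T r" "lmax M r" and M: "\<And>U. U \<in> D ` I \<Longrightarrow> subtopology M U = s U"
  proof (rule ex_lmax_pieces[OF T, of "D ` I" s])
    show "disjoint (D ` I)" using D(1) by (auto simp: disjoint_def)
  qed (use D(3) \<sigma> s in auto)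
  then show ?thesis using that[of M] s by simp
qed

lemma lmes_glue_family:
  assumes T: "is_rank T r"
    and D: "\<And>i j. i \<in> I \<Longrightarrow> j \<in> I \<Longrightarrow> i \<noteq> j \<Longrightarrow> D i \<inter> D j = {}" "\<And>i. i \<in> I \<Longrightarrow> D i \<noteq> {}"
      "\<And>i. i \<in> I \<Longrightarrow> openin T (D i)"
    and \<sigma>: "\<And>i. i \<in> I \<Longrightarrow> lmes (subtopology T (D i)) r (\<sigma> i)"
  obtains \<tau> where "lmes T r \<tau>" "\<And>n i. i \<in> I \<Longrightarrow> subtopology (\<tau> n) (D i) = \<sigma> i n"
proof -
  have inj: "inj_on D I"
  proof (rule inj_onI)
    fix i j assume "i \<in> I" "j \<in> I" "D i = D j"
    then show "i = j" using D(1)[of i j] D(2)[of i] by (cases "i = j") auto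
  qed
  define s where "s = (\<lambda>U. \<sigma> (the_inv_into I D U))"
  have s: "s (D i) = \<sigma> i" if "i \<in> I" for i by (simp add: s_def the_inv_into_f_f[OF inj that])
  obtain \<tau> where "lmes T r \<tau>" and M: "\<And>n U. U \<in> D ` I \<Longrightarrow> subtopology (\<tau> n) U = s U n"
  proof (rule lmes_glue[OF T, of "D ` I" s])
    show "disjoint (D ` I)" using D(1) by (auto simp: disjoint_def)
  qed (use D(3) \<sigma> s in auto)
  then show ?thesis using that[of \<tau>] s by simp
qed

abbreviation iv :: "cord \<Rightarrow> cord \<Rightarrow> cord topology"
  where "iv a b \<equiv> subtopology otop {a<..b}"

lemma is_rank_iv: "is_rank (iv a b) orank"
  by (rule is_rank_subtopology[OF is_rank_otop openin_otop_interval])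

lemma openin_iv: "openin (iv a b) U \<longleftrightarrow> openin otop U \<and> U \<subseteq> {a<..b}"
  using openin_open_subtopology[OF openin_otop_interval] by blast

text \<open>Boxes \<open>[m + j]\<close> are interpreted by the \<open>j\<close>-th topology. The labels are full maximal
  consistent sets, but only boxes \<open>[k]\<psi>\<close> with \<open>k \<le> N\<close> and \<open>\<psi> \<in> \<Psi>\<close> have to be true to them.\<close>

definition labelled ::
  "fm set \<Rightarrow> nat \<Rightarrow> nat \<Rightarrow> cord \<Rightarrow> cord \<Rightarrow> fm set \<Rightarrow> (nat \<Rightarrow> cord topology) \<Rightarrow> (cord \<Rightarrow> fm set) \<Rightarrow> bool"
  where "labelled \<Psi> N m a b \<Gamma> \<tau> f \<longleftrightarrow> lmes (iv a b) orank \<tau> \<and> f b = \<Gamma> \<and>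
    (\<forall>x\<in>{a<..b}. mcs (f x)) \<and>
    (\<forall>x\<in>{a<..<b}. \<forall>\<theta>. FBox m \<theta> \<in> \<Gamma> \<longrightarrow> \<theta> \<in> f x) \<and>
    (\<forall>j \<psi> x. \<psi> \<in> \<Psi> \<and> m + j \<le> N \<and> x \<in> {a<..b} \<longrightarrow>
      (FBox (m + j) \<psi> \<in> f x \<longleftrightarrow> x \<notin> \<tau> j derived_set_of {y\<in>{a<..b}. \<psi> \<notin> f y}))"

text \<open>All intervals with last rank \<delta> have to be labelled, wherever they lie, because
  copies are used at many places of a larger interval.\<close>

definition realizable :: "fm set \<Rightarrow> nat \<Rightarrow> nat \<Rightarrow> fm set \<Rightarrow> bool"
  where "realizable \<Psi> N m \<Gamma> \<longleftrightarrow>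
    (\<exists>\<delta><epsilon0. \<forall>a b. top_interval a b \<delta> \<longrightarrow> (\<exists>\<tau> f. labelled \<Psi> N m a b \<Gamma> \<tau> f))"

lemma labelledD:
  assumes "labelled \<Psi> N m a b \<Gamma> \<tau> f"
  shows "lmes (iv a b) orank \<tau>" "f b = \<Gamma>" "\<And>x. x \<in> {a<..b} \<Longrightarrow> mcs (f x)"
    "\<And>x \<theta>. x \<in> {a<..<b} \<Longrightarrow> FBox m \<theta> \<in> \<Gamma> \<Longrightarrow> \<theta> \<in> f x"
    "\<And>j \<psi> x. \<psi> \<in> \<Psi> \<Longrightarrow> m + j \<le> N \<Longrightarrow> x \<in> {a<..b} \<Longrightarrow>
      FBox (m + j) \<psi> \<in> f x \<longleftrightarrow> x \<notin> \<tau> j derived_set_of {y\<in>{a<..b}. \<psi> \<notin> f y}"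
  using assms unfolding labelled_def by auto

text \<open>An interval with last rank 0 is a single isolated point, where every box is true. This
  serves both as the case without refuted boxes and as the case m > N, where no box is subject to a
  condition.\<close>

lemma realizable_single:
  assumes \<Gamma>: "mcs \<Gamma>" and boxes: "\<And>\<psi>. \<psi> \<in> \<Psi> \<Longrightarrow> m \<le> N \<Longrightarrow> FBox m \<psi> \<in> \<Gamma>"
  shows "realizable \<Psi> N m \<Gamma>"
  unfolding realizable_def
proof (intro exI[of _ 0] conjI allI impI)
  fix a b assume ab: "top_interval a b 0"
  have "{a<..b} = {b}" using ab by (auto simp: top_interval_def le_less)
  obtain \<tau> where \<tau>: "lmes (iv a b) orank \<tau>"
    by (rule lmes_glue[OF is_rank_iv, of "{}"]) auto
  have "FBox (m + j) \<psi> \<in> \<Gamma>" if "\<psi> \<in> \<Psi>" "m + j \<le> N" for j \<psi>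
    by (rule mcs_box_mono[OF \<Gamma> _ boxes[OF that(1)]]) (use that in auto)
  then have "labelled \<Psi> N m a b \<Gamma> \<tau> (\<lambda>_. \<Gamma>)"
    using \<tau> \<Gamma> ab unfolding labelled_def \<open>{a<..b} = {b}\<close> by (auto simp: in_derived_set_of top_interval_def)
  then show "\<exists>\<tau> f. labelled \<Psi> N m a b \<Gamma> \<tau> f" by blast
qed (rule epsilon0_pos)

text \<open>Points of rank at most \<mu> lie in the pieces \<open>D i\<close>, where truth is
  inherited because the pieces stay open. The points of \<open>R\<close>, of rank above \<mu>, carry
  the labels of their ranks in the space \<open>Y\<close>, so boxes beyond [m] are pulled back from
  \<open>Y\<close>. For [m] they all agree with \<Gamma>: a box [m]\<psi> in \<Gamma> makes \<psi>
  true below c, and a refuted one has witnesses near every point of \<open>R\<close>.\<close>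

lemma labelled_construction:
  assumes \<Gamma>: "mcs \<Gamma>" and ac: "top_interval a c \<beta>" and \<mu>\<beta>: "\<mu> < \<beta>"
    and Y: "labelled \<Psi> N (Suc m) \<mu> \<beta> \<Gamma> \<sigma>Y fY"
    and sub: "\<And>i. i \<in> I \<Longrightarrow> lo i < hi i \<and> a \<le> lo i \<and> hi i \<le> c"
    and low: "\<And>i x. i \<in> I \<Longrightarrow> lo i < x \<Longrightarrow> x \<le> hi i \<Longrightarrow> orank x \<le> \<mu>"
    and disj: "\<And>i j. i \<in> I \<Longrightarrow> j \<in> I \<Longrightarrow> i \<noteq> j \<Longrightarrow> {lo i<..hi i} \<inter> {lo j<..hi j} = {}"
    and cover: "\<And>x. a < x \<Longrightarrow> x \<le> c \<Longrightarrow> orank x \<le> \<mu> \<Longrightarrow> \<exists>i\<in>I. x \<in> {lo i<..hi i}"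
    and lab: "\<And>i. i \<in> I \<Longrightarrow> labelled \<Psi> N m (lo i) (hi i) (G i) (\<sigma> i) (F i)"
    and G: "\<And>i \<theta>. i \<in> I \<Longrightarrow> FBox m \<theta> \<in> \<Gamma> \<Longrightarrow> \<theta> \<in> G i \<and> FBox m \<theta> \<in> G i"
    and wit: "\<And>\<psi> x y. \<psi> \<in> \<Psi> \<Longrightarrow> FBox m \<psi> \<notin> \<Gamma> \<Longrightarrow> a < x \<Longrightarrow> x \<le> c \<Longrightarrow> orank x = osuc \<mu> \<Longrightarrow> y < x \<Longrightarrow>
       \<exists>i\<in>I. \<psi> \<notin> G i \<and> y \<le> lo i \<and> hi i < x"
  shows "\<exists>\<tau> f. labelled \<Psi> N m a c \<Gamma> \<tau> f"
proof -
  define D where "D = (\<lambda>i. {lo i<..hi i})"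
  define R where "R = {x\<in>{a<..c}. \<mu> < orank x}"
  have c: "a < c" "orank c = \<beta>" "\<And>x. a < x \<Longrightarrow> x < c \<Longrightarrow> orank x < \<beta>" using ac by (auto simp: top_interval_def)
  have Dsub: "D i \<subseteq> {a<..c}" if "i \<in> I" for i using sub[OF that] by (auto simp: D_def)
  have Dne: "D i \<noteq> {}" if "i \<in> I" for i using sub[OF that] by (auto simp: D_def)
  have Dlow: "\<not> \<mu> < orank x" if "i \<in> I" "x \<in> D i" for i x
    using low[OF that(1), of x] that(2) by (simp add: D_def not_less)
  then have DR: "D i \<inter> R = {}" if "i \<in> I" for i using that by (auto simp: R_def)
  have DD: "D i \<inter> D j = {}" if "i \<in> I" "j \<in> I" "i \<noteq> j" for i j using disj[OF that] by (simp add: D_def)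
  have Dopen: "openin (iv a c) (D i)" if "i \<in> I" for i
    using Dsub[OF that] openin_otop_interval unfolding openin_iv by (simp add: D_def)
  have Dtop: "subtopology (iv a c) (D i) = iv (lo i) (hi i)" if "i \<in> I" for i
  proof -
    have "{a<..c} \<inter> D i = {lo i<..hi i}" using Dsub[OF that] by (auto simp: D_def)
    then show ?thesis by (simp only: subtopology_subtopology)
  qed
  have Rcases: "x \<in> R \<or> (\<exists>i\<in>I. x \<in> D i)" if "x \<in> {a<..c}" for x
    using cover[of x] that by (cases "\<mu> < orank x") (auto simp: R_def D_def)
  note \<sigma> = labelledD(1)[OF lab]

  \<comment> \<open>The pieces keep their own first topology; at the points of \<open>R\<close> any
    \<ell>-maximal completion will do.\<close>
  obtain M where M: "lext M (iv a c) orank" "lmax M orank" "\<And>i. i \<in> I \<Longrightarrow> subtopology M (D i) = \<sigma> i 0"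
  proof (rule ex_lmax_family[OF is_rank_iv, of I D a c "\<lambda>i. \<sigma> i 0"])
    show "lext (\<sigma> i 0) (subtopology (iv a c) (D i)) orank" if "i \<in> I" for i
      unfolding Dtop[OF that] by (rule lmesD(1)[OF \<sigma>[OF that]])
    show "lmax (\<sigma> i 0) orank" if "i \<in> I" for i
      using lmesD(2)[OF \<sigma>[OF that], of 0] by simp
  qed (use DD Dne Dopen in auto)
  have Mr: "is_rank M orank" by (rule lextD(1)[OF M(1)])
  have Mtop: "topspace M = {a<..c}" using lextD(2)[OF M(1)] by simp
  have MD: "openin M (D i)" if "i \<in> I" for i by (rule lextD(3)[OF M(1) Dopen[OF that]])
  let ?P = "plus_topology M"
  have Pr: "is_rank ?P (orank \<circ> orank)" by (rule is_rank_plus[OF Mr M(2)])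
  have d: "dmap orank ?P otop" by (rule dmap_rank[OF Mr M(2)])
  \<comment> \<open>As the preimage of (\<mu>, \<beta>] under the d-map \<open>orank\<close>, the
    region \<open>R\<close> becomes open in \<open>?P\<close>. From the second topology on it is
    separated from the pieces and can be treated independently of them.\<close>
  have Req: "R = {x\<in>topspace ?P. orank x \<in> {\<mu><..\<beta>}}"
    using c unfolding topspace_plus_topology Mtop R_def by (auto simp: le_less)
  have RP: "openin ?P R" unfolding Req by (rule dmapD(2)[OF d openin_otop_interval])
  have dR: "dmap orank (subtopology ?P R) (iv \<mu> \<beta>)"
    unfolding Req by (rule dmap_subtopology[OF d openin_otop_interval])
  obtain \<tau>R where \<tau>R: "lmes (subtopology ?P R) (orank \<circ> orank) \<tau>R" "\<And>n. dmap orank (\<tau>R n) (\<sigma>Y n)"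
    using lmes_lift[OF dR is_rank_iv labelledD(1)[OF Y]] by blast

  \<comment> \<open>\<open>None\<close> is the index of \<open>R\<close>. The sequences of the
    pieces are shifted by one, as their first members are already part of \<open>M\<close>.\<close>
  define D' where "D' = case_option R D"
  define \<sigma>' where "\<sigma>' = case_option \<tau>R (\<lambda>i n. \<sigma> i (Suc n))"
  obtain \<tau>' where \<tau>': "lmes ?P (orank \<circ> orank) \<tau>'"
    "\<And>n i. i \<in> insert None (Some ` I) \<Longrightarrow> subtopology (\<tau>' n) (D' i) = \<sigma>' i n"
  proof (rule lmes_glue_family[OF Pr, of "insert None (Some ` I)" D' \<sigma>'])
    show "D' i \<inter> D' j = {}" if "i \<in> insert None (Some ` I)" "j \<in> insert None (Some ` I)" "i \<noteq> j" for i j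
    proof (cases i)
      case None
      then have "\<exists>k. j = Some k \<and> k \<in> I" using that by auto
      then obtain k where "j = Some k" "k \<in> I" by blast
      then show ?thesis using None DR[of k] by (simp add: D'_def Int_commute)
    next
      case (Some k)
      then have k: "k \<in> I" using that by auto
      show ?thesis
      proof (cases j)
        case None
        then show ?thesis using Some DR[OF k] by (simp add: D'_def)
      next
        case (Some l)
        then have "l \<in> I" "k \<noteq> l" using that \<open>i = Some k\<close> by auto
        then show ?thesis using Some \<open>i = Some k\<close> DD[OF k] by (simp add: D'_def)
      qed
    qed
    have "c \<in> R" using c \<mu>\<beta> by (auto simp: R_def)
    then show "D' i \<noteq> {}" if "i \<in> insert None (Some ` I)" for i
      using that Dne by (auto simp: D'_def)
    show "openin ?P (D' i)" if "i \<in> insert None (Some ` I)" for i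
      using that RP plus_topology_openin[OF MD] by (auto simp: D'_def)
    show "lmes (subtopology ?P (D' i)) (orank \<circ> orank) (\<sigma>' i)" if "i \<in> insert None (Some ` I)" for i
    proof (cases i)
      case None
      then show ?thesis using \<tau>R(1) by (simp add: D'_def \<sigma>'_def)
    next
      case (Some k)
      then have k: "k \<in> I" using that by auto
      have "lmax (subtopology M (D k)) orank" using lmesD(2)[OF \<sigma>[OF k], of 0] M(3)[OF k] by simp
      from subtopology_plus[OF Mr M(2) MD[OF k] this]
      have "subtopology ?P (D k) = plus_topology (\<sigma> k 0)" using M(3)[OF k] by simp
      moreover have "lmes (plus_topology (\<sigma> k 0)) (orank \<circ> orank) (\<lambda>n. \<sigma> k (Suc n))"
        using \<sigma>[OF k] unfolding lmes_Suc_iff[of "iv (lo k) (hi k)"] by blast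
      ultimately show ?thesis using Some by (simp add: D'_def \<sigma>'_def)
    qed
  qed blast
  define \<tau> where "\<tau> = case_nat M \<tau>'"
  have \<tau>: "lmes (iv a c) orank \<tau>"
    unfolding lmes_Suc_iff[of "iv a c"] using M(1,2) \<tau>'(1) by (simp add: \<tau>_def)
  have \<tau>D: "subtopology (\<tau> n) (D i) = \<sigma> i n" if "i \<in> I" for n i
    using M(3)[OF that] \<tau>'(2)[of "Some i"] that by (cases n) (auto simp: \<tau>_def D'_def \<sigma>'_def)
  have \<tau>Rs: "subtopology (\<tau> (Suc n)) R = \<tau>R n" for n
    using \<tau>'(2)[of None n] by (simp add: \<tau>_def D'_def \<sigma>'_def)
  have \<tau>Do: "openin (\<tau> n) (D i)" if "i \<in> I" for n i by (rule lmes_base_mono[OF \<tau> Dopen[OF that]])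
  have \<tau>Ro: "openin (\<tau> (Suc n)) R" for n using lmes_base_mono[OF \<tau>'(1) RP] by (simp add: \<tau>_def)

  define f where "f = (\<lambda>x. if \<mu> < orank x then fY (orank x) else F (THE i. i \<in> I \<and> x \<in> D i) x)"
  have fR: "f x = fY (orank x)" if "x \<in> R" for x using that by (simp add: f_def R_def)
  have fD: "f x = F i x" if "i \<in> I" "x \<in> D i" for i x
  proof -
    have "(THE i. i \<in> I \<and> x \<in> D i) = i" using that DD by (intro the_equality) blast+
    then show ?thesis using Dlow[OF that] by (simp add: f_def)
  qed
  have Rrank: "orank x \<in> {\<mu><..\<beta>}" if "x \<in> R" for x using that Req by blast
  have mcsf: "mcs (f x)" if x: "x \<in> {a<..c}" for x
    using Rcases[OF x]
  proof
    assume "x \<in> R"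
    then show ?thesis using labelledD(3)[OF Y Rrank] fR by simp
  next
    assume "\<exists>i\<in>I. x \<in> D i"
    then obtain i where "i \<in> I" "x \<in> D i" by blast
    then show ?thesis using labelledD(3)[OF lab[OF \<open>i \<in> I\<close>], of x] fD by (simp add: D_def)
  qed
  have fc: "f c = \<Gamma>" using fR[of c] c \<mu>\<beta> labelledD(2)[OF Y] by (simp add: R_def)
  \<comment> \<open>For all \<theta>, not only those in \<Psi>: \<open>mcs_Suc_step\<close> applies
    it to boxes and diamonds for m as well.\<close>
  have Rstep: "FBox (Suc m) \<theta> \<in> \<Gamma> \<Longrightarrow> \<theta> \<in> f x" if "x \<in> R" "x \<noteq> c" for x \<theta>
  proof -
    have "orank x \<in> {\<mu><..<\<beta>}" using that c unfolding R_def by auto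
    then show "FBox (Suc m) \<theta> \<in> \<Gamma> \<Longrightarrow> \<theta> \<in> f x" using labelledD(4)[OF Y] fR[OF that(1)] by simp
  qed
  have Rbox: "FBox m \<theta> \<in> f x \<longleftrightarrow> FBox m \<theta> \<in> \<Gamma>" if x: "x \<in> R" for x \<theta>
  proof (cases "x = c")
    case False
    have "x \<in> {a<..c}" using x by (simp add: R_def)
    from mcs_Suc_step(1)[OF \<Gamma> mcsf[OF this] Rstep[OF x False]] show ?thesis .
  qed (simp add: fc)
  have below: "\<theta> \<in> f x" if x: "x \<in> {a<..<c}" and \<theta>: "FBox m \<theta> \<in> \<Gamma>" for x \<theta>
  proof -
    have xc: "x \<in> {a<..c}" "x \<noteq> c" using x by auto
    show ?thesis using Rcases[OF xc(1)]
    proof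
      assume R: "x \<in> R"
      show ?thesis by (rule mcs_Suc_step(2)[OF \<Gamma> mcsf[OF xc(1)] Rstep[OF R xc(2)] \<theta>])
    next
      assume "\<exists>i\<in>I. x \<in> D i"
      then obtain i where i: "i \<in> I" "x \<in> D i" by blast
      show ?thesis
      proof (cases "x = hi i")
        case True
        then show ?thesis using fD[OF i] labelledD(2)[OF lab[OF i(1)]] G[OF i(1) \<theta>] by simp
      next
        case False
        then have "x \<in> {lo i<..<hi i}" using i(2) by (auto simp: D_def)
        then show ?thesis using fD[OF i] labelledD(4)[OF lab[OF i(1)]] G[OF i(1) \<theta>] by simp
      qed
    qed
  qed
  have truth: "FBox (m + j) \<psi> \<in> f x \<longleftrightarrow> x \<notin> \<tau> j derived_set_of {y\<in>{a<..c}. \<psi> \<notin> f y}"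
    if \<psi>: "\<psi> \<in> \<Psi>" and j: "m + j \<le> N" and x: "x \<in> {a<..c}" for j \<psi> x
    using Rcases[OF x]
  proof
    assume "\<exists>i\<in>I. x \<in> D i"
    then obtain i where i: "i \<in> I" "x \<in> D i" by blast
    have "{y\<in>{a<..c}. \<psi> \<notin> f y} \<inter> D i = {y\<in>{lo i<..hi i}. \<psi> \<notin> F i y}"
      using Dsub[OF i(1)] fD[OF i(1)] by (auto simp: D_def)
    then have "x \<in> \<tau> j derived_set_of {y\<in>{a<..c}. \<psi> \<notin> f y} \<longleftrightarrow>
        x \<in> \<sigma> i j derived_set_of {y\<in>{lo i<..hi i}. \<psi> \<notin> F i y}"
      using derived_set_of_open_subtopology[OF \<tau>Do[OF i(1), of j] i(2)] \<tau>D[OF i(1)] by simp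
    then show ?thesis
      using labelledD(5)[OF lab[OF i(1)] \<psi> j, of x] i(2) fD[OF i] by (simp add: D_def)
  next
    assume R: "x \<in> R"
    show ?thesis
    proof (cases j)
      case 0
      have \<tau>0: "\<tau> 0 = M" by (simp add: \<tau>_def)
      show ?thesis
      proof (cases "FBox m \<psi> \<in> \<Gamma>")
        case True
        have "x \<notin> M derived_set_of {y\<in>{a<..c}. \<psi> \<notin> f y}"
        proof
          assume d: "x \<in> M derived_set_of {y\<in>{a<..c}. \<psi> \<notin> f y}"
          have o: "openin M {a<..x}"
            by (rule lextD(3)[OF M(1)]) (use x openin_otop_interval in \<open>auto simp: openin_iv\<close>)
          have "x \<in> {a<..x}" using x by simp
          from derived_setD[OF d o this] obtain y where y: "y \<noteq> x" "\<psi> \<notin> f y" "y \<in> {a<..x}" by auto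
          then have "y \<in> {a<..<c}" using x by auto
          then show False using below[OF _ True] y(2) by blast
        qed
        then show ?thesis using True Rbox[OF R] 0 \<tau>0 by simp
      next
        case False
        have "x \<in> M derived_set_of {y\<in>{a<..c}. \<psi> \<notin> f y}"
          unfolding in_derived_set_of
        proof (intro conjI allI impI)
          show "x \<in> topspace M" using x Mtop by simp
          fix U assume U: "x \<in> U \<and> openin M U"
          have "osuc \<mu> \<le> orank x" using R by (simp add: R_def osuc_le)
          \<comment> \<open>The rank \<mu>+1 is no limit, so at \<open>z\<close> the topology
            \<open>M\<close> has only the neighbourhoods of the order topology. Hence
            \<open>U\<close> contains an interval ending in \<open>z\<close>, and with it a
            witnessing piece, no matter how \<open>M\<close> was completed.\<close>
          then obtain z where z: "z \<in> U" "orank z = osuc \<mu>" using is_rank_lower_eq[OF Mr] U by blast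
          have zX: "z \<in> {a<..c}" using z(1) openin_subset[of M U] U Mtop by blast
          obtain V where V: "openin (iv a c) V" "z \<in> V" "V \<subseteq> U"
            using lextD(4)[OF M(1), of U z] U z by auto
          then obtain \<alpha> where \<alpha>: "\<alpha> \<le> z" "\<not> limit_ordinal \<alpha>" "{\<alpha>..z} \<subseteq> V" unfolding openin_iv openin_otop by blast
          have "\<alpha> \<noteq> z"
          proof
            assume "\<alpha> = z"
            then have "\<exists>y. z \<le> y \<and> y < z \<and> orank y = \<mu>"
              using orank_lower[of z z \<mu>] \<alpha>(2) z(2) less_osuc[of \<mu>] by simp
            then show False by auto
          qed
          then have "\<alpha> < z" using \<alpha>(1) by simp
          then obtain i where i: "i \<in> I" "\<psi> \<notin> G i" "\<alpha> \<le> lo i" "hi i < z"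
            using wit[OF \<psi> False, of z \<alpha>] zX z(2) by auto
          have hD: "hi i \<in> D i" using sub[OF i(1)] by (simp add: D_def)
          have "\<alpha> \<le> hi i" "hi i \<le> z" using i sub[OF i(1)] by auto
          then have "hi i \<in> U" using \<alpha>(3) V(3) by auto
          moreover have "\<psi> \<notin> f (hi i)" using fD[OF i(1) hD] labelledD(2)[OF lab[OF i(1)]] i(2) by simp
          moreover have "hi i \<noteq> x" using DR[OF i(1)] hD R by blast
          ultimately show "\<exists>y. y \<noteq> x \<and> y \<in> {y\<in>{a<..c}. \<psi> \<notin> f y} \<and> y \<in> U"
            using Dsub[OF i(1)] hD by (intro exI[of _ "hi i"]) auto
        qed
        then show ?thesis using False Rbox[OF R] 0 \<tau>0 by simp
      qed
    next
      case (Suc k)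
      have top: "topspace (\<tau>R k) = R"
        using lmes_topspace[OF \<tau>R(1), of k] openin_subset[OF RP] by auto
      have eq: "{y\<in>{a<..c}. \<psi> \<notin> f y} \<inter> R = {y\<in>topspace (\<tau>R k). orank y \<in> {z\<in>{\<mu><..\<beta>}. \<psi> \<notin> fY z}}"
        unfolding top using fR Rrank by (auto simp: R_def)
      have "x \<in> \<tau> (Suc k) derived_set_of {y\<in>{a<..c}. \<psi> \<notin> f y} \<longleftrightarrow>
          x \<in> \<tau>R k derived_set_of ({y\<in>{a<..c}. \<psi> \<notin> f y} \<inter> R)"
        using derived_set_of_open_subtopology[OF \<tau>Ro[of k] R] \<tau>Rs by simp
      also have "\<dots> \<longleftrightarrow> orank x \<in> \<sigma>Y k derived_set_of {z\<in>{\<mu><..\<beta>}. \<psi> \<notin> fY z}"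
        unfolding eq by (rule dmap_derived_set[OF \<tau>R(2)]) (use top R in simp)
      also have "\<dots> \<longleftrightarrow> FBox (Suc m + k) \<psi> \<notin> fY (orank x)"
        using labelledD(5)[OF Y \<psi>, of k "orank x"] j Suc Rrank[OF R] by simp
      finally show ?thesis using Suc fR[OF R] by simp
    qed
  qed
  have "labelled \<Psi> N m a c \<Gamma> \<tau> f"
    unfolding labelled_def using \<tau> fc mcsf below truth by blast
  then show ?thesis by blast
qed

text \<open>The pieces are copies of spaces for the witnesses of the refuted boxes, with \<mu> the
  largest of their last ranks. The space \<open>Y\<close> for \<Gamma> and m+1 is placed on ordinals
  directly above \<mu>, to be read as ranks of points of the new space.\<close>

lemma realizable_step:
  assumes \<Gamma>: "mcs \<Gamma>" and up: "realizable \<Psi> N (Suc m) \<Gamma>" and fin: "finite \<Psi>"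
    and ne: "{\<psi>\<in>\<Psi>. FBox m \<psi> \<notin> \<Gamma>} \<noteq> {}"
    and IH: "\<And>\<Delta>. mcs \<Delta> \<Longrightarrow> {\<psi>\<in>\<Psi>. FBox m \<psi> \<notin> \<Delta>} \<subset> {\<psi>\<in>\<Psi>. FBox m \<psi> \<notin> \<Gamma>} \<Longrightarrow> realizable \<Psi> N m \<Delta>"
  shows "realizable \<Psi> N m \<Gamma>"
proof -
  define S where "S = {\<psi>\<in>\<Psi>. FBox m \<psi> \<notin> \<Gamma>}"
  have S: "finite S" "S \<noteq> {}" using fin ne by (auto simp: S_def)
  have "\<exists>\<Delta>. \<psi> \<notin> \<Delta> \<and> (\<forall>\<theta>. FBox m \<theta> \<in> \<Gamma> \<longrightarrow> \<theta> \<in> \<Delta> \<and> FBox m \<theta> \<in> \<Delta>) \<and> realizable \<Psi> N m \<Delta>" if "\<psi> \<in> S" for \<psi>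
  proof -
    have \<psi>: "\<psi> \<in> \<Psi>" "FBox m \<psi> \<notin> \<Gamma>" using that by (auto simp: S_def)
    obtain \<Delta> where \<Delta>: "mcs \<Delta>" "\<psi> \<notin> \<Delta>" "FBox m \<psi> \<in> \<Delta>" "\<And>\<theta>. FBox m \<theta> \<in> \<Gamma> \<Longrightarrow> \<theta> \<in> \<Delta> \<and> FBox m \<theta> \<in> \<Delta>"
      using mcs_witness[OF \<Gamma> \<psi>(2)] by blast
    have "realizable \<Psi> N m \<Delta>" by (rule IH[OF \<Delta>(1)]) (use \<psi> \<Delta>(3,4) in blast)
    then show ?thesis using \<Delta> by blast
  qed
  then obtain w where w: "\<And>\<psi>. \<psi> \<in> S \<Longrightarrow> \<psi> \<notin> w \<psi>"
    "\<And>\<psi> \<theta>. \<psi> \<in> S \<Longrightarrow> FBox m \<theta> \<in> \<Gamma> \<Longrightarrow> \<theta> \<in> w \<psi> \<and> FBox m \<theta> \<in> w \<psi>"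
    "\<And>\<psi>. \<psi> \<in> S \<Longrightarrow> realizable \<Psi> N m (w \<psi>)"
    by metis
  then obtain d where d: "\<And>\<psi>. \<psi> \<in> S \<Longrightarrow> d \<psi> < epsilon0"
    "\<And>\<psi> a b. \<psi> \<in> S \<Longrightarrow> top_interval a b (d \<psi>) \<Longrightarrow> \<exists>\<tau> f. labelled \<Psi> N m a b (w \<psi>) \<tau> f"
    unfolding realizable_def by metis
  define \<mu> where "\<mu> = Max (d ` S)"
  have "\<mu> \<in> d ` S" unfolding \<mu>_def using S by (intro Max_in) auto
  then obtain \<psi>0 where \<psi>0: "\<psi>0 \<in> S" "d \<psi>0 = \<mu>" by blast
  have \<mu>e: "\<mu> < epsilon0" using d(1) \<psi>0 by blast
  have d\<mu>: "d \<psi> \<le> \<mu>" if "\<psi> \<in> S" for \<psi> unfolding \<mu>_def using S that by auto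
  obtain xs where xs: "set xs = S" using S finite_list by blast
  \<comment> \<open>In a cyclic enumeration every witness recurs. So does one of largest rank \<mu>,
    which lets the pieces fill the blocks, and each refuted box has witnesses arbitrarily close to
    the end of a block.\<close>
  define e where "e = (\<lambda>n. xs ! (n mod length xs))"
  have len: "0 < length xs" using xs S by auto
  have eS: "e n \<in> S" for n unfolding e_def xs[symmetric] using len by (intro nth_mem) simp
  have eex: "\<exists>n\<ge>N0. e n = \<psi>" if "\<psi> \<in> S" for \<psi> N0
  proof -
    obtain k where k: "k < length xs" "xs ! k = \<psi>" using \<open>\<psi> \<in> S\<close> xs by (auto simp: in_set_conv_nth)
    have "N0 * 1 \<le> N0 * length xs" by (rule mult_le_mono2) (use len in linarith)
    then have "N0 \<le> N0 * length xs + k" unfolding mult_1_right by (rule trans_le_add1)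
    moreover have "e (N0 * length xs + k) = \<psi>" using k by (simp add: e_def)
    ultimately show ?thesis by blast
  qed
  obtain \<delta>Y where \<delta>Y: "\<delta>Y < epsilon0" "\<And>a b. top_interval a b \<delta>Y \<Longrightarrow> \<exists>\<tau> f. labelled \<Psi> N (Suc m) a b \<Gamma> \<tau> f"
    using up unfolding realizable_def by blast
  obtain x where x: "\<mu> < x" "x < epsilon0" "orank x = \<delta>Y" using ex_orank_below_epsilon0[OF \<mu>e \<delta>Y(1)] by blast
  define \<beta> where "\<beta> = next_rank \<delta>Y \<mu>"
  have \<beta>: "top_interval \<mu> \<beta> \<delta>Y" "\<beta> \<le> x" using next_rank[of \<mu> x \<delta>Y] x by (auto simp: \<beta>_def)
  then have \<mu>\<beta>: "\<mu> < \<beta>" by (simp add: top_interval_def)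
  obtain \<sigma>Y fY where Y: "labelled \<Psi> N (Suc m) \<mu> \<beta> \<Gamma> \<sigma>Y fY" using \<delta>Y(2)[OF \<beta>(1)] by blast
  show ?thesis
    unfolding realizable_def
  proof (intro exI[of _ \<beta>] conjI allI impI)
    show "\<beta> < epsilon0" using \<beta>(2) x(2) by simp
    fix a c assume ac: "top_interval a c \<beta>"
    then have ac': "a < c" "\<mu> < orank c" using \<mu>\<beta> by (auto simp: top_interval_def)
    obtain I :: "(cord \<times> nat) set" and lo hi where
      I1: "\<And>i. i \<in> I \<Longrightarrow> top_interval (lo i) (hi i) (d (e (snd i))) \<and> a \<le> lo i \<and> hi i \<le> c" and
      I2: "\<And>i j. i \<in> I \<Longrightarrow> j \<in> I \<Longrightarrow> i \<noteq> j \<Longrightarrow> {lo i<..hi i} \<inter> {lo j<..hi j} = {}" and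
      I3: "\<And>x. a < x \<Longrightarrow> x \<le> c \<Longrightarrow> orank x \<le> \<mu> \<Longrightarrow> \<exists>i\<in>I. x \<in> {lo i<..hi i}" and
      I4: "\<And>x y. a < x \<Longrightarrow> x \<le> c \<Longrightarrow> orank x = osuc \<mu> \<Longrightarrow> y < x \<Longrightarrow>
         \<exists>N. \<forall>n\<ge>N. \<exists>i\<in>I. snd i = n \<and> y \<le> lo i \<and> hi i < x"
    proof (rule ordinal_pieces[of "\<lambda>n. d (e n)" \<mu> a c])
      show "d (e n) \<le> \<mu>" for n by (rule d\<mu>[OF eS])
      show "\<exists>n\<ge>N0. d (e n) = \<mu>" for N0 using eex[OF \<psi>0(1), of N0] \<psi>0(2) by auto
    qed (use ac' in blast)+
    have "\<exists>\<tau> f. labelled \<Psi> N m (lo i) (hi i) (w (e (snd i))) \<tau> f" if "i \<in> I" for i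
      using d(2)[OF eS] I1[OF that] by blast
    then obtain \<sigma> F where F: "\<And>i. i \<in> I \<Longrightarrow> labelled \<Psi> N m (lo i) (hi i) (w (e (snd i))) (\<sigma> i) (F i)"
      by metis
    show "\<exists>\<tau> f. labelled \<Psi> N m a c \<Gamma> \<tau> f"
    proof (rule labelled_construction[OF \<Gamma> ac \<mu>\<beta> Y _ _ I2 I3 F])
      show "lo i < hi i \<and> a \<le> lo i \<and> hi i \<le> c" if "i \<in> I" for i
        using I1[OF that] by (simp add: top_interval_def)
      show "orank x \<le> \<mu>" if "i \<in> I" "lo i < x" "x \<le> hi i" for i x
      proof -
        have "orank x \<le> d (e (snd i))"
          using I1[OF that(1)] that(2,3) by (cases "x = hi i") (auto simp: top_interval_def less_imp_le)
        then show ?thesis using d\<mu>[OF eS] by (rule order_trans)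
      qed
      show "\<theta> \<in> w (e (snd i)) \<and> FBox m \<theta> \<in> w (e (snd i))" if "FBox m \<theta> \<in> \<Gamma>" for i \<theta>
        by (rule w(2)[OF eS that])
      show "\<exists>i\<in>I. \<psi> \<notin> w (e (snd i)) \<and> y \<le> lo i \<and> hi i < x"
        if "\<psi> \<in> \<Psi>" "FBox m \<psi> \<notin> \<Gamma>" "a < x" "x \<le> c" "orank x = osuc \<mu>" "y < x" for \<psi> x y
      proof -
        note cofinal = I4[OF that(3-6)]
        have \<psi>: "\<psi> \<in> S" using that by (simp add: S_def)
        obtain N0 where N0: "\<And>n. n \<ge> N0 \<Longrightarrow> \<exists>i\<in>I. snd i = n \<and> y \<le> lo i \<and> hi i < x"
          using cofinal by blast
        obtain n where "n \<ge> N0" "e n = \<psi>" using eex[OF \<psi>] by blast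
        then show ?thesis using N0[of n] w(1)[OF \<psi>] by auto
      qed
    qed
  qed
qed

text \<open>The outer measure \<open>Suc N - m\<close> vanishes for every m > N, where single points
  suffice. In the inner induction the hypothesis for m+1 is available for all maximal consistent
  sets.\<close>

lemma realizable_all:
  assumes "finite \<Psi>" "mcs \<Gamma>"
  shows "realizable \<Psi> N m \<Gamma>"
  using assms(2)
proof (induction "Suc N - m" arbitrary: m \<Gamma>)
  case 0
  then show ?case by (intro realizable_single) auto
next
  case (Suc k)
  have up: "realizable \<Psi> N (Suc m) \<Delta>" if "mcs \<Delta>" for \<Delta>
    using Suc.hyps(1)[of "Suc m" \<Delta>] Suc.hyps(2) that by simp
  show ?case
    using \<open>mcs \<Gamma>\<close>
  proof (induction "card {\<psi>\<in>\<Psi>. FBox m \<psi> \<notin> \<Gamma>}" arbitrary: \<Gamma> rule: less_induct)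
    case less
    show ?case
    proof (cases "{\<psi>\<in>\<Psi>. FBox m \<psi> \<notin> \<Gamma>} = {}")
      case True
      then show ?thesis using less.prems by (intro realizable_single) auto
    next
      case False
      show ?thesis
      proof (rule realizable_step[OF less.prems up[OF less.prems] assms(1) False])
        fix \<Delta> assume "mcs \<Delta>" "{\<psi>\<in>\<Psi>. FBox m \<psi> \<notin> \<Delta>} \<subset> {\<psi>\<in>\<Psi>. FBox m \<psi> \<notin> \<Gamma>}"
        moreover from this(2) have "card {\<psi>\<in>\<Psi>. FBox m \<psi> \<notin> \<Delta>} < card {\<psi>\<in>\<Psi>. FBox m \<psi> \<notin> \<Gamma>}"
          by (rule psubset_card_mono[rotated]) (use assms(1) in simp)
        ultimately show "realizable \<Psi> N m \<Delta>" using less.hyps by blast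
      qed
    qed
  qed
qed

section \<open>Soundness and completeness\<close>

text \<open>Allows the countermodels for all underivable formulas to be lined up in one sequence of
  intervals below \<epsilon>0.\<close>

instance fm :: countable
  by countable_datatype

lemma truth_subset: "(\<And>p. v p \<subseteq> X) \<Longrightarrow> truth X \<tau> v \<phi> \<subseteq> X"
  by (induction \<phi>) auto

lemma truth_FImp: "x \<in> X \<Longrightarrow> x \<in> truth X \<tau> v (FImp \<phi> \<psi>) \<longleftrightarrow> (x \<in> truth X \<tau> v \<phi> \<longrightarrow> x \<in> truth X \<tau> v \<psi>)"
  by (auto simp: FImp_def)

lemma truth_FBox:
  assumes "topspace (\<tau> n) = X" "x \<in> X"
  shows "x \<in> truth X \<tau> v (FBox n \<phi>) \<longleftrightarrow> (\<exists>U. openin (\<tau> n) U \<and> x \<in> U \<and> (\<forall>y\<in>U. y \<noteq> x \<longrightarrow> y \<in> truth X \<tau> v \<phi>))"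
proof
  assume "x \<in> truth X \<tau> v (FBox n \<phi>)"
  then obtain U where U: "openin (\<tau> n) U" "x \<in> U" "\<And>y. y \<noteq> x \<Longrightarrow> y \<in> X - truth X \<tau> v \<phi> \<Longrightarrow> y \<notin> U"
    using assms by (auto simp: in_derived_set_of)
  have "y \<in> truth X \<tau> v \<phi>" if "y \<in> U" "y \<noteq> x" for y
    using U(3)[OF that(2)] that(1) openin_subset[OF U(1)] assms(1) by auto
  then show "\<exists>U. openin (\<tau> n) U \<and> x \<in> U \<and> (\<forall>y\<in>U. y \<noteq> x \<longrightarrow> y \<in> truth X \<tau> v \<phi>)" using U by blast
next
  assume "\<exists>U. openin (\<tau> n) U \<and> x \<in> U \<and> (\<forall>y\<in>U. y \<noteq> x \<longrightarrow> y \<in> truth X \<tau> v \<phi>)"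
  then obtain U where U: "openin (\<tau> n) U" "x \<in> U" "\<And>y. y \<in> U \<Longrightarrow> y \<noteq> x \<Longrightarrow> y \<in> truth X \<tau> v \<phi>" by blast
  have "x \<notin> (\<tau> n) derived_set_of (X - truth X \<tau> v \<phi>)"
  proof
    assume d: "x \<in> (\<tau> n) derived_set_of (X - truth X \<tau> v \<phi>)"
    from derived_setD[OF d U(1,2)] U(3) show False by blast
  qed
  then show "x \<in> truth X \<tau> v (FBox n \<phi>)" using assms(2) by simp
qed

text \<open>Loeb's axiom is induction on the rank within a neighbourhood where x has the strictly
  largest rank. Axiom (iv) holds because the topologies increase, axiom (v) because derived sets for
  \<tau> m are open in \<tau> (m+1) and all later topologies.\<close>

lemma GLP_sound:
  assumes "GLP \<phi>" and \<tau>: "lmes T r \<tau>" and X: "X = topspace T" and v: "\<And>p. v p \<subseteq> X" and "x \<in> X"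
  shows "x \<in> truth X \<tau> v \<phi>"
  using assms(1,5)
proof (induction arbitrary: x rule: GLP.induct)
  case (taut \<phi>)
  have "bool_eval (\<lambda>\<psi>. x \<in> truth X \<tau> v \<psi>) \<psi> \<longleftrightarrow> x \<in> truth X \<tau> v \<psi>" for \<psi>
    using taut.prems by (induction \<psi>) auto
  then show ?case using taut.hyps unfolding tautology_def by blast
next
  case (distr n \<phi> \<psi>)
  have top: "topspace (\<tau> n) = X" using lmes_topspace[OF \<tau>] X by simp
  note box = truth_FBox[of \<tau>, OF top distr.prems]
  show ?case
    unfolding truth_FImp[OF distr.prems]
  proof (intro impI)
    assume "x \<in> truth X \<tau> v (FBox n (FImp \<phi> \<psi>))" "x \<in> truth X \<tau> v (FBox n \<phi>)"
    then obtain U V where U: "openin (\<tau> n) U" "x \<in> U" "\<forall>y\<in>U. y \<noteq> x \<longrightarrow> y \<in> truth X \<tau> v (FImp \<phi> \<psi>)"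
      and V: "openin (\<tau> n) V" "x \<in> V" "\<forall>y\<in>V. y \<noteq> x \<longrightarrow> y \<in> truth X \<tau> v \<phi>"
      unfolding box by (elim exE conjE)
    have "y \<in> truth X \<tau> v \<psi>" if "y \<in> U \<inter> V" "y \<noteq> x" for y
    proof -
      have "y \<in> X" using that openin_subset[OF U(1)] top by blast
      then show ?thesis using U(3) V(3) that truth_FImp[of y X \<tau> v \<phi> \<psi>] by blast
    qed
    then show "x \<in> truth X \<tau> v (FBox n \<psi>)"
      unfolding box using U V by (intro exI[of _ "U \<inter> V"]) auto
  qed
next
  case (loeb n \<phi>)
  have top: "topspace (\<tau> n) = X" using lmes_topspace[OF \<tau>] X by simp
  define s where "s = (orank ^^ n) \<circ> r"
  have s: "is_rank (\<tau> n) s" unfolding s_def by (rule lmesD(3)[OF \<tau>])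
  show ?case
    unfolding truth_FImp[OF loeb.prems]
  proof
    assume "x \<in> truth X \<tau> v (FBox n (FImp (FBox n \<phi>) \<phi>))"
    then obtain U0 where U0: "openin (\<tau> n) U0" "x \<in> U0" "\<forall>y\<in>U0. y \<noteq> x \<longrightarrow> y \<in> truth X \<tau> v (FImp (FBox n \<phi>) \<phi>)"
      unfolding truth_FBox[of \<tau>, OF top loeb.prems] by (elim exE conjE)
    obtain U where U: "openin (\<tau> n) U" "x \<in> U" "U \<subseteq> U0" "\<And>y. y \<in> U \<Longrightarrow> y \<noteq> x \<Longrightarrow> s y < s x"
      using is_rank_nbhd[OF s U0(1,2)] by metis
    have "y \<in> truth X \<tau> v \<phi>" if "y \<in> U" "y \<noteq> x" for y
      using that
    proof (induction "s y" arbitrary: y rule: less_induct)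
      case less
      have yX: "y \<in> X" using less.prems openin_subset[OF U(1)] top by blast
      obtain W where W: "openin (\<tau> n) W" "y \<in> W" "W \<subseteq> U" "\<And>z. z \<in> W \<Longrightarrow> z \<noteq> y \<Longrightarrow> s z < s y"
        using is_rank_nbhd[OF s U(1) less.prems(1)] by metis
      have "z \<in> truth X \<tau> v \<phi>" if "z \<in> W" "z \<noteq> y" for z
        using less.hyps[of z] W(3,4) that U(4)[OF less.prems] by force
      then have "y \<in> truth X \<tau> v (FBox n \<phi>)"
        unfolding truth_FBox[of \<tau>, OF top yX] using W by (intro exI[of _ W]) auto
      moreover have "y \<in> truth X \<tau> v (FImp (FBox n \<phi>) \<phi>)" using U0(3) U(3) less.prems by blast
      ultimately show ?case unfolding truth_FImp[OF yX] by blast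
    qed
    then show "x \<in> truth X \<tau> v (FBox n \<phi>)"
      unfolding truth_FBox[of \<tau>, OF top loeb.prems] using U by (intro exI[of _ U]) auto
  qed
next
  case (mono_box m n \<phi>)
  have top: "topspace (\<tau> n) = X" for n using lmes_topspace[OF \<tau>] X by simp
  show ?case
    unfolding truth_FImp[OF mono_box.prems] truth_FBox[of \<tau>, OF top mono_box.prems]
    using lmes_mono[OF \<tau> less_imp_le[OF mono_box.hyps]] by blast
next
  case (dia_box m n \<phi>)
  have top: "topspace (\<tau> n) = X" for n using lmes_topspace[OF \<tau>] X by simp
  let ?d = "(\<tau> m) derived_set_of (truth X \<tau> v \<phi>)"
  have dia: "truth X \<tau> v (FDia m \<phi>) = ?d" by (rule truth_FDia[OF top v])
  have "openin (plus_topology (\<tau> m)) ?d"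
    by (rule plus_topology_derived) (use truth_subset[of v X] v top in auto)
  then have "openin (\<tau> (Suc m)) ?d" by (rule lextD(3)[OF lmesD(4)[OF \<tau>]])
  then have "openin (\<tau> n) ?d" by (rule lmes_mono[OF \<tau>, rotated]) (use dia_box.hyps in simp)
  then show ?case
    unfolding truth_FImp[OF dia_box.prems] truth_FBox[of \<tau>, OF top dia_box.prems] dia by blast
next
  case (mp \<phi> \<psi>)
  then show ?case using truth_FImp[of x X \<tau> v \<phi> \<psi>] by blast
next
  case (nec \<phi> n)
  have top: "topspace (\<tau> n) = X" using lmes_topspace[OF \<tau>] X by simp
  show ?case
    unfolding truth_FBox[of \<tau>, OF top nec.prems]
    using nec.IH nec.prems top by (intro exI[of _ X]) (metis openin_topspace)
qed

primrec subs :: "fm \<Rightarrow> fm set" where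
  "subs (FVar p) = {FVar p}"
| "subs FBot = {FBot}"
| "subs (FNeg \<phi>) = insert (FNeg \<phi>) (subs \<phi>)"
| "subs (FOr \<phi> \<psi>) = insert (FOr \<phi> \<psi>) (subs \<phi> \<union> subs \<psi>)"
| "subs (FBox n \<phi>) = insert (FBox n \<phi>) (subs \<phi>)"

primrec max_modality :: "fm \<Rightarrow> nat" where
  "max_modality (FVar p) = 0"
| "max_modality FBot = 0"
| "max_modality (FNeg \<phi>) = max_modality \<phi>"
| "max_modality (FOr \<phi> \<psi>) = max (max_modality \<phi>) (max_modality \<psi>)"
| "max_modality (FBox n \<phi>) = max n (max_modality \<phi>)"

lemma finite_subs: "finite (subs \<phi>)"
  by (induction \<phi>) auto

lemma self_in_subs: "\<phi> \<in> subs \<phi>"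
  by (cases \<phi>) auto

text \<open>The truth lemma inside a larger space. Limit points are a local matter, so truth on the
  open interval depends neither on the rest of \<open>X\<close> nor on the valuation there.\<close>

lemma truth_labelled:
  assumes f: "labelled \<Psi> N 0 a b \<Gamma> \<sigma> f" and ab: "{a<..b} \<subseteq> X"
    and \<tau>: "\<And>n. openin (\<tau> n) {a<..b}" "\<And>n. subtopology (\<tau> n) {a<..b} = \<sigma> n"
  defines "v \<equiv> \<lambda>p. {x\<in>{a<..b}. FVar p \<in> f x}"
  shows "subs \<phi> \<subseteq> \<Psi> \<Longrightarrow> max_modality \<phi> \<le> N \<Longrightarrow> x \<in> {a<..b} \<Longrightarrow> x \<in> truth X \<tau> v \<phi> \<longleftrightarrow> \<phi> \<in> f x"
proof (induction \<phi> arbitrary: x)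
  case (FVar p)
  then show ?case by (simp add: v_def)
next
  case FBot
  then show ?case using labelledD(3)[OF f] by (simp add: mcs_def)
next
  case (FNeg \<phi>)
  then show ?case using mcs_FNeg[OF labelledD(3)[OF f FNeg.prems(3)]] ab by auto
next
  case (FOr \<phi> \<psi>)
  then show ?case using mcs_FOr[OF labelledD(3)[OF f FOr.prems(3)]] by auto
next
  case (FBox n \<phi>)
  have IH: "y \<in> truth X \<tau> v \<phi> \<longleftrightarrow> \<phi> \<in> f y" if "y \<in> {a<..b}" for y
    by (rule FBox.IH) (use FBox.prems that in auto)
  have \<phi>: "\<phi> \<in> \<Psi>" "0 + n \<le> N" using FBox.prems self_in_subs by auto
  have "(X - truth X \<tau> v \<phi>) \<inter> {a<..b} = {y\<in>{a<..b}. \<phi> \<notin> f y}" using IH ab by blast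
  then have "x \<in> (\<tau> n) derived_set_of (X - truth X \<tau> v \<phi>) \<longleftrightarrow> x \<in> (\<sigma> n) derived_set_of {y\<in>{a<..b}. \<phi> \<notin> f y}"
    using derived_set_of_open_subtopology[OF \<tau>(1) FBox.prems(3), of n] \<tau>(2) by simp
  then show ?case using labelledD(5)[OF f \<phi> FBox.prems(3)] FBox.prems(3) ab by auto
qed

section \<open>Return to the definitions of \<open>l_extension\<close>, \<open>l_maximal\<close> and
  \<open>lme_space\<close>\<close>

lemma is_rank_cong:
  assumes "is_rank T r" "\<And>x. x \<in> topspace T \<Longrightarrow> r x = r' x"
  shows "is_rank T r'"
  unfolding is_rank_def
proof (intro conjI allI impI ballI)
  fix U x \<beta> assume *: "openin T U \<and> x \<in> U \<and> \<beta> < r' x"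
  then have U: "U \<subseteq> topspace T" using openin_subset by blast
  then have "\<beta> < r x" using * assms(2) by auto
  then obtain y where "y \<in> U" "r y = \<beta>" using is_rank_lower[OF assms(1)] * by blast
  moreover from this have "r y = r' y" using U assms(2) by blast
  ultimately show "\<exists>y\<in>U. r' y = \<beta>" by auto
next
  fix x assume x: "x \<in> topspace T"
  obtain U where U: "openin T U" "x \<in> U" "\<And>y. y \<in> U \<Longrightarrow> y \<noteq> x \<Longrightarrow> r y < r x"
    using is_rank_nbhd[OF assms(1) openin_topspace x] by metis
  have "r' y < r' x" if "y \<in> U" "y \<noteq> x" for y
    using U(3)[OF that] assms(2) x that(1) openin_subset[OF U(1)] by auto
  then show "\<exists>U. openin T U \<and> x \<in> U \<and> (\<forall>y\<in>U. y \<noteq> x \<longrightarrow> r' y < r' x)" using U by blast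
qed

lemma lext_l_extension:
  assumes "is_rank T r" "lext S T r"
  shows "l_extension S T"
proof -
  note S = lextD[OF assms(2)]
  have r: "rank_fn T x = r x" "rank_fn S x = r x" if "x \<in> topspace T" for x
    using is_rank_rank_fn[OF assms(1)] is_rank_rank_fn[OF S(1)] S(2) that by auto
  have "\<exists>V. openin T V \<and> x \<in> V \<and> V \<subseteq> U" if "openin S U \<and> x \<in> U \<and> \<not> limit_ordinal (rank_fn T x)" for U x
  proof -
    have "x \<in> topspace T" using that openin_subset[of S U] S(2) by auto
    then show ?thesis using S(4)[of U x] that r by simp
  qed
  then show ?thesis
    unfolding l_extension_def rank_preserving_extension_def extends_def
    using is_rank_scattered[OF assms(1)] is_rank_scattered[OF S(1)] S(2,3) r by auto
qed

text \<open>A competitor \<open>S\<close> is scattered on a countable carrier, hence has a rank in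
  the local sense, which agrees with \<open>r\<close> by preservation of ranks. Then
  \<open>S\<close> is an extension in the sense of \<open>lext\<close>, and
  \<open>lmax_lext_eq\<close> applies.\<close>

lemma lmax_l_maximal:
  assumes T: "is_rank T r" "lmax T r" and c: "countable (topspace T)"
  shows "l_maximal T"
  unfolding l_maximal_def
proof (intro conjI allI impI)
  show "scattered T" by (rule is_rank_scattered[OF T(1)])
  fix S assume "l_extension S T"
  then have S: "scattered S" "topspace S = topspace T" "\<And>U. openin T U \<Longrightarrow> openin S U"
    "\<And>x. x \<in> topspace T \<Longrightarrow> rank_fn S x = rank_fn T x"
    and nb: "\<And>U x. openin S U \<and> x \<in> U \<and> \<not> limit_ordinal (rank_fn T x) \<Longrightarrow> \<exists>V. openin T V \<and> x \<in> V \<and> V \<subseteq> U"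
    unfolding l_extension_def rank_preserving_extension_def extends_def by blast+
  have r: "rank_fn T x = r x" if "x \<in> topspace T" for x by (rule is_rank_rank_fn[OF T(1) that])
  have "is_rank S (rank_fn S)" by (rule scattered_is_rank) (use S c in auto)
  then have "is_rank S r" by (rule is_rank_cong) (use S r in auto)
  moreover have "\<exists>V. openin T V \<and> x \<in> V \<and> V \<subseteq> U" if "openin S U \<and> x \<in> U \<and> \<not> limit_ordinal (r x)" for U x
  proof (rule nb)
    have "x \<in> topspace T" using that openin_subset[of S U] S(2) by auto
    then show "openin S U \<and> x \<in> U \<and> \<not> limit_ordinal (rank_fn T x)" using that r by simp
  qed
  ultimately have "lext S T r" unfolding lext_def using S by simp
  then show "S = T" by (rule lmax_lext_eq[OF T(2,1)])
qed

lemma lmes_lme_space: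
  assumes T: "is_rank T r" and \<tau>: "lmes T r \<tau>" and c: "countable (topspace T)"
  shows "lme_space T \<tau>"
  unfolding lme_space_def
proof (intro conjI allI)
  show "scattered T" by (rule is_rank_scattered[OF T])
  show "l_extension (\<tau> 0) T" by (rule lext_l_extension[OF T lmesD(1)[OF \<tau>]])
  have max: "l_maximal (\<tau> n)" for n
    by (rule lmax_l_maximal[OF lmesD(3)[OF \<tau>] lmesD(2)[OF \<tau>]]) (use c lmes_topspace[OF \<tau>] in simp)
  then show "l_maximal (\<tau> 0)" .
  fix n
  show "l_maximal (\<tau> (Suc n))" by (rule max)
  have "is_rank (plus_topology (\<tau> n)) ((orank ^^ Suc n) \<circ> r)"
    using is_rank_plus[OF lmesD(3)[OF \<tau>] lmesD(2)[OF \<tau>]] by (simp add: comp_assoc)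
  then show "l_extension (\<tau> (Suc n)) (plus_topology (\<tau> n))"
    by (rule lext_l_extension) (rule lmesD(4)[OF \<tau>])
qed

theorem theorem6p10:
  shows "\<exists>\<tau> :: nat \<Rightarrow> cord topology.
           ordinal_lme_space {..<epsilon0} \<tau> \<and>
           Log {..<epsilon0} \<tau> = {\<phi>. GLP \<phi>}"
proof -
  let ?X = "{..<epsilon0}"
  let ?T = "subtopology otop ?X"
  define \<phi> where "\<phi> = (from_nat :: nat \<Rightarrow> fm)"
  define I where "I = {k. \<not> GLP (\<phi> k)}"
  have "\<exists>\<Gamma>. mcs \<Gamma> \<and> \<phi> k \<notin> \<Gamma>" if "k \<in> I" for k
  proof -
    have "glp_theory {\<psi>. GLP \<psi>}" unfolding glp_theory_def using GLP.mp by blast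
    moreover have "\<phi> k \<notin> {\<psi>. GLP \<psi>}" using that by (simp add: I_def)
    ultimately obtain \<Gamma> where "mcs \<Gamma>" "\<phi> k \<notin> \<Gamma>" using ex_mcs by metis
    then show ?thesis by blast
  qed
  then obtain \<Gamma> where \<Gamma>: "\<And>k. k \<in> I \<Longrightarrow> mcs (\<Gamma> k)" "\<And>k. k \<in> I \<Longrightarrow> \<phi> k \<notin> \<Gamma> k" by metis
  have "realizable (subs (\<phi> k)) (max_modality (\<phi> k)) 0 (\<Gamma> k)" if "k \<in> I" for k
    by (rule realizable_all[OF finite_subs \<Gamma>(1)[OF that]])
  \<comment> \<open>Indices of derivable formulas also get a rank below \<epsilon>0, so that the
    intervals can be numbered by all k.\<close>
  then have "\<exists>\<delta>. \<delta> < epsilon0 \<and> (k \<in> I \<longrightarrow> (\<forall>a b. top_interval a b \<delta> \<longrightarrow>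
      (\<exists>\<tau> f. labelled (subs (\<phi> k)) (max_modality (\<phi> k)) 0 a b (\<Gamma> k) \<tau> f)))" for k
    unfolding realizable_def using epsilon0_pos by (cases "k \<in> I") auto
  then obtain \<delta> where \<delta>: "\<And>k. \<delta> k < epsilon0" "\<And>k a b. k \<in> I \<Longrightarrow> top_interval a b (\<delta> k) \<Longrightarrow>
      \<exists>\<tau> f. labelled (subs (\<phi> k)) (max_modality (\<phi> k)) 0 a b (\<Gamma> k) \<tau> f"
    by metis
  \<comment> \<open>The k-th countermodel occupies (b k, b (k+1)]. The intervals do not cover
    \<epsilon>0, since 0 lies in none of them; gluing completes the topologies on the rest, where
    soundness still guarantees the theorems of GLP.\<close>
  define b where "b = cuts \<delta> 0"
  have step: "top_interval p (next_rank (\<delta> n) p) (\<delta> n) \<and> next_rank (\<delta> n) p < epsilon0" if "p < epsilon0" for p n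
  proof -
    obtain x where "p < x" "x < epsilon0" "orank x = \<delta> n"
      using ex_orank_below_epsilon0[OF \<open>p < epsilon0\<close> \<delta>(1)] by blast
    then show ?thesis using next_rank[of p x "\<delta> n"] by auto
  qed
  have be: "b n < epsilon0" for n
    unfolding b_def by (induction n) (use epsilon0_pos step in auto)
  have bt: "top_interval (b n) (b (Suc n)) (\<delta> n)" for n
    using step[OF be[of n], of n] by (simp add: b_def)
  have bS: "b n < b (Suc n)" for n using bt[of n] by (simp add: top_interval_def)
  have bm: "b m \<le> b n" if "m \<le> n" for m n
    by (rule lift_Suc_mono_le[of b]) (use bS that in \<open>auto simp: less_imp_le\<close>)
  define D where "D = (\<lambda>k. {b k<..b (Suc k)})"
  have DX: "D k \<subseteq> ?X" for k using be[of "Suc k"] by (auto simp: D_def)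
  have "\<exists>\<tau> f. labelled (subs (\<phi> k)) (max_modality (\<phi> k)) 0 (b k) (b (Suc k)) (\<Gamma> k) \<tau> f" if "k \<in> I" for k
    by (rule \<delta>(2)[OF that bt])
  then obtain \<sigma> f where f: "\<And>k. k \<in> I \<Longrightarrow>
      labelled (subs (\<phi> k)) (max_modality (\<phi> k)) 0 (b k) (b (Suc k)) (\<Gamma> k) (\<sigma> k) (f k)"
    by metis
  have T: "is_rank ?T orank" by (rule is_rank_subtopology[OF is_rank_otop openin_otop_lessThan])
  have Dopen: "openin ?T (D k)" for k
    using openin_open_subtopology[OF openin_otop_lessThan] DX[of k] openin_otop_interval by (auto simp: D_def)
  have Dtop: "subtopology ?T (D k) = iv (b k) (b (Suc k))" for k
  proof -
    have "?X \<inter> D k = {b k<..b (Suc k)}" using DX[of k] by (auto simp: D_def)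
    then show ?thesis by (simp only: subtopology_subtopology)
  qed
  obtain \<tau> where \<tau>: "lmes ?T orank \<tau>" "\<And>n k. k \<in> I \<Longrightarrow> subtopology (\<tau> n) (D k) = \<sigma> k n"
  proof (rule lmes_glue_family[OF T, of I D \<sigma>])
    show "D i \<inter> D j = {}" if "i \<noteq> j" for i j
    proof -
      have "b (Suc i) \<le> b j \<or> b (Suc j) \<le> b i" using bm[of "Suc i" j] bm[of "Suc j" i] that by (cases "i < j") auto
      then show ?thesis by (auto simp: D_def)
    qed
    show "D k \<noteq> {}" for k using bS[of k] by (auto simp: D_def)
    show "lmes (subtopology ?T (D k)) orank (\<sigma> k)" if "k \<in> I" for k
      unfolding Dtop by (rule labelledD(1)[OF f[OF that]])
  qed (use Dopen in blast)+
  have top: "topspace ?T = ?X" by simp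
  have "lme_space ?T \<tau>"
    by (rule lmes_lme_space[OF T \<tau>(1)]) (use countable_lessThan_cord in simp)
  then have "ordinal_lme_space ?X \<tau>"
    unfolding ordinal_lme_space_def order_topology_on_epsilon0
    by (intro conjI exI[of _ 0] exI[of _ epsilon0]) (auto simp: atLeastLessThan_def)
  moreover have "valid_in ?X \<tau> \<psi> \<longleftrightarrow> GLP \<psi>" for \<psi>
  proof
    assume "GLP \<psi>"
    then show "valid_in ?X \<tau> \<psi>"
      unfolding valid_in_def using GLP_sound[OF _ \<tau>(1) top[symmetric]] truth_subset by blast
  next
    assume valid: "valid_in ?X \<tau> \<psi>"
    show "GLP \<psi>"
    proof (rule ccontr)
      assume "\<not> GLP \<psi>"
      moreover obtain k where k: "\<phi> k = \<psi>" unfolding \<phi>_def by (metis from_nat_to_nat)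
      ultimately have kI: "k \<in> I" by (simp add: I_def)
      let ?v = "\<lambda>p. {x\<in>{b k<..b (Suc k)}. FVar p \<in> f k x}"
      have bk: "b (Suc k) \<in> {b k<..b (Suc k)}" using bS[of k] by simp
      have "openin (\<tau> n) {b k<..b (Suc k)}" for n
        using lmes_base_mono[OF \<tau>(1) Dopen[of k]] by (simp add: D_def)
      then have "b (Suc k) \<in> truth ?X \<tau> ?v (\<phi> k) \<longleftrightarrow> \<phi> k \<in> f k (b (Suc k))"
        using truth_labelled[OF f[OF kI], of ?X \<tau> "\<phi> k"] DX[of k] \<tau>(2)[OF kI] bk by (simp add: D_def)
      moreover have "\<phi> k \<notin> f k (b (Suc k))" using labelledD(2)[OF f[OF kI]] \<Gamma>(2)[OF kI] by simp
      moreover have "truth ?X \<tau> ?v (\<phi> k) = ?X"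
      proof -
        have sub: "\<forall>p. ?v p \<subseteq> ?X" using DX[of k] by (auto simp: D_def)
        from HOL.mp[OF spec[OF valid[unfolded valid_in_def], of ?v] sub] show ?thesis unfolding k .
      qed
      ultimately show False using be[of "Suc k"] by simp
    qed
  qed
  then have "Log ?X \<tau> = {\<phi>. GLP \<phi>}" by (simp add: Log_def)
  ultimately show ?thesis by blast
qed

end
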